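(* Let $p$ be a prime and let $G$ be a pro-$p$ group with a mild flag presentation $G\simeq\langle x_1,\dots,x_n,g\mid [x_i,g]=h_i\in\Phi(\widetilde N),\ 1\le i\le l\rangle$. Let $\Lambda=\mathbb{F}_p\langle\{a_{i,j}\}\rangle$ with its associated automorphism $\sigma$ of $\Lambda[\![t]\!]$ and $\delta=\sigma-\operatorname{id}$, and let $\mathcal{D}$ be the universal division $\Lambda$-ring of fractions. Then the maps $\sigma$ and $\delta$ extend from $\Lambda[\![t]\!]$ to an automorphism $\sigma$ of $\mathcal{D}[\![t]\!]$ and a $\sigma$-derivation $\delta=\sigma-\operatorname{id}$ of $\mathcal{D}[\![t]\!]$. Moreover, $\delta(\mathcal{D}[\![t]\!])\subseteq t\mathcal{D}[\![t]\!]$, and thus there is an embedding $\Lambda[\![t]\!][\![s;\sigma,\delta]\!]\hookrightarrow\mathcal{D}[\![t]\!][\![s;\sigma,\delta]\!]$.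
   Context: Commutators are $[a,b]=a^{-1}b^{-1}ab$, left-normed. In the mild flag presentation, $0\le l\le n$, $G$ is the quotient of the free pro-$p$ group $F$ on $x_1,\dots,x_n,g$ by the relations $[x_i,g]=h_i$ ($1\le i\le l$), $\widetilde N$ is the closed normal subgroup of $F$ generated by $x_1,\dots,x_n$, and $\Phi$ is the Frattini subgroup. Let $N$ be the closed normal subgroup of $G$ generated by $x_1,\dots,x_n$; then $G/N\simeq\mathbb{Z}_p$ and $N$ is free pro-$p$ on the elements $x_{i,j}=[x_i,g,\dots,g]$ ($j$ copies of $g$), $1\le i\le n$, $j\ge0$, with $j=0$ if $i\le l$. Put $S=\mathbb{F}_p[\![G]\!]$, $R=\mathbb{F}_p[\![N]\!]$, $I_G$ the augmentation ideal of $S$, $w(a)=p^{-\sup\{k\ge0\,:\,a\in I_G^k\}}$ and $w_{i,j}=-\log_p w(x_{i,j}-1)$. On $R$, $\sigma(x)=g^{-1}xg$. $\Lambda$ is the free associative $\mathbb{F}_p$-algebra on variables $a_{i,j}$ indexed as the $x_{i,j}$, $t$ is a central variable, and $\iota:R\hookrightarrow\Lambda[\![t]\!]$ is the continuous embedding with $x_{i,j}-1\mapsto a_{i,j}t^{w_{i,j}}$. On $\Lambda[\![t]\!]$, $\sigma$ is the automorphism with $\sigma(t)=t$ and $\sigma(a_{i,j})=\iota(\sigma(x_{i,j}-1))/t^{w_{i,j}}$, and $\delta=\sigma-\operatorname{id}$ satisfies $\delta(\Lambda[\![t]\!])\subseteq t\Lambda[\![t]\!]$. $\mathcal{D}$: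 the free algebra $\Lambda$ is a Sylvester domain, and $\mathcal{D}$ is the division ring containing $\Lambda$, generated by it as a division ring, over which every full matrix over $\Lambda$ (an $n\times n$ matrix that is not a product of an $n\times k$ and a $k\times n$ matrix over $\Lambda$ with $k<n$) is invertible; any ring homomorphism from $\Lambda$ inverting all full matrices extends uniquely to $\mathcal{D}$. Power series rings in $t$ have the $t$-adic topology. For a complete topological ring $A$ with continuous automorphism $\sigma$ and $\delta=\sigma-\operatorname{id}$ topologically nilpotent ($\delta^k\to0$ pointwise), $A[\![s;\sigma,\delta]\!]$ is the set of formal series $\sum_{i\ge0}s^ia_i$ ($a_i\in A$) with multiplication $$\Big(\sum_i s^ia_i\Big)\Big(\sum_j s^jb_j\Big)=\sum_{m\ge0}s^m\Big(\sum_{n=0}^m\sum_{k\ge n}\tbinom{k}{n}\delta^{k-n}(\sigma^n(a_{m-n}))b_k\Big).$$ *)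

theory Defs
  imports
    "HOL-Algebra.Ideal_Product"
    "HOL-Algebra.Subrings"
    "HOL-Number_Theory.Residues"
    "HOL-Analysis.T1_Spaces"
    "HOL-Analysis.Abstract_Limits"
    "HOL-Analysis.Product_Topology"
    "HOL-Analysis.Function_Topology"
begin

section \<open>Pro-p groups\<close>

definition topological_group :: "'g monoid \<Rightarrow> 'g topology \<Rightarrow> bool" where
  "topological_group G T \<longleftrightarrow>
     group G \<and> topspace T = carrier G \<and>
     continuous_map (prod_topology T T) T (\<lambda>(x, y). x \<otimes>\<^bsub>G\<^esub> y) \<and>
     continuous_map T T (\<lambda>x. inv\<^bsub>G\<^esub> x)"

definition open_normals :: "'g monoid \<Rightarrow> 'g topology \<Rightarrow> 'g set set" where
  "open_normals G T = {U. U \<lhd> G \<and> openin T U}"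

definition pro_p_group :: "nat \<Rightarrow> 'g monoid \<Rightarrow> 'g topology \<Rightarrow> bool" where
  "pro_p_group p G T \<longleftrightarrow>
     topological_group G T \<and> compact_space T \<and> Hausdorff_space T \<and>
     (\<forall>V. openin T V \<and> \<one>\<^bsub>G\<^esub> \<in> V \<longrightarrow> (\<exists>U\<in>open_normals G T. U \<subseteq> V)) \<and>
     (\<forall>U\<in>open_normals G T. \<exists>k. order (G Mod U) = p ^ k)"

text \<open>
  Universal property of the free pro-p group on a finite family.  It is tested against finite
  p-groups only (pro-p groups are inverse limits of those); every finite group has an isomorphic
  copy with carrier in \<^typ>\<open>nat\<close>.  Uniqueness of \<open>\<theta>\<close> expresses topological generation.
\<close>

definition free_pro_p_group :: "nat \<Rightarrow> 'f monoid \<Rightarrow> 'f topology \<Rightarrow> 'i set \<Rightarrow> ('i \<Rightarrow> 'f) \<Rightarrow> bool" where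
  "free_pro_p_group p F T I b \<longleftrightarrow>
     finite I \<and> pro_p_group p F T \<and> b \<in> I \<rightarrow> carrier F \<and>
     (\<forall>(P :: nat monoid) c. group P \<and> (\<exists>k. order P = p ^ k) \<and> c \<in> I \<rightarrow> carrier P \<longrightarrow>
        (\<exists>\<theta>. \<theta> \<in> hom F P \<and> continuous_map T (discrete_topology (carrier P)) \<theta> \<and>
             (\<forall>i\<in>I. \<theta> (b i) = c i) \<and>
             (\<forall>\<theta>'. \<theta>' \<in> hom F P \<and> continuous_map T (discrete_topology (carrier P)) \<theta>' \<and>
                   (\<forall>i\<in>I. \<theta>' (b i) = c i) \<longrightarrow> (\<forall>y\<in>carrier F. \<theta>' y = \<theta> y))))"

definition closed_normal_closure :: "'g monoid \<Rightarrow> 'g topology \<Rightarrow> 'g set \<Rightarrow> 'g set" where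
  "closed_normal_closure G T X = \<Inter>{H. H \<lhd> G \<and> closedin T H \<and> X \<subseteq> H}"

definition maximal_open_subgroup :: "'g monoid \<Rightarrow> 'g topology \<Rightarrow> 'g set \<Rightarrow> bool" where
  "maximal_open_subgroup G T M \<longleftrightarrow>
     subgroup M G \<and> openin T M \<and> M \<noteq> carrier G \<and>
     (\<forall>L. subgroup L G \<and> M \<subseteq> L \<longrightarrow> L = M \<or> L = carrier G)"

definition frattini_subgroup :: "'g monoid \<Rightarrow> 'g topology \<Rightarrow> 'g set" where
  "frattini_subgroup G T = {x \<in> carrier G. \<forall>M. maximal_open_subgroup G T M \<longrightarrow> x \<in> M}"

definition commutator :: "'g monoid \<Rightarrow> 'g \<Rightarrow> 'g \<Rightarrow> 'g" where
  "commutator G a b = inv\<^bsub>G\<^esub> a \<otimes>\<^bsub>G\<^esub> inv\<^bsub>G\<^esub> b \<otimes>\<^bsub>G\<^esub> a \<otimes>\<^bsub>G\<^esub> b"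


section \<open>Mild flag presentations\<close>

text \<open>
  The free generators \<open>X\<^sub>1, \<dots>, X\<^sub>n\<close> and \<open>\<gamma>\<close> of \<open>F\<close> are indexed by \<^typ>\<open>nat option\<close>, with
  \<^const>\<open>None\<close> for \<open>\<gamma>\<close>.  The isomorphism of \<open>G\<close> with the presented group is given as a continuous
  surjection \<open>\<pi>\<close> whose kernel is the closed normal closure of the relators; by compactness the
  induced bijective homomorphism is a homeomorphism.
\<close>

definition mild_flag_presentation ::
  "nat \<Rightarrow> nat \<Rightarrow> nat \<Rightarrow> 'f monoid \<Rightarrow> 'f topology \<Rightarrow> (nat \<Rightarrow> 'f) \<Rightarrow> 'f \<Rightarrow> (nat \<Rightarrow> 'f) \<Rightarrow>
   'g monoid \<Rightarrow> 'g topology \<Rightarrow> ('f \<Rightarrow> 'g) \<Rightarrow> bool" where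
  "mild_flag_presentation p n l F TF X \<gamma> h G TG \<pi> \<longleftrightarrow>
     l \<le> n \<and>
     free_pro_p_group p F TF (insert None (Some ` {1..n})) (case_option \<gamma> X) \<and>
     (let Nt = closed_normal_closure F TF (X ` {1..n}) in
        \<forall>i\<in>{1..l}. h i \<in> frattini_subgroup (F\<lparr>carrier := Nt\<rparr>) (subtopology TF Nt)) \<and>
     pro_p_group p G TG \<and>
     \<pi> \<in> hom F G \<and> continuous_map TF TG \<pi> \<and> \<pi> ` carrier F = carrier G \<and>
     kernel F G \<pi> =
       closed_normal_closure F TF ((\<lambda>i. commutator F (X i) \<gamma> \<otimes>\<^bsub>F\<^esub> inv\<^bsub>F\<^esub> h i) ` {1..l})"

definition flag_index :: "nat \<Rightarrow> nat \<Rightarrow> (nat \<times> nat) set" where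
  "flag_index n l = {(i, j). 1 \<le> i \<and> i \<le> n \<and> (i \<le> l \<longrightarrow> j = 0)}"

definition flag_gen :: "'g monoid \<Rightarrow> (nat \<Rightarrow> 'g) \<Rightarrow> 'g \<Rightarrow> nat \<times> nat \<Rightarrow> 'g" where
  "flag_gen G x g = (\<lambda>(i, j). ((\<lambda>y. commutator G y g) ^^ j) (x i))"


section \<open>Completed group algebras\<close>

text \<open>The group algebra of a finite group \<open>H\<close>.\<close>

definition group_algebra :: "'k ring \<Rightarrow> 'h monoid \<Rightarrow> ('h \<Rightarrow> 'k) ring" where
  "group_algebra K H =
     \<lparr>carrier = carrier H \<rightarrow>\<^sub>E carrier K,
      monoid.mult = (\<lambda>f f'. \<lambda>x\<in>carrier H.
                \<Oplus>\<^bsub>K\<^esub>y\<in>carrier H. f y \<otimes>\<^bsub>K\<^esub> f' (inv\<^bsub>H\<^esub> y \<otimes>\<^bsub>H\<^esub> x)),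
      one = (\<lambda>x\<in>carrier H. if x = \<one>\<^bsub>H\<^esub> then \<one>\<^bsub>K\<^esub> else \<zero>\<^bsub>K\<^esub>),
      zero = (\<lambda>x\<in>carrier H. \<zero>\<^bsub>K\<^esub>),
      add = (\<lambda>f f'. \<lambda>x\<in>carrier H. f x \<oplus>\<^bsub>K\<^esub> f' x)\<rparr>"

text \<open>
  The inverse limit of the group algebras of the quotients by open normal subgroups: compatible
  families \<open>a\<close>, where \<open>a U\<close> is a function on the cosets of \<open>U\<close>.  For \<open>U \<subseteq> V\<close> the transition map
  adds up the coefficients of the cosets of \<open>U\<close> contained in a given coset of \<open>V\<close>.
\<close>

definition completed_group_algebra ::
  "'k ring \<Rightarrow> 'g monoid \<Rightarrow> 'g topology \<Rightarrow> ('g set \<Rightarrow> 'g set \<Rightarrow> 'k) ring" where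
  "completed_group_algebra K G T =
     \<lparr>carrier =
        {a \<in> (\<Pi>\<^sub>E U\<in>open_normals G T. carrier (group_algebra K (G Mod U))).
           \<forall>U\<in>open_normals G T. \<forall>V\<in>open_normals G T. U \<subseteq> V \<longrightarrow>
             (\<forall>C\<in>carrier (G Mod V). a V C = (\<Oplus>\<^bsub>K\<^esub>D\<in>{D \<in> carrier (G Mod U). D \<subseteq> C}. a U D))},
      monoid.mult = (\<lambda>a b. \<lambda>U\<in>open_normals G T. a U \<otimes>\<^bsub>group_algebra K (G Mod U)\<^esub> b U),
      one = (\<lambda>U\<in>open_normals G T. \<one>\<^bsub>group_algebra K (G Mod U)\<^esub>),
      zero = (\<lambda>U\<in>open_normals G T. \<zero>\<^bsub>group_algebra K (G Mod U)\<^esub>),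
      add = (\<lambda>a b. \<lambda>U\<in>open_normals G T. a U \<oplus>\<^bsub>group_algebra K (G Mod U)\<^esub> b U)\<rparr>"

definition cga_topology ::
  "'k ring \<Rightarrow> 'g monoid \<Rightarrow> 'g topology \<Rightarrow> ('g set \<Rightarrow> 'g set \<Rightarrow> 'k) topology" where
  "cga_topology K G T =
     subtopology
       (product_topology (\<lambda>U. discrete_topology (carrier (group_algebra K (G Mod U))))
          (open_normals G T))
       (carrier (completed_group_algebra K G T))"

text \<open>The image of a group element in the completed group algebra.\<close>

definition cga_of ::
  "'k ring \<Rightarrow> 'g monoid \<Rightarrow> 'g topology \<Rightarrow> 'g \<Rightarrow> 'g set \<Rightarrow> 'g set \<Rightarrow> 'k" where
  "cga_of K G T x =
     (\<lambda>U\<in>open_normals G T. \<lambda>C\<in>carrier (G Mod U). if x \<in> C then \<one>\<^bsub>K\<^esub> else \<zero>\<^bsub>K\<^esub>)"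

text \<open>
  The homomorphism of completed group algebras induced by a continuous homomorphism
  \<open>\<phi>\<close> from \<open>G\<close> to \<open>H\<close>, i.e. its continuous linear extension.
\<close>

definition cga_map ::
  "'k ring \<Rightarrow> 'g monoid \<Rightarrow> 'g topology \<Rightarrow> 'h monoid \<Rightarrow> 'h topology \<Rightarrow> ('g \<Rightarrow> 'h) \<Rightarrow>
   ('g set \<Rightarrow> 'g set \<Rightarrow> 'k) \<Rightarrow> 'h set \<Rightarrow> 'h set \<Rightarrow> 'k" where
  "cga_map K G TG H TH \<phi> a =
     (\<lambda>V\<in>open_normals H TH. \<lambda>C\<in>carrier (H Mod V).
        let U = {x \<in> carrier G. \<phi> x \<in> V}
        in \<Oplus>\<^bsub>K\<^esub>D\<in>{D \<in> carrier (G Mod U). \<phi> ` D \<subseteq> C}. a U D)"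

text \<open>
  The augmentation of \<open>a\<close> is its component at the trivial quotient \<open>G/G\<close>, whose only element is the
  coset \<^term>\<open>carrier G\<close>; by compatibility it is the sum of the coefficients of every \<open>a U\<close>.
\<close>

definition augmentation_ideal ::
  "'k ring \<Rightarrow> 'g monoid \<Rightarrow> 'g topology \<Rightarrow> ('g set \<Rightarrow> 'g set \<Rightarrow> 'k) set" where
  "augmentation_ideal K G T =
     {a \<in> carrier (completed_group_algebra K G T). a (carrier G) (carrier G) = \<zero>\<^bsub>K\<^esub>}"

primrec ideal_pow :: "'a ring \<Rightarrow> 'a set \<Rightarrow> nat \<Rightarrow> 'a set" where
  "ideal_pow R I 0 = carrier R"
| "ideal_pow R I (Suc k) = ideal_prod R (ideal_pow R I k) I"

text \<open>\<open>w(a) = p\<^bsup>-sup{k. a \<in> I\<^sub>G\<^sup>k}\<^esup>\<close>, which is 0 if the supremum is infinite.\<close>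

definition cga_w :: "nat \<Rightarrow> 'g monoid \<Rightarrow> 'g topology \<Rightarrow> ('g set \<Rightarrow> 'g set \<Rightarrow> int) \<Rightarrow> real" where
  "cga_w p G T a =
     (let K = residue_ring (int p);
          E = {k. a \<in> ideal_pow (completed_group_algebra K G T) (augmentation_ideal K G T) k}
      in if finite E then real p powr (- real (Sup E)) else 0)"

text \<open>
  The exponent \<open>-log\<^sub>p w(y - 1)\<close> of a group element \<open>y \<noteq> 1\<close>, a natural number.  (For \<open>y = 1\<close>
  it would be infinite and the value below is meaningless.)
\<close>

definition grp_weight :: "nat \<Rightarrow> 'g monoid \<Rightarrow> 'g topology \<Rightarrow> 'g \<Rightarrow> nat" where
  "grp_weight p G T y =
     (let K = residue_ring (int p); S = completed_group_algebra K G T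
      in nat \<lfloor>- log (real p) (cga_w p G T (cga_of K G T y \<ominus>\<^bsub>S\<^esub> \<one>\<^bsub>S\<^esub>))\<rfloor>)"


section \<open>Free associative algebras and power series in a central variable\<close>

text \<open>Elements are coefficient functions on words in the letters \<open>V\<close>.\<close>

definition free_algebra :: "'k ring \<Rightarrow> 'v set \<Rightarrow> ('v list \<Rightarrow> 'k) ring" where
  "free_algebra K V =
     \<lparr>carrier = {f. (\<forall>u. f u \<in> carrier K) \<and> finite {u. f u \<noteq> \<zero>\<^bsub>K\<^esub>} \<and>
                    (\<forall>u. f u \<noteq> \<zero>\<^bsub>K\<^esub> \<longrightarrow> u \<in> lists V)},
      monoid.mult = (\<lambda>f f' u. \<Oplus>\<^bsub>K\<^esub>k\<in>{..length u}. f (take k u) \<otimes>\<^bsub>K\<^esub> f' (drop k u)),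
      one = (\<lambda>u. if u = [] then \<one>\<^bsub>K\<^esub> else \<zero>\<^bsub>K\<^esub>),
      zero = (\<lambda>u. \<zero>\<^bsub>K\<^esub>),
      add = (\<lambda>f f' u. f u \<oplus>\<^bsub>K\<^esub> f' u)\<rparr>"

definition free_var :: "'k ring \<Rightarrow> 'v \<Rightarrow> 'v list \<Rightarrow> 'k" where
  "free_var K v = (\<lambda>u. if u = [v] then \<one>\<^bsub>K\<^esub> else \<zero>\<^bsub>K\<^esub>)"

definition powser_ring :: "'a ring \<Rightarrow> (nat \<Rightarrow> 'a) ring" where
  "powser_ring A =
     \<lparr>carrier = {f. \<forall>k. f k \<in> carrier A},
      monoid.mult = (\<lambda>f f' k. \<Oplus>\<^bsub>A\<^esub>i\<in>{..k}. f i \<otimes>\<^bsub>A\<^esub> f' (k - i)),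
      one = (\<lambda>k. if k = 0 then \<one>\<^bsub>A\<^esub> else \<zero>\<^bsub>A\<^esub>),
      zero = (\<lambda>k. \<zero>\<^bsub>A\<^esub>),
      add = (\<lambda>f f' k. f k \<oplus>\<^bsub>A\<^esub> f' k)\<rparr>"

definition powser_const :: "'a ring \<Rightarrow> 'a \<Rightarrow> nat \<Rightarrow> 'a" where
  "powser_const A c = (\<lambda>k. if k = 0 then c else \<zero>\<^bsub>A\<^esub>)"

definition powser_t :: "'a ring \<Rightarrow> nat \<Rightarrow> 'a" where
  "powser_t A = (\<lambda>k. if k = 1 then \<one>\<^bsub>A\<^esub> else \<zero>\<^bsub>A\<^esub>)"

text \<open>Two power series are congruent modulo \<open>t\<^sup>k\<close> iff their first \<open>k\<close> coefficients agree.\<close>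

definition tadic_open :: "'a ring \<Rightarrow> (nat \<Rightarrow> 'a) set \<Rightarrow> bool" where
  "tadic_open A U \<longleftrightarrow>
     U \<subseteq> carrier (powser_ring A) \<and>
     (\<forall>f\<in>U. \<exists>k. \<forall>f'\<in>carrier (powser_ring A). (\<forall>m<k. f' m = f m) \<longrightarrow> f' \<in> U)"

definition tadic_topology :: "'a ring \<Rightarrow> (nat \<Rightarrow> 'a) topology" where
  "tadic_topology A = topology (tadic_open A)"

lemma istopology_tadic_open: "istopology (tadic_open A)"
  unfolding istopology_def
proof (intro conjI allI impI)
  fix S T assume S: "tadic_open A S" and T: "tadic_open A T"
  show "tadic_open A (S \<inter> T)"
    unfolding tadic_open_def
  proof (intro conjI ballI)
    show "S \<inter> T \<subseteq> carrier (powser_ring A)" using S by (auto simp: tadic_open_def)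
    fix f assume f: "f \<in> S \<inter> T"
    obtain k where k: "\<forall>f'\<in>carrier (powser_ring A). (\<forall>m<k. f' m = f m) \<longrightarrow> f' \<in> S"
      using S f unfolding tadic_open_def by blast
    obtain k' where k': "\<forall>f'\<in>carrier (powser_ring A). (\<forall>m<k'. f' m = f m) \<longrightarrow> f' \<in> T"
      using T f unfolding tadic_open_def by blast
    have "\<forall>f'\<in>carrier (powser_ring A). (\<forall>m<max k k'. f' m = f m) \<longrightarrow> f' \<in> S \<inter> T"
      using k k' by simp
    then show "\<exists>k. \<forall>f'\<in>carrier (powser_ring A). (\<forall>m<k. f' m = f m) \<longrightarrow> f' \<in> S \<inter> T" ..
  qed
next
  fix \<K> assume "\<forall>U\<in>\<K>. tadic_open A U"
  then show "tadic_open A (\<Union>\<K>)"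
    unfolding tadic_open_def by (meson Sup_le_iff UnionE UnionI)
qed

lemma openin_tadic_topology: "openin (tadic_topology A) = tadic_open A"
  unfolding tadic_topology_def by (rule topology_inverse'[OF istopology_tadic_open])

lemma topspace_tadic_topology: "topspace (tadic_topology A) = carrier (powser_ring A)"
  by (rule antisym)
     (auto simp: openin_tadic_topology topspace_def tadic_open_def)


section \<open>Universal division rings of fractions\<close>

definition mats :: "'a ring \<Rightarrow> nat \<Rightarrow> nat \<Rightarrow> (nat \<Rightarrow> nat \<Rightarrow> 'a) set" where
  "mats A m n = {M. \<forall>i<m. \<forall>j<n. M i j \<in> carrier A}"

definition mat_prod ::
  "'a ring \<Rightarrow> nat \<Rightarrow> (nat \<Rightarrow> nat \<Rightarrow> 'a) \<Rightarrow> (nat \<Rightarrow> nat \<Rightarrow> 'a) \<Rightarrow> nat \<Rightarrow> nat \<Rightarrow> 'a" where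
  "mat_prod A k P Q = (\<lambda>i j. \<Oplus>\<^bsub>A\<^esub>r\<in>{..<k}. P i r \<otimes>\<^bsub>A\<^esub> Q r j)"

definition full_matrix :: "'a ring \<Rightarrow> nat \<Rightarrow> (nat \<Rightarrow> nat \<Rightarrow> 'a) \<Rightarrow> bool" where
  "full_matrix A n M \<longleftrightarrow>
     M \<in> mats A n n \<and>
     \<not> (\<exists>k<n. \<exists>P\<in>mats A n k. \<exists>Q\<in>mats A k n. \<forall>i<n. \<forall>j<n. M i j = mat_prod A k P Q i j)"

definition invertible_matrix :: "'a ring \<Rightarrow> nat \<Rightarrow> (nat \<Rightarrow> nat \<Rightarrow> 'a) \<Rightarrow> bool" where
  "invertible_matrix A n M \<longleftrightarrow>
     M \<in> mats A n n \<and>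
     (\<exists>M'\<in>mats A n n. \<forall>i<n. \<forall>j<n.
        mat_prod A n M M' i j = (if i = j then \<one>\<^bsub>A\<^esub> else \<zero>\<^bsub>A\<^esub>) \<and>
        mat_prod A n M' M i j = (if i = j then \<one>\<^bsub>A\<^esub> else \<zero>\<^bsub>A\<^esub>))"

definition inverts_full_matrices :: "'a ring \<Rightarrow> 'b ring \<Rightarrow> ('a \<Rightarrow> 'b) \<Rightarrow> bool" where
  "inverts_full_matrices A B f \<longleftrightarrow>
     (\<forall>n M. full_matrix A n M \<longrightarrow> invertible_matrix B n (\<lambda>i j. f (M i j)))"

definition is_division_ring :: "'a ring \<Rightarrow> bool" where
  "is_division_ring D \<longleftrightarrow> ring D \<and> Units D = carrier D - {\<zero>\<^bsub>D\<^esub>}"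

definition generates_division_ring :: "'a ring \<Rightarrow> 'a set \<Rightarrow> bool" where
  "generates_division_ring D X \<longleftrightarrow>
     (\<forall>E. subring E D \<and> (\<forall>y\<in>E - {\<zero>\<^bsub>D\<^esub>}. inv\<^bsub>D\<^esub> y \<in> E) \<and> X \<subseteq> E \<longrightarrow> E = carrier D)"

text \<open>
  \<open>D\<close>, with the embedding \<open>e\<close> of \<open>A\<close>, is the universal division ring of fractions of the
  (Sylvester domain) \<open>A\<close>.  The last clause is the universal property of \<open>D\<close> for homomorphisms from
  \<open>A\<close> inverting all full matrices.  HOL cannot quantify over the type of the target ring, so this
  type is a parameter.
\<close>

definition universal_division_ring ::
  "'b itself \<Rightarrow> 'a ring \<Rightarrow> 'd ring \<Rightarrow> ('a \<Rightarrow> 'd) \<Rightarrow> bool" where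
  "universal_division_ring (_ :: 'b itself) A D e \<longleftrightarrow>
     is_division_ring D \<and> e \<in> ring_hom A D \<and> inj_on e (carrier A) \<and>
     generates_division_ring D (e ` carrier A) \<and>
     inverts_full_matrices A D e \<and>
     (\<forall>(B :: 'b ring) f. ring B \<and> f \<in> ring_hom A B \<and> inverts_full_matrices A B f \<longrightarrow>
        (\<exists>f'\<in>ring_hom D B. (\<forall>y\<in>carrier A. f' (e y) = f y) \<and>
           (\<forall>f''\<in>ring_hom D B. (\<forall>y\<in>carrier A. f'' (e y) = f y) \<longrightarrow>
              (\<forall>y\<in>carrier D. f'' y = f' y))))"


section \<open>Skew power series rings\<close>

definition minus_id :: "'a ring \<Rightarrow> ('a \<Rightarrow> 'a) \<Rightarrow> 'a \<Rightarrow> 'a" where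
  "minus_id A \<sigma> = (\<lambda>y. \<sigma> y \<ominus>\<^bsub>A\<^esub> y)"

text \<open>
  The Leibniz rule is the one forced by \<open>b s = s \<sigma>(b) + \<delta>(b)\<close>, which is the commutation rule in the
  skew power series ring below, where coefficients stand to the right of the powers of \<open>s\<close>.
\<close>

definition sigma_derivation :: "'a ring \<Rightarrow> ('a \<Rightarrow> 'a) \<Rightarrow> ('a \<Rightarrow> 'a) \<Rightarrow> bool" where
  "sigma_derivation A \<sigma> \<delta> \<longleftrightarrow>
     \<delta> \<in> carrier A \<rightarrow> carrier A \<and>
     (\<forall>a\<in>carrier A. \<forall>b\<in>carrier A.
        \<delta> (a \<oplus>\<^bsub>A\<^esub> b) = \<delta> a \<oplus>\<^bsub>A\<^esub> \<delta> b \<and>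
        \<delta> (a \<otimes>\<^bsub>A\<^esub> b) = \<delta> a \<otimes>\<^bsub>A\<^esub> \<sigma> b \<oplus>\<^bsub>A\<^esub> a \<otimes>\<^bsub>A\<^esub> \<delta> b)"

definition topologically_nilpotent :: "'a ring \<Rightarrow> 'a topology \<Rightarrow> ('a \<Rightarrow> 'a) \<Rightarrow> bool" where
  "topologically_nilpotent A T \<delta> \<longleftrightarrow>
     (\<forall>a\<in>carrier A. limitin T (\<lambda>k. (\<delta> ^^ k) a) \<zero>\<^bsub>A\<^esub> sequentially)"

text \<open>The sum of the series \<open>\<Sum>\<^bsub>k \<ge> n\<^esub> c k\<close> (unspecified if it does not converge).\<close>

definition suminf_from :: "'a ring \<Rightarrow> 'a topology \<Rightarrow> nat \<Rightarrow> (nat \<Rightarrow> 'a) \<Rightarrow> 'a" where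
  "suminf_from A T n c = (THE y. limitin T (\<lambda>m. \<Oplus>\<^bsub>A\<^esub>k\<in>{n..<m}. c k) y sequentially)"

text \<open>\<open>f\<close> stands for the series \<open>\<Sum>i. s\<^sup>i (f i)\<close>.\<close>

definition skew_powser_ring ::
  "'a ring \<Rightarrow> 'a topology \<Rightarrow> ('a \<Rightarrow> 'a) \<Rightarrow> ('a \<Rightarrow> 'a) \<Rightarrow> (nat \<Rightarrow> 'a) ring" where
  "skew_powser_ring A T \<sigma> \<delta> =
     \<lparr>carrier = {f. \<forall>i. f i \<in> carrier A},
      monoid.mult = (\<lambda>a b m. \<Oplus>\<^bsub>A\<^esub>n\<in>{..m}. suminf_from A T n
                (\<lambda>k. add_pow A (k choose n) ((\<delta> ^^ (k - n)) ((\<sigma> ^^ n) (a (m - n))) \<otimes>\<^bsub>A\<^esub> b k))),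
      one = (\<lambda>i. if i = 0 then \<one>\<^bsub>A\<^esub> else \<zero>\<^bsub>A\<^esub>),
      zero = (\<lambda>i. \<zero>\<^bsub>A\<^esub>),
      add = (\<lambda>a b i. a i \<oplus>\<^bsub>A\<^esub> b i)\<rparr>"

definition ring_embedding :: "'a ring \<Rightarrow> 'b ring \<Rightarrow> ('a \<Rightarrow> 'b) \<Rightarrow> bool" where
  "ring_embedding A B f \<longleftrightarrow> ring A \<and> ring B \<and> f \<in> ring_hom A B \<and> inj_on f (carrier A)"

end

(*
  Writing a(i,j) for the free generators of the algebra, the conjugate of x(i,j) by g is the product
  x(i,j) [x(i,j),g].  For u in N the constant term of iota(u) is 1: it is a unit of p-power order,
  because u^(p^k) tends to 1, and the free algebra embeds into a division ring of characteristic p.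
  Hence all weights are positive.  If i > l, then [x(i,j),g] = x(i,j+1) has larger weight than x(i,j).
  If i <= l, then x(i,0) has weight 1, because a character of F with value 1 on all X(i) kills the
  relators, and [x(i,0),g] = h(i) lies in the Frattini subgroup, on which the coefficient of t of
  iota, an additive map on N, vanishes.  Therefore sigma(a(i,j)) = a(i,j) modulo t, that is, sigma is
  the identity modulo t.

  Composed with the embedding into D, sigma maps full matrices to matrices over D[[t]] whose reduction
  modulo t is invertible, so they are invertible and the universal property gives D -> D[[t]].  It is
  the identity modulo t on a division subring containing the free algebra, hence on D, and extends
  t-linearly to an automorphism of D[[t]].

  In the skew power series ring right multiplication by s is an explicit operator, and the product of
  a and b is the sum of the (a s^k) b(k), which is finite modulo powers of t.  Associativity follows
  from the case that the last factor is s.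
*)

theory Submission
  imports Defs
begin


section \<open>Finite sums and power series\<close>

text \<open>The obstacle is that \<sigma> is known on the variables only after multiplication by
  \<open>t^w\<close>, where w is a formal weight: an infinite supremum in its definition would
  silently give 0. No weight is computed. That none is 0 is read off from \<iota>: otherwise the
  nonzero variable a(i,j) would be the constant term of \<iota>(x(i,j)) - 1. A positive weight is in
  turn a genuine maximum, so that weights can be compared. The conjugate enters as x [x,g], and the
  claim about \<sigma>(a(i,j)) becomes the vanishing of the coefficients 1, ..., w of
  \<iota>([x,g]); here the bounds on the weights and the Frattini condition meet.

  Fixing t and being the identity modulo t is the one property on which the rest stands. It makes
  \<delta> raise the order in t, which gives continuity of \<sigma> and of its inverse and sends the
  iterates of \<delta> to 0. The property passes from \<Lambda> to D, so it is made into a locale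
  and used for both rings.\<close>

context abelian_monoid begin

lemma finsum_swap:
  assumes "finite A" "finite B" "\<And>i j. i \<in> A \<Longrightarrow> j \<in> B \<Longrightarrow> f i j \<in> carrier G"
  shows "(\<Oplus>i\<in>A. \<Oplus>j\<in>B. f i j) = (\<Oplus>j\<in>B. \<Oplus>i\<in>A. f i j)"
  using assms(1,3)
proof (induction A rule: finite_induct)
  case empty
  then show ?case by simp
next
  case (insert a A)
  have "(\<Oplus>i\<in>insert a A. \<Oplus>j\<in>B. f i j) = (\<Oplus>j\<in>B. f a j) \<oplus> (\<Oplus>i\<in>A. \<Oplus>j\<in>B. f i j)"
    using insert by (subst finsum_insert) (auto intro!: finsum_closed)
  also have "\<dots> = (\<Oplus>j\<in>B. f a j) \<oplus> (\<Oplus>j\<in>B. \<Oplus>i\<in>A. f i j)"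
    using insert by auto
  also have "\<dots> = (\<Oplus>j\<in>B. f a j \<oplus> (\<Oplus>i\<in>A. f i j))"
    using insert by (subst finsum_addf) (auto intro!: finsum_closed)
  also have "\<dots> = (\<Oplus>j\<in>B. \<Oplus>i\<in>insert a A. f i j)"
    using insert by (intro finsum_cong') (auto intro!: finsum_closed)
  finally show ?case .
qed

lemma finsum_fibres:
  assumes "finite A" "finite B" "\<tau> \<in> A \<rightarrow> B" "f \<in> A \<rightarrow> carrier G"
  shows "(\<Oplus>y\<in>B. \<Oplus>x\<in>{x \<in> A. \<tau> x = y}. f x) = (\<Oplus>x\<in>A. f x)"
proof -
  have "(\<Oplus>x\<in>(\<Union>y\<in>B. {x \<in> A. \<tau> x = y}). f x) = (\<Oplus>y\<in>B. \<Oplus>x\<in>{x \<in> A. \<tau> x = y}. f x)"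
    using assms by (intro add.finprod_UN_disjoint) (auto simp: Pi_iff pairwise_def disjnt_def)
  moreover have "(\<Union>y\<in>B. {x \<in> A. \<tau> x = y}) = A" using assms by auto
  ultimately show ?thesis by simp
qed

lemma finsum_Sigma:
  assumes "finite A" "\<And>x. x \<in> A \<Longrightarrow> finite (B x)"
    "\<And>x y. x \<in> A \<Longrightarrow> y \<in> B x \<Longrightarrow> f x y \<in> carrier G"
  shows "(\<Oplus>x\<in>A. \<Oplus>y\<in>B x. f x y) = (\<Oplus>z\<in>Sigma A B. f (fst z) (snd z))"
proof -
  have fin: "finite (Sigma A B)" using assms by auto
  have "(\<Oplus>x\<in>A. \<Oplus>z\<in>{z \<in> Sigma A B. fst z = x}. f (fst z) (snd z)) = (\<Oplus>z\<in>Sigma A B. f (fst z) (snd z))"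
    using assms fin by (intro finsum_fibres) auto
  moreover have "(\<Oplus>z\<in>{z \<in> Sigma A B. fst z = x}. f (fst z) (snd z)) = (\<Oplus>y\<in>B x. f x y)" if "x \<in> A" for x
  proof -
    have "{z \<in> Sigma A B. fst z = x} = Pair x ` B x" using that by auto
    then show ?thesis using assms that by (simp, subst finsum_reindex) (auto simp: inj_on_def)
  qed
  ultimately show ?thesis using assms
    by (simp add: case_prod_unfold cong: finsum_cong) 
qed

lemma finsum_reindex_bij:
  assumes "bij_betw h A B" "\<And>y. y \<in> B \<Longrightarrow> f y \<in> carrier G"
  shows "(\<Oplus>x\<in>A. f (h x)) = (\<Oplus>y\<in>B. f y)"
  using assms finsum_reindex[of f h A] by (auto simp: bij_betw_def)

lemma finsum_eq_single:
  assumes "finite A" "a \<in> A" "f a \<in> carrier G" "\<And>x. x \<in> A \<Longrightarrow> x \<noteq> a \<Longrightarrow> f x = \<zero>"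
  shows "(\<Oplus>x\<in>A. f x) = f a"
proof -
  have "(\<Oplus>x\<in>A. f x) = (\<Oplus>x\<in>A. if a = x then f x else \<zero>)"
    using assms by (intro finsum_cong') auto
  also have "\<dots> = f a"
    using finsum_singleton[of a A "\<lambda>x. if x = a then f x else \<zero>"] assms
    by (simp cong: if_cong)
  finally show ?thesis .
qed

end

text \<open>Apart from closure and the existence of negatives the ring axioms are equations, so they
  may be checked after an injective map that respects the operations. This is how the free algebra
  becomes a ring: it embeds in D.\<close>

lemma ring_by_injection:
  assumes B: "ring B" and f: "f \<in> carrier A \<rightarrow> carrier B" and inj: "inj_on f (carrier A)"
    and cl: "\<And>x y. x \<in> carrier A \<Longrightarrow> y \<in> carrier A \<Longrightarrow> x \<oplus>\<^bsub>A\<^esub> y \<in> carrier A"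
      "\<And>x y. x \<in> carrier A \<Longrightarrow> y \<in> carrier A \<Longrightarrow> x \<otimes>\<^bsub>A\<^esub> y \<in> carrier A"
      "\<one>\<^bsub>A\<^esub> \<in> carrier A" "\<zero>\<^bsub>A\<^esub> \<in> carrier A"
      "\<And>x. x \<in> carrier A \<Longrightarrow> \<exists>y\<in>carrier A. y \<oplus>\<^bsub>A\<^esub> x = \<zero>\<^bsub>A\<^esub>"
    and hom: "\<And>x y. x \<in> carrier A \<Longrightarrow> y \<in> carrier A \<Longrightarrow> f (x \<oplus>\<^bsub>A\<^esub> y) = f x \<oplus>\<^bsub>B\<^esub> f y"
      "\<And>x y. x \<in> carrier A \<Longrightarrow> y \<in> carrier A \<Longrightarrow> f (x \<otimes>\<^bsub>A\<^esub> y) = f x \<otimes>\<^bsub>B\<^esub> f y"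
      "f \<one>\<^bsub>A\<^esub> = \<one>\<^bsub>B\<^esub>" "f \<zero>\<^bsub>A\<^esub> = \<zero>\<^bsub>B\<^esub>"
  shows "ring A"
proof -
  interpret B: ring B by fact
  have eqI: "f x = f y \<Longrightarrow> x \<in> carrier A \<Longrightarrow> y \<in> carrier A \<Longrightarrow> x = y" for x y
    using inj by (auto simp: inj_on_def)
  have c: "x \<in> carrier A \<Longrightarrow> f x \<in> carrier B" for x using f by auto
  show ?thesis
    apply (intro ringI abelian_groupI monoidI cl)
    apply (auto intro!: eqI cl simp: hom cl c B.a_ac B.m_assoc B.l_distr B.r_distr)
    done
qed


text \<open>Course-of-values recursion: the hypothesis, that \<Phi> reads its argument only below k,
  is the admissibility that \<open>wfrec\<close> needs. It supplies coefficient sequences that are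
  defined by solving triangular equations.\<close>

lemma wf_nat_recursion:
  assumes "\<And>k g h. (\<And>i. i < k \<Longrightarrow> g i = h i) \<Longrightarrow> \<Phi> k g = \<Phi> k h"
  obtains g :: "nat \<Rightarrow> 'a" where "\<And>k. g k = \<Phi> k g"
proof
  let ?F = "\<lambda>g k. \<Phi> k g"
  fix k
  have "adm_wf less_than ?F" unfolding adm_wf_def using assms by (metis less_than_iff)
  then have "wfrec less_than ?F = ?F (wfrec less_than ?F)"
    by (intro wfrec_fixpoint) auto
  then show "wfrec less_than ?F k = \<Phi> k (wfrec less_than ?F)" by metis
qed

context ring begin

lemma finsum_minus:
  "(\<And>x. x \<in> A \<Longrightarrow> f x \<in> carrier R) \<Longrightarrow> (\<Oplus>x\<in>A. \<ominus> f x) = \<ominus> (\<Oplus>x\<in>A. f x)"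
proof (induction A rule: infinite_finite_induct)
  case (insert x A)
  then show ?case by (simp add: finsum_insert Pi_iff minus_add finsum_closed)
qed (auto simp: finsum_infinite)

text \<open>Both sides sum over triples of exponents with total n. The left one groups them by the
  degree of a b, the right one by the degree of a; \<open>?h\<close> passes between the two
  groupings.\<close>

lemma finsum_convolution_assoc:
  fixes n :: nat
  assumes "\<And>i. i \<le> n \<Longrightarrow> a i \<in> carrier R" "\<And>i. i \<le> n \<Longrightarrow> b i \<in> carrier R"
    "\<And>i. i \<le> n \<Longrightarrow> c i \<in> carrier R"
  shows "(\<Oplus>i\<in>{..n}. (\<Oplus>j\<in>{..i}. a j \<otimes> b (i - j)) \<otimes> c (n - i)) =
         (\<Oplus>j\<in>{..n}. a j \<otimes> (\<Oplus>i\<in>{..n - j}. b i \<otimes> c (n - j - i)))"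
proof -
  let ?f = "\<lambda>z. a (snd z) \<otimes> b (fst z - snd z) \<otimes> c (n - fst z)"
  let ?g = "\<lambda>z. a (fst z) \<otimes> (b (snd z) \<otimes> c (n - fst z - snd z))"
  let ?h = "\<lambda>z. (snd z, fst z - snd z)"
  have "(\<Oplus>i\<in>{..n}. (\<Oplus>j\<in>{..i}. a j \<otimes> b (i - j)) \<otimes> c (n - i)) =
        (\<Oplus>i\<in>{..n}. \<Oplus>j\<in>{..i}. a j \<otimes> b (i - j) \<otimes> c (n - i))"
    using assms by (intro finsum_cong' finsum_ldistr) (auto intro!: finsum_closed)
  also have "\<dots> = (\<Oplus>z\<in>Sigma {..n} (\<lambda>i. {..i}). ?f z)"
    using assms by (subst finsum_Sigma) auto
  also have "\<dots> = (\<Oplus>z\<in>Sigma {..n} (\<lambda>i. {..i}). ?g (?h z))"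
    using assms by (intro finsum_cong') (auto intro!: m_assoc)
  also have "\<dots> = (\<Oplus>z\<in>Sigma {..n} (\<lambda>j. {..n - j}). ?g z)"
    using assms
    by (intro finsum_reindex_bij bij_betw_byWitness[where f' = "\<lambda>z. (fst z + snd z, fst z)"]) auto
  also have "\<dots> = (\<Oplus>j\<in>{..n}. \<Oplus>i\<in>{..n - j}. a j \<otimes> (b i \<otimes> c (n - j - i)))"
    using assms by (subst finsum_Sigma) auto
  also have "\<dots> = (\<Oplus>j\<in>{..n}. a j \<otimes> (\<Oplus>i\<in>{..n - j}. b i \<otimes> c (n - j - i)))"
    using assms by (intro finsum_cong' finsum_rdistr[symmetric]) (auto intro!: finsum_closed)
  finally show ?thesis .
qed

end

section \<open>Formal power series in a central variable\<close>

locale plain_ring = ring R for R :: "'a ring" (structure)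
begin

abbreviation P where "P \<equiv> powser_ring R"

lemma powser_ring_ring: "ring P"
proof (intro ringI abelian_groupI monoidI)
  fix f g h
  assume f: "f \<in> carrier P" and g: "g \<in> carrier P"
  show "f \<oplus>\<^bsub>P\<^esub> g \<in> carrier P"
    "f \<oplus>\<^bsub>P\<^esub> g = g \<oplus>\<^bsub>P\<^esub> f"
    using f g by (auto simp: powser_ring_def a_ac)
  show "f \<otimes>\<^bsub>P\<^esub> g \<in> carrier P"
    using f g by (auto simp: powser_ring_def intro!: finsum_closed)
  show "\<zero>\<^bsub>P\<^esub> \<oplus>\<^bsub>P\<^esub> f = f"
    using f by (auto simp: powser_ring_def)
  show "\<exists>y\<in>carrier P. y \<oplus>\<^bsub>P\<^esub> f = \<zero>\<^bsub>P\<^esub>"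
    using f by (intro bexI[of _ "\<lambda>k. \<ominus> f k"]) (auto simp: powser_ring_def l_neg)
  show "\<one>\<^bsub>P\<^esub> \<otimes>\<^bsub>P\<^esub> f = f"
  proof
    fix k
    have "(\<Oplus>i\<in>{..k}. (if i = 0 then \<one> else \<zero>) \<otimes> f (k - i)) = (if (0::nat) = 0 then \<one> else \<zero>) \<otimes> f (k - 0)"
      using f by (intro finsum_eq_single) (auto simp: powser_ring_def)
    then show "(\<one>\<^bsub>P\<^esub> \<otimes>\<^bsub>P\<^esub> f) k = f k"
      using f by (auto simp: powser_ring_def)
  qed
  show "f \<otimes>\<^bsub>P\<^esub> \<one>\<^bsub>P\<^esub> = f"
  proof
    fix k
    have "(\<Oplus>i\<in>{..k}. f i \<otimes> (if k - i = 0 then \<one> else \<zero>)) = f k \<otimes> (if k - k = 0 then \<one> else \<zero>)"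
      using f by (intro finsum_eq_single) (auto simp: powser_ring_def)
    then show "(f \<otimes>\<^bsub>P\<^esub> \<one>\<^bsub>P\<^esub>) k = f k"
      using f by (auto simp: powser_ring_def)
  qed
  assume h: "h \<in> carrier P"
  show "f \<oplus>\<^bsub>P\<^esub> g \<oplus>\<^bsub>P\<^esub> h = f \<oplus>\<^bsub>P\<^esub> (g \<oplus>\<^bsub>P\<^esub> h)"
    using f g h by (auto simp: powser_ring_def a_assoc)
  show "f \<otimes>\<^bsub>P\<^esub> g \<otimes>\<^bsub>P\<^esub> h = f \<otimes>\<^bsub>P\<^esub> (g \<otimes>\<^bsub>P\<^esub> h)"
    using f g h finsum_convolution_assoc[of _ f g h] by (simp add: powser_ring_def fun_eq_iff)
  show "(f \<oplus>\<^bsub>P\<^esub> g) \<otimes>\<^bsub>P\<^esub> h =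
      f \<otimes>\<^bsub>P\<^esub> h \<oplus>\<^bsub>P\<^esub> (g \<otimes>\<^bsub>P\<^esub> h)"
    using f g h by (auto simp: powser_ring_def fun_eq_iff l_distr finsum_addf Pi_iff)
  show "h \<otimes>\<^bsub>P\<^esub> (f \<oplus>\<^bsub>P\<^esub> g) =
      h \<otimes>\<^bsub>P\<^esub> f \<oplus>\<^bsub>P\<^esub> (h \<otimes>\<^bsub>P\<^esub> g)"
    using f g h by (auto simp: powser_ring_def fun_eq_iff r_distr finsum_addf Pi_iff)
qed (auto simp: powser_ring_def)

lemma powser_const_carrier: "c \<in> carrier R \<Longrightarrow> powser_const R c \<in> carrier P"
  by (auto simp: powser_const_def powser_ring_def)

lemma powser_t_carrier: "powser_t R \<in> carrier P"
  by (auto simp: powser_t_def powser_ring_def)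

lemma powser_uminus_apply:
  assumes "f \<in> carrier P"
  shows "(\<ominus>\<^bsub>P\<^esub> f) k = \<ominus> f k"
proof -
  interpret P: ring P by (rule powser_ring_ring)
  have "\<ominus>\<^bsub>P\<^esub> f = (\<lambda>k. \<ominus> f k)"
    by (rule P.minus_equality) (use assms in \<open>auto simp: powser_ring_def l_neg\<close>)
  then show ?thesis by simp
qed

lemma powser_minus_apply:
  assumes "g \<in> carrier P"
  shows "(f \<ominus>\<^bsub>P\<^esub> g) k = f k \<ominus> g k"
proof -
  have "(f \<oplus>\<^bsub>P\<^esub> h) k = f k \<oplus> h k" for h by (simp add: powser_ring_def)
  then show ?thesis by (simp add: a_minus_def powser_uminus_apply[OF assms])
qed

lemma powser_finsum_apply:
  assumes "\<And>x. x \<in> A \<Longrightarrow> f x \<in> carrier P"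
  shows "(\<Oplus>\<^bsub>P\<^esub>x\<in>A. f x) k = (\<Oplus>x\<in>A. f x k)"
proof -
  interpret P: ring P by (rule powser_ring_ring)
  show ?thesis using assms
  proof (induction A rule: infinite_finite_induct)
    case (infinite A)
    then show ?case by (simp add: finsum_infinite P.finsum_infinite) (simp add: powser_ring_def)
  next
    case empty
    then show ?case by simp (simp add: powser_ring_def)
  next
    case (insert x A)
    then have "f y k \<in> carrier R" if "y \<in> insert x A" for y
      using that by (auto simp: powser_ring_def)
    with insert show ?case
      by (simp add: finsum_insert P.finsum_insert Pi_iff) (simp add: powser_ring_def)
  qed
qed

lemma powser_mult_const:
  assumes "f \<in> carrier P" "c \<in> carrier R"
  shows "(powser_const R c \<otimes>\<^bsub>P\<^esub> f) k = c \<otimes> f k"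
    "(f \<otimes>\<^bsub>P\<^esub> powser_const R c) k = f k \<otimes> c"
proof -
  have "(\<Oplus>i\<in>{..k}. powser_const R c i \<otimes> f (k - i)) = powser_const R c 0 \<otimes> f (k - 0)"
    using assms by (intro finsum_eq_single) (auto simp: powser_ring_def powser_const_def)
  moreover have "(\<Oplus>i\<in>{..k}. f i \<otimes> powser_const R c (k - i)) = f k \<otimes> powser_const R c (k - k)"
    using assms by (intro finsum_eq_single) (auto simp: powser_ring_def powser_const_def)
  ultimately show "(powser_const R c \<otimes>\<^bsub>P\<^esub> f) k = c \<otimes> f k"
    "(f \<otimes>\<^bsub>P\<^esub> powser_const R c) k = f k \<otimes> c"
    by (simp_all add: powser_ring_def powser_const_def)
qed

lemma powser_t_pow: "powser_t R [^]\<^bsub>P\<^esub> (n::nat) = (\<lambda>k. if k = n then \<one> else \<zero>)"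
proof (induction n)
  case 0
  then show ?case by (simp add: powser_ring_def)
next
  case (Suc n)
  show ?case
  proof
    fix k
    have "(powser_t R [^]\<^bsub>P\<^esub> Suc n) k = (\<Oplus>i\<in>{..k}. (if i = n then \<one> else \<zero>) \<otimes> powser_t R (k - i))"
      using Suc by (simp add: powser_ring_def)
    also have "\<dots> = (if k = Suc n then \<one> else \<zero>)"
    proof (cases "n \<le> k")
      case True
      then have "(\<Oplus>i\<in>{..k}. (if i = n then \<one> else \<zero>) \<otimes> powser_t R (k - i)) =
          (if n = n then \<one> else \<zero>) \<otimes> powser_t R (k - n)"
        by (intro finsum_eq_single) (auto simp: powser_t_def)
      with True show ?thesis by (auto simp: powser_t_def)
    next
      case False
      then have "(\<Oplus>i\<in>{..k}. (if i = n then \<one> else \<zero>) \<otimes> powser_t R (k - i)) = (\<Oplus>i\<in>{..k}. \<zero>)"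
        by (intro finsum_cong') (auto simp: powser_t_def)
      with False show ?thesis by auto
    qed
    finally show "(powser_t R [^]\<^bsub>P\<^esub> Suc n) k = (if k = Suc n then \<one> else \<zero>)" .
  qed
qed

lemma powser_mult_t_pow:
  assumes "f \<in> carrier P"
  shows "(powser_t R [^]\<^bsub>P\<^esub> n \<otimes>\<^bsub>P\<^esub> f) k = (if k < n then \<zero> else f (k - n))"
    "(f \<otimes>\<^bsub>P\<^esub> powser_t R [^]\<^bsub>P\<^esub> n) k = (if k < n then \<zero> else f (k - n))"
proof -
  have f: "f i \<in> carrier R" for i using assms by (auto simp: powser_ring_def)
  have 1: "(\<Oplus>i\<in>{..k}. (if i = n then \<one> else \<zero>) \<otimes> f (k - i)) = (if k < n then \<zero> else f (k - n))"
  proof (cases "n \<le> k")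
    case True
    then have "(\<Oplus>i\<in>{..k}. (if i = n then \<one> else \<zero>) \<otimes> f (k - i)) =
        (if n = n then \<one> else \<zero>) \<otimes> f (k - n)"
      using f by (intro finsum_eq_single) auto
    with True f show ?thesis by auto
  next
    case False
    then have "(\<Oplus>i\<in>{..k}. (if i = n then \<one> else \<zero>) \<otimes> f (k - i)) = (\<Oplus>i\<in>{..k}. \<zero>)"
      using f by (intro finsum_cong') auto
    with False show ?thesis by auto
  qed
  have 2: "(\<Oplus>i\<in>{..k}. f i \<otimes> (if k - i = n then \<one> else \<zero>)) = (if k < n then \<zero> else f (k - n))"
  proof (cases "n \<le> k")
    case True
    then have "(\<Oplus>i\<in>{..k}. f i \<otimes> (if k - i = n then \<one> else \<zero>)) =
        f (k - n) \<otimes> (if k - (k - n) = n then \<one> else \<zero>)"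
      using f by (intro finsum_eq_single) auto
    with True f show ?thesis by auto
  next
    case False
    then have "(\<Oplus>i\<in>{..k}. f i \<otimes> (if k - i = n then \<one> else \<zero>)) = (\<Oplus>i\<in>{..k}. \<zero>)"
      using f by (intro finsum_cong') auto
    with False show ?thesis by auto
  qed
  show "(powser_t R [^]\<^bsub>P\<^esub> n \<otimes>\<^bsub>P\<^esub> f) k = (if k < n then \<zero> else f (k - n))"
    "(f \<otimes>\<^bsub>P\<^esub> powser_t R [^]\<^bsub>P\<^esub> n) k = (if k < n then \<zero> else f (k - n))"
    unfolding powser_t_pow using 1 2 by (simp_all add: powser_ring_def)
qed

lemma powser_mult_t:
  assumes "f \<in> carrier P"
  shows "(powser_t R \<otimes>\<^bsub>P\<^esub> f) k = (if k = 0 then \<zero> else f (k - 1))"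
proof -
  interpret P: ring P by (rule powser_ring_ring)
  show ?thesis using powser_mult_t_pow(1)[OF assms, of 1 k] powser_t_carrier by auto
qed

text \<open>The equations for the coefficients of g are triangular: once the earlier ones are known,
  the product of f 0 and g k is prescribed, and f 0 is invertible.\<close>

lemma powser_right_inverse:
  assumes f: "f \<in> carrier P" and u: "f 0 \<in> Units R"
  shows "\<exists>g\<in>carrier P. f \<otimes>\<^bsub>P\<^esub> g = \<one>\<^bsub>P\<^esub> \<and> g 0 = inv (f 0)"
proof -
  have fc: "f i \<in> carrier R" for i using f by (auto simp: powser_ring_def)
  have ic: "inv (f 0) \<in> carrier R" using u by auto
  \<comment> \<open>Truncation below k makes the recursion visibly depend on earlier values only, as
    \<open>wf_nat_recursion\<close> demands. It changes nothing, since k - i < k for i \<ge> 1, and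
    is removed again right after closure is known.\<close>
  let ?cut = "\<lambda>k g (i::nat). if i < k then g i else \<zero>"
  obtain g where g': "\<And>k. g k = inv (f 0) \<otimes> ((if k = 0 then \<one> else \<zero>) \<ominus> (\<Oplus>i\<in>{1..k}. f i \<otimes> ?cut k g (k - i)))"
  proof (rule wf_nat_recursion)
    fix k and g h :: "nat \<Rightarrow> 'a" assume "\<And>i. i < k \<Longrightarrow> g i = h i"
    then have "(\<lambda>i. f i \<otimes> ?cut k g (k - i)) = (\<lambda>i. f i \<otimes> ?cut k h (k - i))" by auto
    then show "inv (f 0) \<otimes> ((if k = 0 then \<one> else \<zero>) \<ominus> (\<Oplus>i\<in>{1..k}. f i \<otimes> ?cut k g (k - i))) =
      inv (f 0) \<otimes> ((if k = 0 then \<one> else \<zero>) \<ominus> (\<Oplus>i\<in>{1..k}. f i \<otimes> ?cut k h (k - i)))" by (simp only:)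
  qed blast
  have gc: "g k \<in> carrier R" for k
  proof (induction k rule: less_induct)
    case (less k)
    then have "(\<Oplus>i\<in>{1..k}. f i \<otimes> g (k - i)) \<in> carrier R"
      using fc by (intro finsum_closed) auto
    moreover have "(\<Oplus>i\<in>{1..k}. f i \<otimes> ?cut k g (k - i)) \<in> carrier R"
      using fc less by (intro finsum_closed) auto
    ultimately show ?case using ic unfolding g'[of k] by (intro m_closed minus_closed) simp_all
  qed
  have g: "g k = inv (f 0) \<otimes> ((if k = 0 then \<one> else \<zero>) \<ominus> (\<Oplus>i\<in>{1..k}. f i \<otimes> g (k - i)))" for k
  proof -
    have "(\<Oplus>i\<in>{1..k}. f i \<otimes> ?cut k g (k - i)) = (\<Oplus>i\<in>{1..k}. f i \<otimes> g (k - i))"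
      using fc gc by (intro finsum_cong') auto
    then show ?thesis using g'[of k] by simp
  qed
  have "(\<Oplus>i\<in>{..k}. f i \<otimes> g (k - i)) = (if k = 0 then \<one> else \<zero>)" for k
  proof -
    have "{..k} = insert 0 {1..k}" by auto
    then have "(\<Oplus>i\<in>{..k}. f i \<otimes> g (k - i)) = f 0 \<otimes> g k \<oplus> (\<Oplus>i\<in>{1..k}. f i \<otimes> g (k - i))"
      using fc gc by (simp add: finsum_insert)
    also have "f 0 \<otimes> g k = f 0 \<otimes> (inv (f 0) \<otimes> ((if k = 0 then \<one> else \<zero>) \<ominus> (\<Oplus>i\<in>{1..k}. f i \<otimes> g (k - i))))"
      using g[of k] by (simp only:)
    also have "\<dots> = (if k = 0 then \<one> else \<zero>) \<ominus> (\<Oplus>i\<in>{1..k}. f i \<otimes> g (k - i))"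
      using fc gc ic u by (subst m_assoc[symmetric]) (auto intro!: finsum_closed)
    also have "\<dots> \<oplus> (\<Oplus>i\<in>{1..k}. f i \<otimes> g (k - i)) = (if k = 0 then \<one> else \<zero>)"
      using fc gc by (simp add: a_minus_def a_assoc l_neg finsum_closed Pi_iff)
    finally show ?thesis .
  qed
  moreover have "g 0 = inv (f 0)" using ic g[of 0] by (simp add: a_minus_def)
  ultimately show ?thesis using gc by (intro bexI[of _ g]) (simp_all add: powser_ring_def)
qed

text \<open>A right inverse g of f again has an invertible constant term, so it has a right inverse
  h. Then f = f (g h) = (f g) h = h, which makes g a two-sided inverse.\<close>

lemma powser_Units:
  assumes f: "f \<in> carrier P" and u: "f 0 \<in> Units R"
  shows "f \<in> Units P"
proof -
  interpret P: ring P by (rule powser_ring_ring)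
  obtain g where g: "g \<in> carrier P" "f \<otimes>\<^bsub>P\<^esub> g = \<one>\<^bsub>P\<^esub>" "g 0 = inv (f 0)"
    using powser_right_inverse[OF f u] by blast
  have "g 0 \<in> Units R" using g u by auto
  then obtain h where h: "h \<in> carrier P" "g \<otimes>\<^bsub>P\<^esub> h = \<one>\<^bsub>P\<^esub>"
    using powser_right_inverse[OF g(1)] by blast
  have "f = f \<otimes>\<^bsub>P\<^esub> (g \<otimes>\<^bsub>P\<^esub> h)" using f h by simp
  also have "\<dots> = (f \<otimes>\<^bsub>P\<^esub> g) \<otimes>\<^bsub>P\<^esub> h" using P.m_assoc[OF f g(1) h(1)] by simp
  also have "\<dots> = h" using g h by simp
  finally have "g \<otimes>\<^bsub>P\<^esub> f = \<one>\<^bsub>P\<^esub>" using h(2) by simp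
  with f g(1,2) show ?thesis unfolding Units_def by blast
qed

end


section \<open>Congruence modulo \<open>t^r\<close>, written \<open>agree r\<close>, and the t-adic
  topology\<close>

definition agree :: "nat \<Rightarrow> (nat \<Rightarrow> 'a) \<Rightarrow> (nat \<Rightarrow> 'a) \<Rightarrow> bool" where
  "agree r f g \<longleftrightarrow> (\<forall>i<r. f i = g i)"

lemma agree_refl: "agree r f f"
  by (simp add: agree_def)

lemma agree_sym: "agree r f g \<Longrightarrow> agree r g f"
  by (simp add: agree_def)

lemma agree_trans: "agree r f g \<Longrightarrow> agree r g h \<Longrightarrow> agree r f h"
  by (simp add: agree_def)

lemma agree_mono: "agree r f g \<Longrightarrow> q \<le> r \<Longrightarrow> agree q f g"
  by (simp add: agree_def)

lemma agree_all_eq: "(\<And>r. agree r f g) \<Longrightarrow> f = g"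
  by (auto simp: agree_def)

lemma agreeD: "agree r f g \<Longrightarrow> i < r \<Longrightarrow> f i = g i"
  by (simp add: agree_def)

text \<open>The series congruent to y modulo \<open>t^k\<close> form an open set, and these sets are
  a neighbourhood base at y.\<close>

lemma limitin_tadic:
  assumes "\<And>n. s n \<in> carrier (powser_ring A)"
  shows "limitin (tadic_topology A) s y sequentially \<longleftrightarrow>
    y \<in> carrier (powser_ring A) \<and> (\<forall>k. \<forall>\<^sub>F n in sequentially. agree k (s n) y)"
proof (intro iffI conjI allI)
  assume L: "limitin (tadic_topology A) s y sequentially"
  then show y: "y \<in> carrier (powser_ring A)" by (simp add: limitin_def topspace_tadic_topology)
  fix k
  have "tadic_open A {f \<in> carrier (powser_ring A). agree k f y}"
    unfolding tadic_open_def agree_def by (auto intro!: exI[of _ k])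
  then have "\<forall>\<^sub>F n in sequentially. s n \<in> {f \<in> carrier (powser_ring A). agree k f y}"
    using L y unfolding limitin_def openin_tadic_topology by (auto simp: agree_refl)
  then show "\<forall>\<^sub>F n in sequentially. agree k (s n) y" by (rule eventually_mono) auto
next
  assume R: "y \<in> carrier (powser_ring A) \<and> (\<forall>k. \<forall>\<^sub>F n in sequentially. agree k (s n) y)"
  show "limitin (tadic_topology A) s y sequentially"
    unfolding limitin_def openin_tadic_topology topspace_tadic_topology
  proof (intro conjI allI impI)
    show "y \<in> carrier (powser_ring A)" using R by simp
    fix U assume "tadic_open A U \<and> y \<in> U"
    then obtain k where k: "\<forall>f'\<in>carrier (powser_ring A). (\<forall>m<k. f' m = y m) \<longrightarrow> f' \<in> U"
      unfolding tadic_open_def by blast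
    have "\<forall>\<^sub>F n in sequentially. agree k (s n) y" using R by blast
    then show "\<forall>\<^sub>F n in sequentially. s n \<in> U"
      by (rule eventually_mono) (use k assms in \<open>auto simp: agree_def\<close>)
  qed
qed

text \<open>Preserving congruence modulo every \<open>t^r\<close> is a strong form of continuity,
  and both \<sigma> and its inverse have it.\<close>

lemma continuous_map_tadic:
  assumes "\<And>f. f \<in> carrier (powser_ring A) \<Longrightarrow> \<phi> f \<in> carrier (powser_ring B)"
    and "\<And>r f g. f \<in> carrier (powser_ring A) \<Longrightarrow> g \<in> carrier (powser_ring A) \<Longrightarrow>
      agree r f g \<Longrightarrow> agree r (\<phi> f) (\<phi> g)"
  shows "continuous_map (tadic_topology A) (tadic_topology B) \<phi>"
  unfolding continuous_map topspace_tadic_topology openin_tadic_topology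
proof (intro conjI allI impI)
  show "\<phi> ` carrier (powser_ring A) \<subseteq> carrier (powser_ring B)" using assms(1) by auto
  fix U assume U: "tadic_open B U"
  show "tadic_open A {x \<in> carrier (powser_ring A). \<phi> x \<in> U}"
    unfolding tadic_open_def
  proof (intro conjI ballI)
    fix f assume "f \<in> {x \<in> carrier (powser_ring A). \<phi> x \<in> U}"
    then obtain k where f: "f \<in> carrier (powser_ring A)"
      and k: "\<forall>f'\<in>carrier (powser_ring B). (\<forall>m<k. f' m = \<phi> f m) \<longrightarrow> f' \<in> U"
      using U unfolding tadic_open_def by blast
    show "\<exists>k. \<forall>f'\<in>carrier (powser_ring A). (\<forall>m<k. f' m = f m) \<longrightarrow> f' \<in> {x \<in> carrier (powser_ring A). \<phi> x \<in> U}"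
      using assms(1) assms(2)[OF _ f, of _ k] k unfolding agree_def by (intro exI[of _ k]) auto
  qed auto
qed

context plain_ring begin

lemma P_add: "(f \<oplus>\<^bsub>P\<^esub> g) k = f k \<oplus> g k"
  by (simp add: powser_ring_def)

lemma P_mult: "(f \<otimes>\<^bsub>P\<^esub> g) k = (\<Oplus>i\<in>{..k}. f i \<otimes> g (k - i))"
  by (simp add: powser_ring_def)

lemma P_zero: "\<zero>\<^bsub>P\<^esub> k = \<zero>"
  by (simp add: powser_ring_def)

lemma P_one: "\<one>\<^bsub>P\<^esub> k = (if k = 0 then \<one> else \<zero>)"
  by (simp add: powser_ring_def)

lemma P_I: "(\<And>k. f k \<in> carrier R) \<Longrightarrow> f \<in> carrier P"
  by (simp add: powser_ring_def)

lemma P_coeff [simp]: "f \<in> carrier P \<Longrightarrow> f k \<in> carrier R"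
  by (simp add: powser_ring_def)

lemma agree_add: "agree r f f' \<Longrightarrow> agree r g g' \<Longrightarrow> agree r (f \<oplus>\<^bsub>P\<^esub> g) (f' \<oplus>\<^bsub>P\<^esub> g')"
  by (simp add: agree_def P_add)

lemma agree_mult:
  assumes "f' \<in> carrier P" "g' \<in> carrier P" "agree r f f'" "agree r g g'"
  shows "agree r (f \<otimes>\<^bsub>P\<^esub> g) (f' \<otimes>\<^bsub>P\<^esub> g')"
  using assms unfolding agree_def P_mult by (auto intro!: finsum_cong')

lemma agree_finsum:
  assumes "\<And>x. x \<in> A \<Longrightarrow> f x \<in> carrier P" "\<And>x. x \<in> A \<Longrightarrow> g x \<in> carrier P"
    and "\<And>x. x \<in> A \<Longrightarrow> agree r (f x) (g x)"
  shows "agree r (\<Oplus>\<^bsub>P\<^esub>x\<in>A. f x) (\<Oplus>\<^bsub>P\<^esub>x\<in>A. g x)"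
  using assms unfolding agree_def by (auto simp: powser_finsum_apply intro!: finsum_cong')

lemma agree_minus_iff:
  assumes "f \<in> carrier P" "g \<in> carrier P"
  shows "agree r (f \<ominus>\<^bsub>P\<^esub> g) \<zero>\<^bsub>P\<^esub> \<longleftrightarrow> agree r f g"
  using assms by (simp add: agree_def powser_minus_apply P_zero)

text \<open>The term with index k is divisible by \<open>t^(k-n)\<close>, so the coefficient r sees
  only the terms up to n + r. Since \<open>suminf_from\<close> is a definite description, uniqueness
  of the limit has to be shown as well as its existence.\<close>

lemma suminf_from_powser:
  assumes c: "\<And>k. c k \<in> carrier P" and van: "\<And>k. agree (k - n) (c k) \<zero>\<^bsub>P\<^esub>"
    and M: "n + r < M"
  shows "suminf_from P (tadic_topology R) n c r = (\<Oplus>\<^bsub>P\<^esub>k\<in>{n..<M}. c k) r"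
proof -
  interpret P: ring P by (rule powser_ring_ring)
  have partial: "(\<Oplus>\<^bsub>P\<^esub>k\<in>{n..<M}. c k) r = (\<Oplus>\<^bsub>P\<^esub>k\<in>{n..<Suc (n + r)}. c k) r" if "n + r < M" for r M
  proof -
    have "c k r = \<zero>" if "k \<in> {n..<M} - {n..<Suc (n + r)}" for k
      using van[of k] that by (auto simp: agree_def P_zero)
    then show ?thesis
      using \<open>n + r < M\<close> c by (simp add: powser_finsum_apply) (auto intro!: add.finprod_mono_neutral_cong_right)
  qed
  define y where "y = (\<lambda>r. (\<Oplus>\<^bsub>P\<^esub>k\<in>{n..<Suc (n + r)}. c k) r)"
  have s: "(\<Oplus>\<^bsub>P\<^esub>k\<in>{n..<m}. c k) \<in> carrier P" for m
    using c by (intro P.finsum_closed) auto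
  have y: "y \<in> carrier P" unfolding y_def using s by (intro P_I) simp
  have conv: "agree q (\<Oplus>\<^bsub>P\<^esub>k\<in>{n..<m}. c k) y" if "n + q \<le> m" for q m
    unfolding agree_def y_def using that by (auto intro!: partial)
  have "limitin (tadic_topology R) (\<lambda>m. \<Oplus>\<^bsub>P\<^esub>k\<in>{n..<m}. c k) z sequentially \<longleftrightarrow> z = y" for z
  proof
    assume "limitin (tadic_topology R) (\<lambda>m. \<Oplus>\<^bsub>P\<^esub>k\<in>{n..<m}. c k) z sequentially"
    then have ev: "\<forall>\<^sub>F m in sequentially. agree q (\<Oplus>\<^bsub>P\<^esub>k\<in>{n..<m}. c k) z" for q
      using limitin_tadic[of "\<lambda>m. \<Oplus>\<^bsub>P\<^esub>k\<in>{n..<m}. c k" R z, OF s] by blast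
    show "z = y"
    proof (rule agree_all_eq)
      fix q
      from ev[of q] obtain m0 where "\<forall>m\<ge>m0. agree q (\<Oplus>\<^bsub>P\<^esub>k\<in>{n..<m}. c k) z"
        unfolding eventually_sequentially by blast
      then have "agree q (\<Oplus>\<^bsub>P\<^esub>k\<in>{n..<max m0 (n + q)}. c k) z" by simp
      then show "agree q z y" using conv[of q "max m0 (n + q)"] agree_sym agree_trans by (metis max.cobounded2)
    qed
  next
    assume "z = y"
    then show "limitin (tadic_topology R) (\<lambda>m. \<Oplus>\<^bsub>P\<^esub>k\<in>{n..<m}. c k) z sequentially"
      using limitin_tadic[of "\<lambda>m. \<Oplus>\<^bsub>P\<^esub>k\<in>{n..<m}. c k" R y, OF s] y conv
      unfolding eventually_sequentially by blast
  qed
  then have "suminf_from P (tadic_topology R) n c = y" unfolding suminf_from_def by simp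
  then show ?thesis using partial[OF M] by (simp add: y_def)
qed

end

section \<open>Unipotent automorphisms of power series rings\<close>

text \<open>Continuity of \<sigma> is a consequence: \<sigma> maps \<open>t^r h\<close> to
  \<open>t^r \<sigma>(h)\<close>, and so respects congruences. The locale is interpreted with
  \<Lambda> and with D as coefficient ring.\<close>

locale unipotent_powser_automorphism = plain_ring R for R :: "'a ring" (structure) +
  fixes \<sigma> :: "(nat \<Rightarrow> 'a) \<Rightarrow> nat \<Rightarrow> 'a"
  assumes \<sigma>_iso: "\<sigma> \<in> ring_iso (powser_ring R) (powser_ring R)"
    and \<sigma>_t: "\<sigma> (powser_t R) = powser_t R"
    and \<sigma>_0: "f \<in> carrier (powser_ring R) \<Longrightarrow> \<sigma> f 0 = f 0"
begin

definition \<delta> where "\<delta> = minus_id P \<sigma>"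

sublocale P: ring P by (rule powser_ring_ring)

lemma \<sigma>_hom: "\<sigma> \<in> ring_hom P P"
  using \<sigma>_iso by (simp add: ring_iso_def)

sublocale \<sigma>: ring_hom_ring P P \<sigma>
  using \<sigma>_hom by (intro ring_hom_ringI2 P.ring_axioms)

lemma \<delta>_closed [simp]: "f \<in> carrier P \<Longrightarrow> \<delta> f \<in> carrier P"
  by (simp add: \<delta>_def minus_id_def)

lemma \<delta>_add: "f \<in> carrier P \<Longrightarrow> g \<in> carrier P \<Longrightarrow> \<delta> (f \<oplus>\<^bsub>P\<^esub> g) = \<delta> f \<oplus>\<^bsub>P\<^esub> \<delta> g"
  by (simp add: \<delta>_def minus_id_def a_minus_def P.minus_add P.a_ac)

lemma \<delta>_zero: "\<delta> \<zero>\<^bsub>P\<^esub> = \<zero>\<^bsub>P\<^esub>"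
  by (simp add: \<delta>_def minus_id_def a_minus_def)

lemma \<delta>_one: "\<delta> \<one>\<^bsub>P\<^esub> = \<zero>\<^bsub>P\<^esub>"
  by (simp add: \<delta>_def minus_id_def a_minus_def P.r_neg)

lemma \<delta>_mult:
  assumes "f \<in> carrier P" "g \<in> carrier P"
  shows "\<delta> (f \<otimes>\<^bsub>P\<^esub> g) = \<delta> f \<otimes>\<^bsub>P\<^esub> \<sigma> g \<oplus>\<^bsub>P\<^esub> f \<otimes>\<^bsub>P\<^esub> \<delta> g"
proof -
  have "\<delta> f \<otimes>\<^bsub>P\<^esub> \<sigma> g \<oplus>\<^bsub>P\<^esub> f \<otimes>\<^bsub>P\<^esub> \<delta> g =
    \<sigma> f \<otimes>\<^bsub>P\<^esub> \<sigma> g \<oplus>\<^bsub>P\<^esub> (\<ominus>\<^bsub>P\<^esub> (f \<otimes>\<^bsub>P\<^esub> \<sigma> g) \<oplus>\<^bsub>P\<^esub> (f \<otimes>\<^bsub>P\<^esub> \<sigma> g)) \<oplus>\<^bsub>P\<^esub> (\<ominus>\<^bsub>P\<^esub> (f \<otimes>\<^bsub>P\<^esub> g))"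
    using assms by (simp add: \<delta>_def minus_id_def a_minus_def P.l_distr P.r_distr P.l_minus P.r_minus P.a_assoc del: P.l_neg)
  also have "\<dots> = \<delta> (f \<otimes>\<^bsub>P\<^esub> g)"
    using assms by (simp add: \<delta>_def minus_id_def a_minus_def P.l_neg)
  finally show ?thesis ..
qed

lemma \<delta>_\<sigma>: "f \<in> carrier P \<Longrightarrow> \<delta> (\<sigma> f) = \<sigma> (\<delta> f)"
  by (simp add: \<delta>_def minus_id_def a_minus_def)

lemma sigma_derivation_\<delta>: "sigma_derivation P \<sigma> \<delta>"
  by (auto simp: sigma_derivation_def \<delta>_add \<delta>_mult)

lemma \<sigma>_t_pow_mult:
  assumes "f \<in> carrier P"
  shows "\<sigma> (powser_t R [^]\<^bsub>P\<^esub> (n::nat) \<otimes>\<^bsub>P\<^esub> f) = powser_t R [^]\<^bsub>P\<^esub> n \<otimes>\<^bsub>P\<^esub> \<sigma> f"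
  using assms \<sigma>_t powser_t_carrier
  by (simp add: \<sigma>.hom_nat_pow)

lemma van_factor:
  assumes "f \<in> carrier P" "agree r f \<zero>\<^bsub>P\<^esub>"
  shows "\<exists>h\<in>carrier P. f = powser_t R [^]\<^bsub>P\<^esub> r \<otimes>\<^bsub>P\<^esub> h"
proof
  show h: "(\<lambda>k. f (k + r)) \<in> carrier P" using assms by (intro P_I) simp
  show "f = powser_t R [^]\<^bsub>P\<^esub> r \<otimes>\<^bsub>P\<^esub> (\<lambda>k. f (k + r))"
    using assms by (auto simp: fun_eq_iff powser_mult_t_pow(1)[OF h] agree_def P_zero)
qed

text \<open>Write f as \<open>t^r h\<close>. Then \<sigma> f is \<open>t^r \<sigma>(h)\<close>, and
  \<sigma>(h) - h is divisible by t, which is the factor gained by \<delta>.\<close>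

lemma \<sigma>_van:
  assumes f: "f \<in> carrier P" and v: "agree r f \<zero>\<^bsub>P\<^esub>"
  shows "agree r (\<sigma> f) \<zero>\<^bsub>P\<^esub>" and "agree (Suc r) (\<delta> f) \<zero>\<^bsub>P\<^esub>"
proof -
  obtain h where h: "h \<in> carrier P" "f = powser_t R [^]\<^bsub>P\<^esub> r \<otimes>\<^bsub>P\<^esub> h"
    using van_factor[OF f v] by blast
  have s: "\<sigma> f k = (if k < r then \<zero> else \<sigma> h (k - r))" for k
    unfolding h(2) \<sigma>_t_pow_mult[OF h(1)] using h(1) by (simp add: powser_mult_t_pow)
  then show "agree r (\<sigma> f) \<zero>\<^bsub>P\<^esub>" by (simp add: agree_def P_zero)
  have "f k = (if k < r then \<zero> else h (k - r))" for k
    unfolding h(2) using h(1) by (simp add: powser_mult_t_pow)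
  moreover have "x \<ominus> x = \<zero>" if "x \<in> carrier R" for x using that by (simp add: a_minus_def r_neg)
  moreover have "\<delta> f k = \<sigma> f k \<ominus> f k" for k
    using f by (simp add: \<delta>_def minus_id_def powser_minus_apply)
  ultimately show "agree (Suc r) (\<delta> f) \<zero>\<^bsub>P\<^esub>"
    using s h(1) \<sigma>_0[OF h(1)] by (auto simp: agree_def P_zero less_Suc_eq)
qed

lemma \<sigma>_agree:
  assumes "f \<in> carrier P" "g \<in> carrier P" "agree r f g"
  shows "agree r (\<sigma> f) (\<sigma> g)" and "agree r (\<delta> f) (\<delta> g)"
proof -
  have d: "f \<ominus>\<^bsub>P\<^esub> g \<in> carrier P" "agree r (f \<ominus>\<^bsub>P\<^esub> g) \<zero>\<^bsub>P\<^esub>"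
    using assms by (simp_all add: agree_minus_iff)
  have "\<sigma> (f \<ominus>\<^bsub>P\<^esub> g) = \<sigma> f \<ominus>\<^bsub>P\<^esub> \<sigma> g" using assms by (simp add: a_minus_def)
  then show s: "agree r (\<sigma> f) (\<sigma> g)"
    using \<sigma>_van(1)[OF d] assms by (simp add: agree_minus_iff)
  with assms show "agree r (\<delta> f) (\<delta> g)"
    by (auto simp: \<delta>_def minus_id_def agree_def powser_minus_apply)
qed

text \<open>For the direction from left to right let d be the difference. If d vanishes modulo
  \<open>t^k\<close>, then \<delta> d vanishes modulo \<open>t^(k+1)\<close>, so d = \<sigma> d -
  \<delta> d has the same coefficient k as \<sigma> d. This makes the inverse of \<sigma>
  continuous.\<close>

lemma \<sigma>_agree_iff:
  assumes "f \<in> carrier P" "g \<in> carrier P"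
  shows "agree r (\<sigma> f) (\<sigma> g) \<longleftrightarrow> agree r f g"
proof
  assume s: "agree r (\<sigma> f) (\<sigma> g)"
  let ?d = "f \<ominus>\<^bsub>P\<^esub> g"
  have d: "?d \<in> carrier P" using assms by simp
  have "\<sigma> ?d = \<sigma> f \<ominus>\<^bsub>P\<^esub> \<sigma> g" using assms by (simp add: a_minus_def)
  then have sd: "agree r (\<sigma> ?d) \<zero>\<^bsub>P\<^esub>" using s assms by (simp add: agree_minus_iff)
  have "k \<le> r \<Longrightarrow> agree k ?d \<zero>\<^bsub>P\<^esub>" for k
  proof (induction k)
    case 0
    then show ?case by (simp add: agree_def)
  next
    case (Suc k)
    then have "agree (Suc k) (\<delta> ?d) \<zero>\<^bsub>P\<^esub>" using \<sigma>_van(2)[OF d] by simp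
    then have "(\<sigma> ?d) k \<ominus> ?d k = \<zero>" using d
      by (simp add: agree_def \<delta>_def minus_id_def powser_minus_apply P_zero)
    moreover have "(\<sigma> ?d) k = \<zero>" using sd Suc by (simp add: agree_def P_zero)
    ultimately have "?d k = \<zero>" using d by (metis P_coeff r_right_minus_eq zero_closed)
    then show ?case using Suc by (auto simp: agree_def less_Suc_eq P_zero)
  qed
  then show "agree r f g" using agree_minus_iff[OF assms] by blast
qed (use assms in \<open>auto intro: \<sigma>_agree\<close>)

lemma \<delta>_divisible: "\<delta> ` carrier P \<subseteq> {powser_t R \<otimes>\<^bsub>P\<^esub> f | f. f \<in> carrier P}"
proof (clarify)
  fix f assume f: "f \<in> carrier P"
  have "agree 1 (\<delta> f) \<zero>\<^bsub>P\<^esub>" using \<sigma>_van(2)[OF f, of 0] by (simp add: agree_def)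
  from van_factor[OF \<delta>_closed[OF f] this] obtain h where "h \<in> carrier P" "\<delta> f = powser_t R [^]\<^bsub>P\<^esub> (1::nat) \<otimes>\<^bsub>P\<^esub> h" by blast
  then show "\<exists>h. \<delta> f = powser_t R \<otimes>\<^bsub>P\<^esub> h \<and> h \<in> carrier P" using powser_t_carrier by auto
qed

lemma \<sigma>_bij: "bij_betw \<sigma> (carrier P) (carrier P)"
  using \<sigma>_iso by (simp add: ring_iso_def)

lemma homeomorphic_map_\<sigma>: "homeomorphic_map (tadic_topology R) (tadic_topology R) \<sigma>"
proof -
  let ?\<tau> = "inv_into (carrier P) \<sigma>"
  have \<tau>: "f \<in> carrier P \<Longrightarrow> ?\<tau> f \<in> carrier P \<and> \<sigma> (?\<tau> f) = f" for f
    using \<sigma>_bij by (metis bij_betw_imp_surj_on f_inv_into_f inv_into_into)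
  have "homeomorphic_maps (tadic_topology R) (tadic_topology R) \<sigma> ?\<tau>"
    unfolding homeomorphic_maps_def topspace_tadic_topology
  proof (intro conjI ballI continuous_map_tadic)
    show "?\<tau> (\<sigma> f) = f" if "f \<in> carrier P" for f
      using \<sigma>_bij that by (simp add: bij_betw_def)
    show "agree r (?\<tau> f) (?\<tau> g)" if "f \<in> carrier P" "g \<in> carrier P" "agree r f g" for r f g
      using \<sigma>_agree_iff[of "?\<tau> f" "?\<tau> g" r] \<tau> that by simp
  qed (use \<tau> \<sigma>_agree in auto)
  then show ?thesis by (rule homeomorphic_maps_imp_map)
qed

lemma topologically_nilpotent_\<delta>: "topologically_nilpotent P (tadic_topology R) \<delta>"
  unfolding topologically_nilpotent_def
proof
  fix f assume f: "f \<in> carrier P"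
  have *: "(\<delta> ^^ k) f \<in> carrier P \<and> agree k ((\<delta> ^^ k) f) \<zero>\<^bsub>P\<^esub>" for k
  proof (induction k)
    case (Suc k)
    then show ?case using \<sigma>_van(2) by auto
  qed (use f in \<open>auto simp: agree_def\<close>)
  then show "limitin (tadic_topology R) (\<lambda>k. (\<delta> ^^ k) f) \<zero>\<^bsub>P\<^esub> sequentially"
    by (subst limitin_tadic) (auto simp: eventually_sequentially intro: agree_mono)
qed

end


section \<open>Skew power series rings\<close>

context unipotent_powser_automorphism begin

abbreviation S where "S \<equiv> {a. \<forall>i. a i \<in> carrier P}"

text \<open>Right multiplication by \<open>s\<close>: \<open>(\<Sum>i. s\<^sup>i a\<^sub>i) s = \<Sum>i. s\<^sup>i (s \<sigma>(a\<^sub>i) + \<delta>(a\<^sub>i))\<close>.\<close>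

definition mult_s :: "(nat \<Rightarrow> nat \<Rightarrow> 'a) \<Rightarrow> nat \<Rightarrow> nat \<Rightarrow> 'a" where
  "mult_s a i = (if i = 0 then \<zero>\<^bsub>P\<^esub> else \<sigma> (a (i - 1))) \<oplus>\<^bsub>P\<^esub> \<delta> (a i)"

text \<open>\<open>a b = \<Sum>k. (a s\<^sup>k) b\<^sub>k\<close>, where only the terms with \<open>k < m + r\<close> contribute to the
  coefficient of \<open>s\<^sup>m\<close> modulo \<open>t\<^sup>r\<close>.\<close>

definition partial_mult where
  "partial_mult M a b m = (\<Oplus>\<^bsub>P\<^esub>k\<in>{..<M}. (mult_s ^^ k) a m \<otimes>\<^bsub>P\<^esub> b k)"

text \<open>The coefficient of \<open>t^r\<close> is determined modulo \<open>t^(r+1)\<close>, hence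
  the bound \<open>Suc (m + r)\<close>. Choosing the truncation separately for each coefficient
  gives the limit without speaking of convergence.\<close>

definition skew_mult where
  "skew_mult a b = (\<lambda>m r. partial_mult (Suc (m + r)) a b m r)"

lemma mult_s_closed: "a \<in> S \<Longrightarrow> mult_s a \<in> S"
  by (auto simp: mult_s_def)

lemma mult_s_pow_closed: "a \<in> S \<Longrightarrow> (mult_s ^^ k) a \<in> S"
  by (induction k) (use mult_s_closed in auto)

lemma mult_s_pow_closed' [simp]: "\<forall>i. a i \<in> carrier P \<Longrightarrow> (mult_s ^^ k) a m \<in> carrier P"
  using mult_s_pow_closed by blast

text \<open>Each step either raises the degree in s by one or applies \<delta>, and \<delta> gains a
  factor t. Arriving in degree m after k steps takes at least k - m applications of
  \<delta>.\<close>

lemma mult_s_pow_van: "a \<in> S \<Longrightarrow> agree (k - m) ((mult_s ^^ k) a m) \<zero>\<^bsub>P\<^esub>"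
proof (induction k arbitrary: m)
  case 0
  then show ?case by (simp add: agree_def)
next
  case (Suc k)
  let ?b = "(mult_s ^^ k) a"
  have b: "?b i \<in> carrier P" for i using Suc.prems by simp
  have "agree (Suc (k - m)) (\<delta> (?b m)) \<zero>\<^bsub>P\<^esub>" using \<sigma>_van(2) Suc b by blast
  then have 1: "agree (Suc k - m) (\<delta> (?b m)) \<zero>\<^bsub>P\<^esub>" by (rule agree_mono) simp
  have 2: "agree (Suc k - m) (if m = 0 then \<zero>\<^bsub>P\<^esub> else \<sigma> (?b (m - 1))) \<zero>\<^bsub>P\<^esub>"
  proof (cases m)
    case (Suc n)
    then show ?thesis using \<sigma>_van(1)[OF b Suc.IH[OF Suc.prems], of n] by simp
  qed (simp add: agree_refl)
  show ?case using agree_add[OF 2 1] by (simp add: mult_s_def[of ?b m])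
qed

lemma partial_mult_closed [simp]: "a \<in> S \<Longrightarrow> b \<in> S \<Longrightarrow> partial_mult M a b m \<in> carrier P"
  unfolding partial_mult_def by (intro P.finsum_closed) auto

lemma mult_van: "f \<in> carrier P \<Longrightarrow> g \<in> carrier P \<Longrightarrow> agree r f \<zero>\<^bsub>P\<^esub> \<Longrightarrow> agree r (f \<otimes>\<^bsub>P\<^esub> g) \<zero>\<^bsub>P\<^esub>"
  using agree_mult[of "\<zero>\<^bsub>P\<^esub>" g r f g] by (simp add: agree_refl)

lemma partial_mult_Suc:
  assumes "a \<in> S" "b \<in> S"
  shows "partial_mult (Suc M) a b m = (mult_s ^^ M) a m \<otimes>\<^bsub>P\<^esub> b M \<oplus>\<^bsub>P\<^esub> partial_mult M a b m"
  using assms unfolding partial_mult_def by (simp add: lessThan_Suc P.finsum_insert Pi_iff)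

lemma partial_mult_agree:
  assumes a: "a \<in> S" and b: "b \<in> S" and "m + r \<le> M" "m + r \<le> M'"
  shows "agree r (partial_mult M a b m) (partial_mult M' a b m)"
proof -
  have "agree r (partial_mult (m + r + d) a b m) (partial_mult (m + r) a b m)" for d
  proof (induction d)
    case 0
    then show ?case by (simp add: agree_refl)
  next
    case (Suc d)
    have "agree (m + r + d - m) ((mult_s ^^ (m + r + d)) a m \<otimes>\<^bsub>P\<^esub> b (m + r + d)) \<zero>\<^bsub>P\<^esub>"
      using a b by (intro mult_van mult_s_pow_van) auto
    then have "agree r ((mult_s ^^ (m + r + d)) a m \<otimes>\<^bsub>P\<^esub> b (m + r + d)) \<zero>\<^bsub>P\<^esub>"
      by (rule agree_mono) simp
    from agree_add[OF this Suc] show ?case using a b by (simp add: partial_mult_Suc)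
  qed
  from this[of "M - (m + r)"] this[of "M' - (m + r)"] show ?thesis
    using assms(3,4) agree_sym agree_trans by fastforce
qed

lemma skew_mult_agree:
  assumes "a \<in> S" "b \<in> S" "m + r \<le> M"
  shows "agree r (skew_mult a b m) (partial_mult M a b m)"
  unfolding agree_def skew_mult_def
proof (intro allI impI)
  fix i assume "i < r"
  then show "partial_mult (Suc (m + i)) a b m i = partial_mult M a b m i"
    using agreeD[OF partial_mult_agree[OF assms(1,2), of m "Suc i" "Suc (m + i)" M], of i] assms(3) by simp
qed

lemma skew_mult_closed [simp]:
  assumes "a \<in> S" "b \<in> S" shows "skew_mult a b m \<in> carrier P" "skew_mult a b \<in> S"
proof -
  have "partial_mult M a b m r \<in> carrier R" for m r M by (rule P_coeff) (use assms in simp)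
  then show "skew_mult a b m \<in> carrier P" "skew_mult a b \<in> S" unfolding skew_mult_def by (auto intro!: P_I)
qed

lemma skew_multI:
  assumes "a \<in> S" "b \<in> S" and "\<And>r. \<exists>M\<ge>m + r. agree r (partial_mult M a b m) f"
  shows "skew_mult a b m = f"
proof (rule agree_all_eq)
  fix r
  obtain M where "M \<ge> m + r" "agree r (partial_mult M a b m) f" using assms(3) by blast
  then show "agree r (skew_mult a b m) f" using skew_mult_agree[OF assms(1,2)] agree_trans by blast
qed

lemma mult_s_add:
  "a \<in> S \<Longrightarrow> b \<in> S \<Longrightarrow> mult_s (\<lambda>i. a i \<oplus>\<^bsub>P\<^esub> b i) = (\<lambda>i. mult_s a i \<oplus>\<^bsub>P\<^esub> mult_s b i)"
  by (auto simp: mult_s_def fun_eq_iff \<delta>_add P.a_ac simp del: P_add)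

lemma mult_s_pow_add:
  "a \<in> S \<Longrightarrow> b \<in> S \<Longrightarrow> (mult_s ^^ k) (\<lambda>i. a i \<oplus>\<^bsub>P\<^esub> b i) = (\<lambda>i. (mult_s ^^ k) a i \<oplus>\<^bsub>P\<^esub> (mult_s ^^ k) b i)"
  by (induction k) (auto simp: mult_s_add)

text \<open>This is the rule \<open>c s = s \<sigma>(c) + \<delta>(c)\<close>: a right factor c
  becomes \<sigma> c when s passes it, up to the correction \<delta> c.\<close>

lemma mult_s_scale:
  assumes "a \<in> S" "c \<in> carrier P"
  shows "mult_s (\<lambda>i. a i \<otimes>\<^bsub>P\<^esub> c) i = mult_s a i \<otimes>\<^bsub>P\<^esub> \<sigma> c \<oplus>\<^bsub>P\<^esub> a i \<otimes>\<^bsub>P\<^esub> \<delta> c"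
  using assms by (auto simp: mult_s_def \<delta>_mult P.l_distr P.a_assoc)

lemma mult_s_agree:
  assumes "a \<in> S" "b \<in> S" "\<And>j. j \<le> i \<Longrightarrow> agree r (a j) (b j)"
  shows "agree r (mult_s a i) (mult_s b i)"
  unfolding mult_s_def using assms by (intro agree_add) (auto intro: \<sigma>_agree agree_refl)

lemma mult_s_partial_mult:
  assumes a: "a \<in> S" and b: "b \<in> S"
  shows "mult_s (partial_mult M a b) i =
    (\<Oplus>\<^bsub>P\<^esub>k\<in>{..<M}. (mult_s ^^ Suc k) a i \<otimes>\<^bsub>P\<^esub> \<sigma> (b k) \<oplus>\<^bsub>P\<^esub> (mult_s ^^ k) a i \<otimes>\<^bsub>P\<^esub> \<delta> (b k))"
proof (induction M)
  case 0
  then show ?case by (simp add: partial_mult_def mult_s_def \<delta>_zero)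
next
  case (Suc M)
  have "partial_mult (Suc M) a b = (\<lambda>m. (mult_s ^^ M) a m \<otimes>\<^bsub>P\<^esub> b M \<oplus>\<^bsub>P\<^esub> partial_mult M a b m)"
    using partial_mult_Suc[OF a b] by blast
  moreover have "(\<lambda>m. (mult_s ^^ M) a m \<otimes>\<^bsub>P\<^esub> b M) \<in> S" "partial_mult M a b \<in> S" using a b by auto
  ultimately have "mult_s (partial_mult (Suc M) a b) i =
    mult_s (\<lambda>m. (mult_s ^^ M) a m \<otimes>\<^bsub>P\<^esub> b M) i \<oplus>\<^bsub>P\<^esub> mult_s (partial_mult M a b) i"
    by (simp only: mult_s_add)
  also have "mult_s (\<lambda>m. (mult_s ^^ M) a m \<otimes>\<^bsub>P\<^esub> b M) i =
      (mult_s ^^ Suc M) a i \<otimes>\<^bsub>P\<^esub> \<sigma> (b M) \<oplus>\<^bsub>P\<^esub> (mult_s ^^ M) a i \<otimes>\<^bsub>P\<^esub> \<delta> (b M)"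
    using a b by (subst mult_s_scale) auto
  finally have *: "mult_s (partial_mult (Suc M) a b) i =
      (mult_s ^^ Suc M) a i \<otimes>\<^bsub>P\<^esub> \<sigma> (b M) \<oplus>\<^bsub>P\<^esub> (mult_s ^^ M) a i \<otimes>\<^bsub>P\<^esub> \<delta> (b M) \<oplus>\<^bsub>P\<^esub>
      mult_s (partial_mult M a b) i" .
  have cl: "(mult_s ^^ Suc k) a i \<in> carrier P" for k
    using mult_s_pow_closed[OF a, of "Suc k"] by blast
  show ?case unfolding * Suc.IH lessThan_Suc
    using a b cl by (subst P.finsum_insert) (auto simp del: funpow.simps)
qed

text \<open>Associativity for the case that the last factor is \<open>s\<close>.\<close>

lemma skew_mult_mult_s:
  assumes a: "a \<in> S" and b: "b \<in> S"
  shows "skew_mult a (mult_s b) = mult_s (skew_mult a b)"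
proof
  fix m
  show "skew_mult a (mult_s b) m = mult_s (skew_mult a b) m"
  proof (rule skew_multI)
    fix r
    define M where "M = m + r"
    let ?q = "\<lambda>k. (mult_s ^^ k) a m"
    have q: "?q k \<in> carrier P" for k using a by simp
    have sb: "b k \<in> carrier P" for k using b by simp
    let ?T = "(\<Oplus>\<^bsub>P\<^esub>k\<in>{..<M}. ?q (Suc k) \<otimes>\<^bsub>P\<^esub> \<sigma> (b k))"
    let ?U = "(\<Oplus>\<^bsub>P\<^esub>k\<in>{..<M}. ?q k \<otimes>\<^bsub>P\<^esub> \<delta> (b k))"
    have clT: "?T \<in> carrier P" using q sb by (intro P.finsum_closed) (auto simp del: funpow.simps)
    have clU: "?U \<in> carrier P" using q sb by (intro P.finsum_closed) auto
    have "partial_mult (Suc M) a (mult_s b) m =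
      (\<Oplus>\<^bsub>P\<^esub>k\<in>{..<Suc M}. ?q k \<otimes>\<^bsub>P\<^esub> (if k = 0 then \<zero>\<^bsub>P\<^esub> else \<sigma> (b (k - 1))) \<oplus>\<^bsub>P\<^esub> ?q k \<otimes>\<^bsub>P\<^esub> \<delta> (b k))"
      unfolding partial_mult_def mult_s_def[of b] using q sb
      by (intro P.finsum_cong') (auto simp: P.r_distr)
    also have "\<dots> = (\<Oplus>\<^bsub>P\<^esub>k\<in>{..<Suc M}. ?q k \<otimes>\<^bsub>P\<^esub> (if k = 0 then \<zero>\<^bsub>P\<^esub> else \<sigma> (b (k - 1)))) \<oplus>\<^bsub>P\<^esub>
        (\<Oplus>\<^bsub>P\<^esub>k\<in>{..<Suc M}. ?q k \<otimes>\<^bsub>P\<^esub> \<delta> (b k))"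
      using q sb by (intro P.finsum_addf) auto
    also have "(\<Oplus>\<^bsub>P\<^esub>k\<in>{..<Suc M}. ?q k \<otimes>\<^bsub>P\<^esub> \<delta> (b k)) = ?q M \<otimes>\<^bsub>P\<^esub> \<delta> (b M) \<oplus>\<^bsub>P\<^esub> ?U"
      using q sb by (simp add: lessThan_Suc P.finsum_insert Pi_iff)
    also have "(\<Oplus>\<^bsub>P\<^esub>k\<in>{..<Suc M}. ?q k \<otimes>\<^bsub>P\<^esub> (if k = 0 then \<zero>\<^bsub>P\<^esub> else \<sigma> (b (k - 1)))) = ?T"
    proof -
      have i: "{..<Suc M} = insert 0 (Suc ` {..<M})" by (auto simp: image_iff less_Suc_eq_0_disj)
      have "(\<Oplus>\<^bsub>P\<^esub>k\<in>{..<Suc M}. ?q k \<otimes>\<^bsub>P\<^esub> (if k = 0 then \<zero>\<^bsub>P\<^esub> else \<sigma> (b (k - 1)))) =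
        (\<Oplus>\<^bsub>P\<^esub>k\<in>Suc ` {..<M}. ?q k \<otimes>\<^bsub>P\<^esub> \<sigma> (b (k - 1)))"
        unfolding i using q q[of 0] sb
        by (subst P.finsum_insert) (auto intro!: P.finsum_cong' P.finsum_closed simp del: funpow.simps)
      also have "\<dots> = ?T" using q sb by (subst P.finsum_reindex) (auto simp del: funpow.simps)
      finally show ?thesis .
    qed
    finally have 1: "partial_mult (Suc M) a (mult_s b) m = ?T \<oplus>\<^bsub>P\<^esub> (?q M \<otimes>\<^bsub>P\<^esub> \<delta> (b M) \<oplus>\<^bsub>P\<^esub> ?U)" .
    have 2: "mult_s (partial_mult M a b) m = ?T \<oplus>\<^bsub>P\<^esub> ?U"
      unfolding mult_s_partial_mult[OF a b] using q sb
      by (subst P.finsum_addf) (auto simp del: funpow.simps)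
    \<comment> \<open>The range up to M is needed for the shifted \<sigma>-part to match, and it
      gives the \<delta>-part one term too many. By \<open>M = m + r\<close> this boundary term is
      divisible by \<open>t^r\<close>.\<close>
    have "agree r (?q M \<otimes>\<^bsub>P\<^esub> \<delta> (b M)) \<zero>\<^bsub>P\<^esub>"
      using mult_s_pow_van[OF a, of M m] q sb by (intro mult_van) (auto simp: M_def)
    then have "agree r (?T \<oplus>\<^bsub>P\<^esub> (?q M \<otimes>\<^bsub>P\<^esub> \<delta> (b M) \<oplus>\<^bsub>P\<^esub> ?U)) (?T \<oplus>\<^bsub>P\<^esub> (\<zero>\<^bsub>P\<^esub> \<oplus>\<^bsub>P\<^esub> ?U))"
      by (intro agree_add agree_refl)
    then have "agree r (partial_mult (Suc M) a (mult_s b) m) (mult_s (partial_mult M a b) m)"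
      using clU unfolding 1 2 by simp
    moreover have "agree r (mult_s (skew_mult a b) m) (mult_s (partial_mult M a b) m)"
    proof (rule mult_s_agree)
      show "agree r (skew_mult a b j) (partial_mult M a b j)" if "j \<le> m" for j
        using that by (intro skew_mult_agree a b) (simp add: M_def)
    qed (use a b skew_mult_closed in auto)
    ultimately have "agree r (partial_mult (Suc M) a (mult_s b) m) (mult_s (skew_mult a b) m)"
      using agree_sym agree_trans by blast
    then show "\<exists>M\<ge>m + r. agree r (partial_mult M a (mult_s b) m) (mult_s (skew_mult a b) m)"
      by (intro exI[of _ "Suc M"]) (simp add: M_def)
  qed (use a b mult_s_closed in auto)
qed

lemma skew_mult_mult_s_pow:
  assumes a: "a \<in> S" and b: "b \<in> S"
  shows "skew_mult a ((mult_s ^^ k) b) = (mult_s ^^ k) (skew_mult a b)"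
proof (induction k)
  case (Suc k)
  then show ?case using skew_mult_mult_s[OF a mult_s_pow_closed[OF b]] by simp
qed simp

text \<open>Expanding \<open>(a b) c\<close> and \<open>a (b c)\<close> in the coefficients of c
  reduces the claim to \<open>a (b s^k) = (a b) s^k\<close>. Modulo \<open>t^r\<close> all sums
  involved are finite and may be interchanged.\<close>

lemma skew_mult_assoc:
  assumes a: "a \<in> S" and b: "b \<in> S" and c: "c \<in> S"
  shows "skew_mult (skew_mult a b) c = skew_mult a (skew_mult b c)"
proof
  fix m
  have ab: "skew_mult a b \<in> S" and bc: "skew_mult b c \<in> S" using a b c by (simp_all del: mem_Collect_eq)
  have aq: "(mult_s ^^ j) a m \<in> carrier P" and bq: "(mult_s ^^ k) b j \<in> carrier P" and cc: "c k \<in> carrier P" for j k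
    using a b c by auto
  show "skew_mult (skew_mult a b) c m = skew_mult a (skew_mult b c) m"
  proof (rule agree_all_eq)
    fix r
    define M where "M = m + r"
    \<comment> \<open>M terms determine the outer product in degree m modulo \<open>t^r\<close>. The
      inner products are needed in all degrees j < M, and each takes j + r terms.\<close>
    define M' where "M' = M + r"
    have 1: "agree r (skew_mult a (skew_mult b c) m) (partial_mult M a (skew_mult b c) m)"
      using skew_mult_agree[OF a bc] by (simp add: M_def)
    have 2: "agree r (partial_mult M a (skew_mult b c) m)
        (\<Oplus>\<^bsub>P\<^esub>j\<in>{..<M}. (mult_s ^^ j) a m \<otimes>\<^bsub>P\<^esub> partial_mult M' b c j)"
      unfolding partial_mult_def[of _ a]
      using aq bc partial_mult_closed[OF b c] skew_mult_agree[OF b c]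
      by (intro agree_finsum agree_mult agree_refl) (auto simp: M'_def)
    have "(\<Oplus>\<^bsub>P\<^esub>j\<in>{..<M}. (mult_s ^^ j) a m \<otimes>\<^bsub>P\<^esub> partial_mult M' b c j) =
      (\<Oplus>\<^bsub>P\<^esub>j\<in>{..<M}. \<Oplus>\<^bsub>P\<^esub>k\<in>{..<M'}. (mult_s ^^ j) a m \<otimes>\<^bsub>P\<^esub> ((mult_s ^^ k) b j \<otimes>\<^bsub>P\<^esub> c k))"
      unfolding partial_mult_def using aq bq cc
      by (intro P.finsum_cong' P.finsum_rdistr) (auto intro!: P.finsum_closed)
    also have "\<dots> = (\<Oplus>\<^bsub>P\<^esub>k\<in>{..<M'}. \<Oplus>\<^bsub>P\<^esub>j\<in>{..<M}. (mult_s ^^ j) a m \<otimes>\<^bsub>P\<^esub> (mult_s ^^ k) b j \<otimes>\<^bsub>P\<^esub> c k)"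
      using aq bq cc by (subst P.finsum_swap) (auto simp: P.m_assoc)
    also have "\<dots> = (\<Oplus>\<^bsub>P\<^esub>k\<in>{..<M'}. partial_mult M a ((mult_s ^^ k) b) m \<otimes>\<^bsub>P\<^esub> c k)"
      unfolding partial_mult_def using aq bq cc
      by (intro P.finsum_cong' P.finsum_ldistr[symmetric]) (auto intro!: P.finsum_closed)
    finally have 3: "(\<Oplus>\<^bsub>P\<^esub>j\<in>{..<M}. (mult_s ^^ j) a m \<otimes>\<^bsub>P\<^esub> partial_mult M' b c j) = \<dots>" .
    have bq': "(mult_s ^^ k) b \<in> S" for k by (rule mult_s_pow_closed[OF b])
    have 4: "agree r (\<Oplus>\<^bsub>P\<^esub>k\<in>{..<M'}. partial_mult M a ((mult_s ^^ k) b) m \<otimes>\<^bsub>P\<^esub> c k)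
        (\<Oplus>\<^bsub>P\<^esub>k\<in>{..<M'}. skew_mult a ((mult_s ^^ k) b) m \<otimes>\<^bsub>P\<^esub> c k)"
    proof (intro agree_finsum agree_mult agree_refl)
      fix k
      show "agree r (partial_mult M a ((mult_s ^^ k) b) m) (skew_mult a ((mult_s ^^ k) b) m)"
        by (rule agree_sym[OF skew_mult_agree[OF a bq']]) (simp add: M_def)
    qed (use cc skew_mult_closed(1)[OF a bq'] partial_mult_closed[OF a bq'] in auto)
    have 5: "(\<Oplus>\<^bsub>P\<^esub>k\<in>{..<M'}. skew_mult a ((mult_s ^^ k) b) m \<otimes>\<^bsub>P\<^esub> c k) = partial_mult M' (skew_mult a b) c m"
      by (simp only: partial_mult_def skew_mult_mult_s_pow[OF a b])
    have 6: "agree r (skew_mult (skew_mult a b) c m) (partial_mult M' (skew_mult a b) c m)"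
      by (rule skew_mult_agree[OF ab c]) (simp add: M'_def M_def)
    show "agree r (skew_mult (skew_mult a b) c m) (skew_mult a (skew_mult b c) m)"
      using agree_trans[OF 1 agree_trans[OF 2[unfolded 3] 4[unfolded 5]]] 6 agree_sym agree_trans by blast
  qed
qed

abbreviation T where "T \<equiv> skew_powser_ring P (tadic_topology R) \<sigma> \<delta>"

definition skew_one where "skew_one = (\<lambda>i::nat. if i = 0 then \<one>\<^bsub>P\<^esub> else \<zero>\<^bsub>P\<^esub>)"

lemma skew_one_closed: "skew_one \<in> S"
  by (simp add: skew_one_def)

text \<open>These are the powers of s themselves: \<delta> kills 0 and 1, so only the shift
  remains.\<close>

lemma mult_s_pow_one: "(mult_s ^^ k) skew_one = (\<lambda>i. if i = k then \<one>\<^bsub>P\<^esub> else \<zero>\<^bsub>P\<^esub>)"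
proof (induction k)
  case 0
  then show ?case by (simp add: skew_one_def)
next
  case (Suc k)
  show ?case
  proof
    fix i
    show "(mult_s ^^ Suc k) skew_one i = (if i = Suc k then \<one>\<^bsub>P\<^esub> else \<zero>\<^bsub>P\<^esub>)"
      using Suc mult_s_def[of "(mult_s ^^ k) skew_one" i] by (cases i) (auto simp: \<delta>_one \<delta>_zero)
  qed
qed

lemma skew_mult_one:
  assumes a: "a \<in> S"
  shows "skew_mult skew_one a = a" "skew_mult a skew_one = a"
proof -
  show "skew_mult skew_one a = a"
  proof
    fix m
    have "partial_mult (Suc m + r) skew_one a m = a m" for r
    proof -
      have "(\<Oplus>\<^bsub>P\<^esub>k\<in>{..<Suc m + r}. (if m = k then \<one>\<^bsub>P\<^esub> else \<zero>\<^bsub>P\<^esub>) \<otimes>\<^bsub>P\<^esub> a k) = (if m = m then \<one>\<^bsub>P\<^esub> else \<zero>\<^bsub>P\<^esub>) \<otimes>\<^bsub>P\<^esub> a m"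
        using a by (intro P.finsum_eq_single) auto
      then show ?thesis using a unfolding partial_mult_def mult_s_pow_one by simp
    qed
    then have "\<exists>M\<ge>m + r. agree r (partial_mult M skew_one a m) (a m)" for r
      by (intro exI[of _ "Suc m + r"]) (simp add: agree_refl)
    then show "skew_mult skew_one a m = a m"
      using a skew_one_closed by (intro skew_multI) auto
  qed
  show "skew_mult a skew_one = a"
  proof
    fix m
    have "partial_mult (Suc m + r) a skew_one m = a m" for r
    proof -
      have "(\<Oplus>\<^bsub>P\<^esub>k\<in>{..<Suc m + r}. (mult_s ^^ k) a m \<otimes>\<^bsub>P\<^esub> skew_one k) = (mult_s ^^ 0) a m \<otimes>\<^bsub>P\<^esub> skew_one 0"
        using a by (intro P.finsum_eq_single) (auto simp: skew_one_def)
      then show ?thesis using a unfolding partial_mult_def by (simp add: skew_one_def)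
    qed
    then have "\<exists>M\<ge>m + r. agree r (partial_mult M a skew_one m) (a m)" for r
      by (intro exI[of _ "Suc m + r"]) (simp add: agree_refl)
    then show "skew_mult a skew_one m = a m"
      using a skew_one_closed by (intro skew_multI) auto
  qed
qed

lemma skew_mult_distrib:
  assumes a: "a \<in> S" and b: "b \<in> S" and c: "c \<in> S"
  shows "skew_mult (\<lambda>i. a i \<oplus>\<^bsub>P\<^esub> b i) c = (\<lambda>i. skew_mult a c i \<oplus>\<^bsub>P\<^esub> skew_mult b c i)"
    "skew_mult c (\<lambda>i. a i \<oplus>\<^bsub>P\<^esub> b i) = (\<lambda>i. skew_mult c a i \<oplus>\<^bsub>P\<^esub> skew_mult c b i)"
proof -
  have "partial_mult M (\<lambda>i. a i \<oplus>\<^bsub>P\<^esub> b i) c m = partial_mult M a c m \<oplus>\<^bsub>P\<^esub> partial_mult M b c m" for M m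
    using a b c unfolding partial_mult_def mult_s_pow_add[OF a b]
    by (subst P.finsum_addf[symmetric]) (auto intro!: P.finsum_cong' simp: P.l_distr)
  then show "skew_mult (\<lambda>i. a i \<oplus>\<^bsub>P\<^esub> b i) c = (\<lambda>i. skew_mult a c i \<oplus>\<^bsub>P\<^esub> skew_mult b c i)"
    by (simp add: skew_mult_def fun_eq_iff P_add)
  have "partial_mult M c (\<lambda>i. a i \<oplus>\<^bsub>P\<^esub> b i) m = partial_mult M c a m \<oplus>\<^bsub>P\<^esub> partial_mult M c b m" for M m
    using a b c unfolding partial_mult_def
    by (subst P.finsum_addf[symmetric]) (auto intro!: P.finsum_cong' simp: P.r_distr)
  then show "skew_mult c (\<lambda>i. a i \<oplus>\<^bsub>P\<^esub> b i) = (\<lambda>i. skew_mult c a i \<oplus>\<^bsub>P\<^esub> skew_mult c b i)"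
    by (simp add: skew_mult_def fun_eq_iff P_add)
qed

end


section \<open>The binomial product formula and the ring of skew power series\<close>

context abelian_monoid begin

text \<open>Stated for additive maps, so that it covers \<delta>, which is not a ring
  homomorphism.\<close>

lemma additive_finsum:
  assumes f: "\<And>x. x \<in> carrier G \<Longrightarrow> \<phi> x \<in> carrier G" "\<phi> \<zero> = \<zero>"
    "\<And>x y. x \<in> carrier G \<Longrightarrow> y \<in> carrier G \<Longrightarrow> \<phi> (x \<oplus> y) = \<phi> x \<oplus> \<phi> y"
    and g: "\<And>i. i \<in> A \<Longrightarrow> g i \<in> carrier G"
  shows "\<phi> (\<Oplus>i\<in>A. g i) = (\<Oplus>i\<in>A. \<phi> (g i))"
  using g
proof (induction A rule: infinite_finite_induct)
  case (insert x A)
  then show ?case using f by (simp add: finsum_insert Pi_iff finsum_closed)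
qed (use f in \<open>auto simp: finsum_infinite\<close>)

lemma additive_add_pow:
  assumes f: "\<And>x. x \<in> carrier G \<Longrightarrow> \<phi> x \<in> carrier G" "\<phi> \<zero> = \<zero>"
    "\<And>x y. x \<in> carrier G \<Longrightarrow> y \<in> carrier G \<Longrightarrow> \<phi> (x \<oplus> y) = \<phi> x \<oplus> \<phi> y"
    and x: "x \<in> carrier G"
  shows "\<phi> (add_pow G (n::nat) x) = add_pow G n (\<phi> x)"
proof (induction n)
  case (Suc n)
  have "add_pow G n x \<in> carrier G" using x by (rule add.nat_pow_closed)
  then show ?case using Suc f x by (simp add: add_pow_def)
qed (use f in \<open>simp add: add_pow_def\<close>)

end

context unipotent_powser_automorphism begin

lemma \<sigma>_pow_closed [simp]: "f \<in> carrier P \<Longrightarrow> (\<sigma> ^^ n) f \<in> carrier P"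
  by (induction n) auto

lemma \<delta>_pow_closed [simp]: "f \<in> carrier P \<Longrightarrow> (\<delta> ^^ n) f \<in> carrier P"
  by (induction n) auto

lemma \<delta>_pow_van: "f \<in> carrier P \<Longrightarrow> agree k ((\<delta> ^^ k) f) \<zero>\<^bsub>P\<^esub>"
  by (induction k) (use \<sigma>_van(2) in \<open>auto simp: agree_def\<close>)

lemma \<sigma>_\<delta>_pow: "f \<in> carrier P \<Longrightarrow> \<sigma> ((\<delta> ^^ k) f) = (\<delta> ^^ k) (\<sigma> f)"
  by (induction k) (auto simp: \<delta>_\<sigma>[symmetric])

lemma add_pow_closed [simp]: "f \<in> carrier P \<Longrightarrow> add_pow P (n::nat) f \<in> carrier P"
  using P.add.nat_pow_closed by (simp add: add_pow_def)

lemma add_pow_add: "f \<in> carrier P \<Longrightarrow> add_pow P (m + n :: nat) f = add_pow P m f \<oplus>\<^bsub>P\<^esub> add_pow P n f"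
  using P.add.nat_pow_mult[of f m n] by (simp add: add_pow_def)

lemma add_pow_0 [simp]: "add_pow P (0::nat) f = \<zero>\<^bsub>P\<^esub>"
  by (simp add: add_pow_def)

lemma add_pow_van: "f \<in> carrier P \<Longrightarrow> agree r f \<zero>\<^bsub>P\<^esub> \<Longrightarrow> agree r (add_pow P (n::nat) f) \<zero>\<^bsub>P\<^esub>"
proof (induction n)
  case 0
  then show ?case by (simp add: agree_refl)
next
  case (Suc n)
  then have "agree r (add_pow P n f \<oplus>\<^bsub>P\<^esub> f) (\<zero>\<^bsub>P\<^esub> \<oplus>\<^bsub>P\<^esub> \<zero>\<^bsub>P\<^esub>)" by (intro agree_add) auto
  then show ?case using Suc by (simp add: add_pow_def)
qed

text \<open>Since \<sigma> and \<delta> commute, all words with n letters \<sigma> and k - n letters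
  \<delta> act alike, and there are \<open>k choose n\<close> of them. The induction is Pascal's
  rule. This is the link between the operator \<open>mult_s\<close> and the binomials in the
  definition of the product.\<close>

lemma mult_s_pow_formula:
  assumes a: "a \<in> S"
  shows "(mult_s ^^ k) a m = (\<Oplus>\<^bsub>P\<^esub>n\<in>{..m}. add_pow P (k choose n) ((\<delta> ^^ (k - n)) ((\<sigma> ^^ n) (a (m - n)))))"
proof (induction k arbitrary: m)
  case 0
  have "(\<Oplus>\<^bsub>P\<^esub>n\<in>{..m}. add_pow P (0 choose n) ((\<delta> ^^ (0 - n)) ((\<sigma> ^^ n) (a (m - n))))) =
    add_pow P (0 choose 0) ((\<delta> ^^ (0 - 0)) ((\<sigma> ^^ 0) (a (m - 0))))"
    using a by (intro P.finsum_eq_single) (auto simp: binomial_eq_0)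
  then show ?case using a by (simp add: add_pow_def)
next
  case (Suc k)
  let ?X = "\<lambda>k m n. (\<delta> ^^ (k - n)) ((\<sigma> ^^ n) (a (m - n)))"
  \<comment> \<open>The part that comes from \<sigma>, shifted by one in n. The value 0 at n = 0
    lets it be added to the \<delta>-part over the same range.\<close>
  let ?g = "\<lambda>n. if n = 0 then \<zero>\<^bsub>P\<^esub> else add_pow P (k choose (n - 1)) (?X (Suc k) m n)"
  have ac: "a i \<in> carrier P" for i using a by simp
  have "(if m = 0 then \<zero>\<^bsub>P\<^esub> else \<sigma> ((mult_s ^^ k) a (m - 1))) = (\<Oplus>\<^bsub>P\<^esub>n\<in>{..m}. ?g n)"
  proof (cases m)
    case 0
    then show ?thesis by simp
  next
    case m: (Suc m')
    have i: "{..m} = insert 0 (Suc ` {..m'})" by (simp add: m atMost_Suc_eq_insert_0)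
    have "(\<Oplus>\<^bsub>P\<^esub>n\<in>{..m}. ?g n) = (\<Oplus>\<^bsub>P\<^esub>n\<in>Suc ` {..m'}. ?g n)"
      unfolding i using ac by (subst P.finsum_insert) (auto intro!: P.finsum_closed simp del: funpow.simps)
    also have "\<dots> = (\<Oplus>\<^bsub>P\<^esub>n\<in>{..m'}. ?g (Suc n))"
      using ac by (intro P.finsum_reindex) (auto simp del: funpow.simps)
    also have "\<dots> = (\<Oplus>\<^bsub>P\<^esub>n\<in>{..m'}. \<sigma> (add_pow P (k choose n) (?X k m' n)))"
    proof (intro P.finsum_cong' refl)
      fix n assume "n \<in> {..m'}"
      have "\<sigma> (add_pow P (k choose n) (?X k m' n)) = add_pow P (k choose n) (\<sigma> (?X k m' n))"
        using ac by (intro P.additive_add_pow) auto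
      then show "?g (Suc n) = \<sigma> (add_pow P (k choose n) (?X k m' n))"
        using ac by (simp add: \<sigma>_\<delta>_pow m)
    qed (use ac in auto)
    also have "\<dots> = \<sigma> (\<Oplus>\<^bsub>P\<^esub>n\<in>{..m'}. add_pow P (k choose n) (?X k m' n))"
      using ac by (intro P.additive_finsum[symmetric]) auto
    also have "\<dots> = \<sigma> ((mult_s ^^ k) a m')" by (simp add: Suc)
    finally show ?thesis by (simp add: m)
  qed
  moreover have "\<delta> ((mult_s ^^ k) a m) = (\<Oplus>\<^bsub>P\<^esub>n\<in>{..m}. add_pow P (k choose n) (?X (Suc k) m n))"
  proof -
    have "\<delta> ((mult_s ^^ k) a m) = (\<Oplus>\<^bsub>P\<^esub>n\<in>{..m}. \<delta> (add_pow P (k choose n) (?X k m n)))"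
      unfolding Suc using ac by (intro P.additive_finsum) (auto simp: \<delta>_zero \<delta>_add)
    also have "\<dots> = (\<Oplus>\<^bsub>P\<^esub>n\<in>{..m}. add_pow P (k choose n) (?X (Suc k) m n))"
    proof (intro P.finsum_cong' refl)
      fix n
      have "\<delta> (add_pow P (k choose n) (?X k m n)) = add_pow P (k choose n) (\<delta> (?X k m n))"
        using ac by (intro P.additive_add_pow) (auto simp: \<delta>_zero \<delta>_add)
      then show "\<delta> (add_pow P (k choose n) (?X k m n)) = add_pow P (k choose n) (?X (Suc k) m n)"
        \<comment> \<open>For n > k truncated subtraction does not give
          \<open>Suc k - n = Suc (k - n)\<close>, but then the binomial coefficient is 0.\<close>
        by (cases "n \<le> k") (simp_all add: Suc_diff_le binomial_eq_0)
    qed (use ac in \<open>auto simp del: funpow.simps\<close>)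
    finally show ?thesis .
  qed
  ultimately have "(mult_s ^^ Suc k) a m = (\<Oplus>\<^bsub>P\<^esub>n\<in>{..m}. ?g n) \<oplus>\<^bsub>P\<^esub> (\<Oplus>\<^bsub>P\<^esub>n\<in>{..m}. add_pow P (k choose n) (?X (Suc k) m n))"
    by (simp add: mult_s_def)
  also have "\<dots> = (\<Oplus>\<^bsub>P\<^esub>n\<in>{..m}. ?g n \<oplus>\<^bsub>P\<^esub> add_pow P (k choose n) (?X (Suc k) m n))"
    using ac by (intro P.finsum_addf[symmetric]) (auto simp del: funpow.simps)
  also have "\<dots> = (\<Oplus>\<^bsub>P\<^esub>n\<in>{..m}. add_pow P (Suc k choose n) (?X (Suc k) m n))"
  proof (intro P.finsum_cong' refl)
    fix n
    show "?g n \<oplus>\<^bsub>P\<^esub> add_pow P (k choose n) (?X (Suc k) m n) = add_pow P (Suc k choose n) (?X (Suc k) m n)"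
    proof (cases n)
      case (Suc n')
      then show ?thesis using ac by (subst Suc) (simp add: add_pow_add del: funpow.simps)
    qed (use ac in \<open>simp del: funpow.simps\<close>)
  qed (use ac in \<open>auto simp del: funpow.simps\<close>)
  finally show ?case .
qed

text \<open>For a fixed coefficient the convergent inner sums can be cut off at a common bound, so
  the two summations may be interchanged. Summing over n first then yields the coefficients of
  \<open>a s^k\<close> by \<open>mult_s_pow_formula\<close>.\<close>

lemma skew_powser_mult:
  assumes a: "a \<in> S" and b: "b \<in> S"
  shows "a \<otimes>\<^bsub>T\<^esub> b = skew_mult a b"
proof (intro ext)
  fix m r
  define M where "M = Suc (m + r)"
  let ?c = "\<lambda>n k. add_pow P (k choose n) ((\<delta> ^^ (k - n)) ((\<sigma> ^^ n) (a (m - n))) \<otimes>\<^bsub>P\<^esub> b k)"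
  let ?d = "\<lambda>n k. add_pow P (k choose n) ((\<delta> ^^ (k - n)) ((\<sigma> ^^ n) (a (m - n))))"
  have ac: "a i \<in> carrier P" and bc: "b i \<in> carrier P" for i using a b by auto
  have c: "?c n k \<in> carrier P" for n k using ac bc by simp
  have cd: "?c n k = ?d n k \<otimes>\<^bsub>P\<^esub> b k" for n k
    using ac bc by (intro P.add_pow_ldistr[symmetric]) auto
  have van: "agree (k - n) (?c n k) \<zero>\<^bsub>P\<^esub>" for n k
    using ac bc by (intro add_pow_van mult_van \<delta>_pow_van) auto
  have sum: "suminf_from P (tadic_topology R) n (?c n) i = (\<Oplus>\<^bsub>P\<^esub>k\<in>{n..<M}. ?c n k) i" if "n + i < M" for n i M
    by (rule suminf_from_powser) (use c van that in auto)
  have cl: "suminf_from P (tadic_topology R) n (?c n) \<in> carrier P" for n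
  proof (rule P_I)
    fix i
    have "suminf_from P (tadic_topology R) n (?c n) i = (\<Oplus>\<^bsub>P\<^esub>k\<in>{n..<Suc (n + i)}. ?c n k) i"
      by (rule sum) simp
    also have "\<dots> \<in> carrier R" using c by (intro P_coeff P.finsum_closed) auto
    finally show "suminf_from P (tadic_topology R) n (?c n) i \<in> carrier R" .
  qed
  have "(a \<otimes>\<^bsub>T\<^esub> b) m r = (\<Oplus>\<^bsub>P\<^esub>n\<in>{..m}. suminf_from P (tadic_topology R) n (?c n)) r"
    by (simp add: skew_powser_ring_def)
  also have "\<dots> = (\<Oplus>n\<in>{..m}. suminf_from P (tadic_topology R) n (?c n) r)"
    using cl by (simp add: powser_finsum_apply)
  also have "\<dots> = (\<Oplus>n\<in>{..m}. (\<Oplus>\<^bsub>P\<^esub>k\<in>{..<M}. ?c n k) r)"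
  proof (intro finsum_cong' refl)
    fix n assume n: "n \<in> {..m}"
    have "suminf_from P (tadic_topology R) n (?c n) r = (\<Oplus>\<^bsub>P\<^esub>k\<in>{n..<M}. ?c n k) r"
      by (rule sum) (use n in \<open>simp add: M_def\<close>)
    \<comment> \<open>For k < n the binomial coefficient is 0; after this extension the range of k
      no longer depends on n.\<close>
    also have "(\<Oplus>\<^bsub>P\<^esub>k\<in>{n..<M}. ?c n k) = (\<Oplus>\<^bsub>P\<^esub>k\<in>{..<M}. ?c n k)"
      using ac bc by (intro P.add.finprod_mono_neutral_cong_left) (auto simp: binomial_eq_0)
    finally show "suminf_from P (tadic_topology R) n (?c n) r = (\<Oplus>\<^bsub>P\<^esub>k\<in>{..<M}. ?c n k) r" .
  qed (use c in \<open>auto intro!: P_coeff P.finsum_closed\<close>)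
  also have "\<dots> = (\<Oplus>\<^bsub>P\<^esub>n\<in>{..m}. \<Oplus>\<^bsub>P\<^esub>k\<in>{..<M}. ?c n k) r"
    using c by (subst powser_finsum_apply) (auto intro!: P.finsum_closed)
  also have "(\<Oplus>\<^bsub>P\<^esub>n\<in>{..m}. \<Oplus>\<^bsub>P\<^esub>k\<in>{..<M}. ?c n k) = (\<Oplus>\<^bsub>P\<^esub>k\<in>{..<M}. \<Oplus>\<^bsub>P\<^esub>n\<in>{..m}. ?d n k \<otimes>\<^bsub>P\<^esub> b k)"
    unfolding cd using ac bc by (intro P.finsum_swap) auto
  also have "\<dots> = (\<Oplus>\<^bsub>P\<^esub>k\<in>{..<M}. (\<Oplus>\<^bsub>P\<^esub>n\<in>{..m}. ?d n k) \<otimes>\<^bsub>P\<^esub> b k)"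
    using ac bc by (intro P.finsum_cong' P.finsum_ldistr[symmetric]) (auto intro!: P.finsum_closed)
  also have "\<dots> r = skew_mult a b m r"
    unfolding skew_mult_def partial_mult_def mult_s_pow_formula[OF a] M_def by simp
  finally show "(a \<otimes>\<^bsub>T\<^esub> b) m r = skew_mult a b m r" .
qed

lemma skew_powser_carrier: "carrier T = S"
  by (simp add: skew_powser_ring_def)

lemma skew_powser_ring_ring: "ring T"
proof (intro ringI abelian_groupI monoidI)
  fix a b c assume "a \<in> carrier T" "b \<in> carrier T"
  then have ab: "a \<in> S" "b \<in> S" by (simp_all add: skew_powser_carrier)
  show "a \<oplus>\<^bsub>T\<^esub> b \<in> carrier T" "a \<oplus>\<^bsub>T\<^esub> b = b \<oplus>\<^bsub>T\<^esub> a"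
    using ab by (auto simp: skew_powser_ring_def P.a_ac)
  show "a \<otimes>\<^bsub>T\<^esub> b \<in> carrier T"
    using skew_mult_closed(2)[OF ab] unfolding skew_powser_mult[OF ab] skew_powser_carrier .
  show "\<zero>\<^bsub>T\<^esub> \<oplus>\<^bsub>T\<^esub> a = a"
    using ab by (auto simp: skew_powser_ring_def)
  show "\<exists>y\<in>carrier T. y \<oplus>\<^bsub>T\<^esub> a = \<zero>\<^bsub>T\<^esub>"
    using ab by (intro bexI[of _ "\<lambda>i. \<ominus>\<^bsub>P\<^esub> a i"]) (auto simp: skew_powser_ring_def P.l_neg)
  have one: "\<one>\<^bsub>T\<^esub> = skew_one" by (simp add: skew_powser_ring_def skew_one_def)
  show "\<one>\<^bsub>T\<^esub> \<otimes>\<^bsub>T\<^esub> a = a" "a \<otimes>\<^bsub>T\<^esub> \<one>\<^bsub>T\<^esub> = a"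
    unfolding one using ab by (simp_all only: skew_powser_mult skew_one_closed skew_mult_one)
  assume "c \<in> carrier T"
  then have c: "c \<in> S" by (simp add: skew_powser_carrier)
  have add: "x \<oplus>\<^bsub>T\<^esub> y = (\<lambda>i. x i \<oplus>\<^bsub>P\<^esub> y i)" for x y by (simp add: skew_powser_ring_def)
  have add_S: "(\<lambda>i. a i \<oplus>\<^bsub>P\<^esub> b i) \<in> S" using ab by simp
  show "a \<oplus>\<^bsub>T\<^esub> b \<oplus>\<^bsub>T\<^esub> c = a \<oplus>\<^bsub>T\<^esub> (b \<oplus>\<^bsub>T\<^esub> c)"
    using ab c by (auto simp: skew_powser_ring_def P.a_assoc)
  show "a \<otimes>\<^bsub>T\<^esub> b \<otimes>\<^bsub>T\<^esub> c = a \<otimes>\<^bsub>T\<^esub> (b \<otimes>\<^bsub>T\<^esub> c)"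
    using ab c skew_mult_closed(2)[OF ab] skew_mult_closed(2)[OF ab(2) c]
    by (simp only: skew_powser_mult skew_mult_assoc)
  show "(a \<oplus>\<^bsub>T\<^esub> b) \<otimes>\<^bsub>T\<^esub> c = a \<otimes>\<^bsub>T\<^esub> c \<oplus>\<^bsub>T\<^esub> (b \<otimes>\<^bsub>T\<^esub> c)"
    "c \<otimes>\<^bsub>T\<^esub> (a \<oplus>\<^bsub>T\<^esub> b) = c \<otimes>\<^bsub>T\<^esub> a \<oplus>\<^bsub>T\<^esub> (c \<otimes>\<^bsub>T\<^esub> b)"
    using ab c add_S by (simp_all only: skew_powser_mult skew_mult_distrib add)
qed (auto simp: skew_powser_ring_def)

end

section \<open>Functoriality in the coefficient ring\<close>

lemma powser_map_hom:
  fixes A :: "'a ring" and B :: "'b ring"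
  assumes "ring A" "ring B" and e: "e \<in> ring_hom A B"
  shows "(\<lambda>f. e \<circ> f) \<in> ring_hom (powser_ring A) (powser_ring B)"
proof -
  interpret A: plain_ring A using assms(1) by (simp add: plain_ring_def)
  interpret B: plain_ring B using assms(2) by (simp add: plain_ring_def)
  interpret e: ring_hom_ring A B e using e by (intro ring_hom_ringI2 A.ring_axioms B.ring_axioms)
  have fin: "e (\<Oplus>\<^bsub>A\<^esub>i\<in>I. g i) = (\<Oplus>\<^bsub>B\<^esub>i\<in>I. e (g i))" if "\<And>i. i \<in> I \<Longrightarrow> g i \<in> carrier A" for I and g :: "nat \<Rightarrow> 'a"
    using e.hom_finsum[of g I] that by (simp add: comp_def Pi_iff)
  show ?thesis
  proof (rule ring_hom_memI)
    fix f assume f: "f \<in> carrier A.P"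
    then show "e \<circ> f \<in> carrier B.P" by (intro B.P_I) simp
    fix g assume g: "g \<in> carrier A.P"
    show "e \<circ> (f \<otimes>\<^bsub>A.P\<^esub> g) = (e \<circ> f) \<otimes>\<^bsub>B.P\<^esub> (e \<circ> g)"
      using f g by (simp add: fun_eq_iff A.P_mult B.P_mult fin del: e.hom_finsum)
    show "e \<circ> (f \<oplus>\<^bsub>A.P\<^esub> g) = (e \<circ> f) \<oplus>\<^bsub>B.P\<^esub> (e \<circ> g)"
      using f g by (simp add: fun_eq_iff A.P_add B.P_add)
  next
    show "e \<circ> \<one>\<^bsub>A.P\<^esub> = \<one>\<^bsub>B.P\<^esub>" by (simp add: fun_eq_iff A.P_one B.P_one)
  qed
qed

text \<open>Composition with e commutes with \<sigma>, hence with \<delta> and with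
  \<open>mult_s\<close>. Each coefficient of a product is read from a finite sum
  \<open>partial_mult\<close>, so products are preserved without comparing limits.\<close>

lemma skew_powser_embedding:
  fixes A :: "'a ring" and B :: "'b ring"
  assumes A: "unipotent_powser_automorphism A \<sigma>" and B: "unipotent_powser_automorphism B \<sigma>'"
    and e: "e \<in> ring_hom A B" "inj_on e (carrier A)"
    and comp: "\<And>f. f \<in> carrier (powser_ring A) \<Longrightarrow> \<sigma>' (e \<circ> f) = e \<circ> \<sigma> f"
  shows "ring_embedding
    (skew_powser_ring (powser_ring A) (tadic_topology A) \<sigma> (minus_id (powser_ring A) \<sigma>))
    (skew_powser_ring (powser_ring B) (tadic_topology B) \<sigma>' (minus_id (powser_ring B) \<sigma>'))
    (\<lambda>f i. e \<circ> f i)"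
proof -
  interpret A: unipotent_powser_automorphism A \<sigma> by fact
  interpret B: unipotent_powser_automorphism B \<sigma>' by fact
  interpret e: ring_hom_ring A B e using e(1) by (intro ring_hom_ringI2 A.ring_axioms B.ring_axioms)
  interpret eP: ring_hom_ring A.P B.P "\<lambda>f. e \<circ> f"
    by (intro ring_hom_ringI2 A.P.ring_axioms B.P.ring_axioms powser_map_hom A.ring_axioms B.ring_axioms e(1))
  note eP = eP.hom_closed and e_add = eP.hom_add and e_mult = eP.hom_mult
    and e_zero = eP.hom_zero and e_one = eP.hom_one
  have e_fin: "e \<circ> (\<Oplus>\<^bsub>A.P\<^esub>k\<in>{..<M}. g k) = (\<Oplus>\<^bsub>B.P\<^esub>k\<in>{..<M}. e \<circ> g k)"
    if "\<And>k. g k \<in> carrier A.P" for g and M :: nat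
    using eP.hom_finsum[of g "{..<M}"] that by (simp add: comp_def)
  have e_minus: "e (x \<ominus>\<^bsub>A\<^esub> y) = e x \<ominus>\<^bsub>B\<^esub> e y" if "x \<in> carrier A" "y \<in> carrier A" for x y
    using that by (simp add: a_minus_def)
  have e_\<delta>: "e \<circ> A.\<delta> f = B.\<delta> (e \<circ> f)" if f: "f \<in> carrier A.P" for f
    using f eP[OF f] eP[OF A.\<sigma>.hom_closed[OF f]]
    by (simp add: fun_eq_iff A.\<delta>_def B.\<delta>_def minus_id_def A.powser_minus_apply B.powser_minus_apply
        comp e_minus)
  have e_s: "(\<lambda>i. e \<circ> A.mult_s a i) = B.mult_s (\<lambda>i. e \<circ> a i)" if "a \<in> A.S" for a
    using that by (auto simp: A.mult_s_def B.mult_s_def e_add e_zero e_\<delta> comp)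
  have e_pow: "(\<lambda>i. e \<circ> (A.mult_s ^^ k) a i) = (B.mult_s ^^ k) (\<lambda>i. e \<circ> a i)" if "a \<in> A.S" for a k
  proof (induction k)
    case (Suc k)
    then show ?case using e_s[OF A.mult_s_pow_closed[OF that, of k]] by (simp only: funpow.simps comp_apply[of A.mult_s] comp_apply[of B.mult_s])
  qed simp
  have e_part: "e \<circ> A.partial_mult M a b m = B.partial_mult M (\<lambda>i. e \<circ> a i) (\<lambda>i. e \<circ> b i) m"
    if a: "a \<in> A.S" and b: "b \<in> A.S" for a b M m
  proof -
    have "e \<circ> A.partial_mult M a b m = (\<Oplus>\<^bsub>B.P\<^esub>k\<in>{..<M}. e \<circ> ((A.mult_s ^^ k) a m \<otimes>\<^bsub>A.P\<^esub> b k))"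
      unfolding A.partial_mult_def by (rule e_fin) (use a b in auto)
    also have "\<dots> = (\<Oplus>\<^bsub>B.P\<^esub>k\<in>{..<M}. (e \<circ> (A.mult_s ^^ k) a m) \<otimes>\<^bsub>B.P\<^esub> (e \<circ> b k))"
      using a b by (intro B.P.finsum_cong') (auto simp: e_mult eP)
    also have "\<dots> = B.partial_mult M (\<lambda>i. e \<circ> a i) (\<lambda>i. e \<circ> b i) m"
      unfolding B.partial_mult_def by (simp only: fun_cong[OF e_pow[OF a], of _ m])
    finally show ?thesis .
  qed
  have e_skew: "(\<lambda>i. e \<circ> A.skew_mult a b i) = B.skew_mult (\<lambda>i. e \<circ> a i) (\<lambda>i. e \<circ> b i)"
    if "a \<in> A.S" "b \<in> A.S" for a b
  proof (intro ext)
    fix i k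
    show "(e \<circ> A.skew_mult a b i) k = B.skew_mult (\<lambda>i. e \<circ> a i) (\<lambda>i. e \<circ> b i) i k"
      using fun_cong[OF e_part[OF that, of "Suc (i + k)" i], of k]
      by (simp only: A.skew_mult_def B.skew_mult_def comp_apply)
  qed
  have eS: "(\<lambda>i. e \<circ> a i) \<in> B.S" if "a \<in> A.S" for a using that eP by auto
  have hom: "(\<lambda>f i. e \<circ> f i) \<in> ring_hom A.T B.T"
  proof (rule ring_hom_memI)
    fix a b assume "a \<in> carrier A.T" "b \<in> carrier A.T"
    then have ab: "a \<in> A.S" "b \<in> A.S" by (simp_all add: A.skew_powser_carrier)
    show "(\<lambda>i. e \<circ> a i) \<in> carrier B.T" using eS[OF ab(1)] by (simp add: B.skew_powser_carrier)
    show "(\<lambda>i. e \<circ> (a \<otimes>\<^bsub>A.T\<^esub> b) i) = (\<lambda>i. e \<circ> a i) \<otimes>\<^bsub>B.T\<^esub> (\<lambda>i. e \<circ> b i)"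
      using A.skew_powser_mult[OF ab] B.skew_powser_mult[OF eS[OF ab(1)] eS[OF ab(2)]] e_skew[OF ab] by metis
    show "(\<lambda>i. e \<circ> (a \<oplus>\<^bsub>A.T\<^esub> b) i) = (\<lambda>i. e \<circ> a i) \<oplus>\<^bsub>B.T\<^esub> (\<lambda>i. e \<circ> b i)"
      using ab by (auto simp: skew_powser_ring_def e_add)
  next
    show "(\<lambda>i. e \<circ> \<one>\<^bsub>A.T\<^esub> i) = \<one>\<^bsub>B.T\<^esub>"
      by (auto simp: skew_powser_ring_def e_zero e_one)
  qed
  moreover have "inj_on (\<lambda>f i. e \<circ> f i) (carrier A.T)"
  proof (rule inj_onI)
    fix a b assume "a \<in> carrier A.T" "b \<in> carrier A.T" and eq: "(\<lambda>i. e \<circ> a i) = (\<lambda>i. e \<circ> b i)"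
    then have ab: "a i \<in> carrier A.P" "b i \<in> carrier A.P" for i by (simp_all add: A.skew_powser_carrier)
    have "e (a i k) = e (b i k)" for i k using fun_cong[OF eq, of i] by (auto simp: fun_eq_iff)
    then show "a = b" using e(2) ab by (auto simp: fun_eq_iff inj_on_def)
  qed
  ultimately show ?thesis
    using A.skew_powser_ring_ring B.skew_powser_ring_ring
    unfolding ring_embedding_def A.\<delta>_def B.\<delta>_def by blast
qed


section \<open>Extension to the universal division ring\<close>

context plain_ring begin

text \<open>Members of \<open>mats\<close> are arbitrary outside the index range. Here the carrier
  is extensional, so that equal entries give equal elements and a ring results, which can itself
  serve as coefficient ring of power series.\<close>

definition mat_ring :: "nat \<Rightarrow> (nat \<Rightarrow> nat \<Rightarrow> 'a) ring" where
  "mat_ring n =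
     \<lparr>carrier = {..<n} \<rightarrow>\<^sub>E ({..<n} \<rightarrow>\<^sub>E carrier R),
      monoid.mult = (\<lambda>M N. \<lambda>i\<in>{..<n}. \<lambda>j\<in>{..<n}. mat_prod R n M N i j),
      one = (\<lambda>i\<in>{..<n}. \<lambda>j\<in>{..<n}. if i = j then \<one> else \<zero>),
      zero = (\<lambda>i\<in>{..<n}. \<lambda>j\<in>{..<n}. \<zero>),
      add = (\<lambda>M N. \<lambda>i\<in>{..<n}. \<lambda>j\<in>{..<n}. M i j \<oplus> N i j)\<rparr>"

lemma mat_ring_eqI:
  assumes "M \<in> carrier (mat_ring n)" "N \<in> carrier (mat_ring n)"
    and "\<And>i j. i < n \<Longrightarrow> j < n \<Longrightarrow> M i j = N i j"
  shows "M = N"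
proof (rule ext)
  fix i
  show "M i = N i"
  proof (cases "i < n")
    case True
    then have "M i \<in> {..<n} \<rightarrow>\<^sub>E carrier R" "N i \<in> {..<n} \<rightarrow>\<^sub>E carrier R"
      using assms by (auto simp: mat_ring_def PiE_def)
    then show ?thesis by (rule PiE_ext) (use assms True in auto)
  qed (use assms in \<open>auto simp: mat_ring_def PiE_def extensional_def\<close>)
qed

lemma mat_ring_carrierI:
  "(\<And>i j. i < n \<Longrightarrow> j < n \<Longrightarrow> M i j \<in> carrier R) \<Longrightarrow>
    (\<lambda>i\<in>{..<n}. \<lambda>j\<in>{..<n}. M i j) \<in> carrier (mat_ring n)"
  by (auto simp: mat_ring_def)

lemma mat_ring_entry: "M \<in> carrier (mat_ring n) \<Longrightarrow> i < n \<Longrightarrow> j < n \<Longrightarrow> M i j \<in> carrier R"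
  by (auto simp: mat_ring_def PiE_iff)

lemma mat_ring_apply:
  assumes "i < n" "j < n"
  shows "(M \<otimes>\<^bsub>mat_ring n\<^esub> N) i j = (\<Oplus>r\<in>{..<n}. M i r \<otimes> N r j)"
    "(M \<oplus>\<^bsub>mat_ring n\<^esub> N) i j = M i j \<oplus> N i j"
    "\<zero>\<^bsub>mat_ring n\<^esub> i j = \<zero>" "\<one>\<^bsub>mat_ring n\<^esub> i j = (if i = j then \<one> else \<zero>)"
  using assms by (simp_all add: mat_ring_def mat_prod_def)

lemma mat_ring_closed:
  assumes "M \<in> carrier (mat_ring n)" "N \<in> carrier (mat_ring n)"
  shows "M \<otimes>\<^bsub>mat_ring n\<^esub> N \<in> carrier (mat_ring n)" "M \<oplus>\<^bsub>mat_ring n\<^esub> N \<in> carrier (mat_ring n)"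
  using assms[THEN mat_ring_entry]
  by (auto simp: mat_ring_def mat_prod_def intro!: finsum_closed)

lemma mat_ring_consts: "\<one>\<^bsub>mat_ring n\<^esub> \<in> carrier (mat_ring n)" "\<zero>\<^bsub>mat_ring n\<^esub> \<in> carrier (mat_ring n)"
  by (auto simp: mat_ring_def)

lemma mat_ring_ring: "ring (mat_ring n)"
proof (intro ringI abelian_groupI monoidI)
  let ?M = "mat_ring n"
  fix A B C
  assume A: "A \<in> carrier ?M" and B: "B \<in> carrier ?M"
  note AB = A[THEN mat_ring_entry] B[THEN mat_ring_entry]
  show "A \<oplus>\<^bsub>?M\<^esub> B \<in> carrier ?M" "A \<otimes>\<^bsub>?M\<^esub> B \<in> carrier ?M"
    using A B by (auto intro: mat_ring_closed)
  show "A \<oplus>\<^bsub>?M\<^esub> B = B \<oplus>\<^bsub>?M\<^esub> A"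
    by (rule mat_ring_eqI[of _ n]) (use A B AB in \<open>auto simp: mat_ring_apply mat_ring_closed a_comm\<close>)
  show "\<zero>\<^bsub>?M\<^esub> \<oplus>\<^bsub>?M\<^esub> A = A"
    by (rule mat_ring_eqI[of _ n]) (use A AB in \<open>auto simp: mat_ring_apply mat_ring_closed mat_ring_consts\<close>)
  show "\<exists>B\<in>carrier ?M. B \<oplus>\<^bsub>?M\<^esub> A = \<zero>\<^bsub>?M\<^esub>"
  proof
    show m: "(\<lambda>i\<in>{..<n}. \<lambda>j\<in>{..<n}. \<ominus> A i j) \<in> carrier ?M" using AB by (intro mat_ring_carrierI) auto
    show "(\<lambda>i\<in>{..<n}. \<lambda>j\<in>{..<n}. \<ominus> A i j) \<oplus>\<^bsub>?M\<^esub> A = \<zero>\<^bsub>?M\<^esub>"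
      by (rule mat_ring_eqI[of _ n]) (use A AB m in \<open>auto simp: mat_ring_apply mat_ring_closed mat_ring_consts l_neg\<close>)
  qed
  show "\<one>\<^bsub>?M\<^esub> \<otimes>\<^bsub>?M\<^esub> A = A"
  proof (rule mat_ring_eqI[of _ n])
    fix i j assume ij: "i < n" "j < n"
    have "(\<one>\<^bsub>?M\<^esub> \<otimes>\<^bsub>?M\<^esub> A) i j = (\<Oplus>r\<in>{..<n}. \<one>\<^bsub>?M\<^esub> i r \<otimes> A r j)" using ij by (simp add: mat_ring_apply)
    also have "\<dots> = \<one>\<^bsub>?M\<^esub> i i \<otimes> A i j"
      by (rule finsum_eq_single) (use ij AB in \<open>auto simp: mat_ring_apply\<close>)
    finally show "(\<one>\<^bsub>?M\<^esub> \<otimes>\<^bsub>?M\<^esub> A) i j = A i j" using ij AB by (simp add: mat_ring_apply)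
  qed (use A in \<open>auto simp: mat_ring_closed mat_ring_consts\<close>)
  show "A \<otimes>\<^bsub>?M\<^esub> \<one>\<^bsub>?M\<^esub> = A"
  proof (rule mat_ring_eqI[of _ n])
    fix i j assume ij: "i < n" "j < n"
    have "(A \<otimes>\<^bsub>?M\<^esub> \<one>\<^bsub>?M\<^esub>) i j = (\<Oplus>r\<in>{..<n}. A i r \<otimes> \<one>\<^bsub>?M\<^esub> r j)" using ij by (simp add: mat_ring_apply)
    also have "\<dots> = A i j \<otimes> \<one>\<^bsub>?M\<^esub> j j"
      by (rule finsum_eq_single) (use ij AB in \<open>auto simp: mat_ring_apply\<close>)
    finally show "(A \<otimes>\<^bsub>?M\<^esub> \<one>\<^bsub>?M\<^esub>) i j = A i j" using ij AB by (simp add: mat_ring_apply)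
  qed (use A in \<open>auto simp: mat_ring_closed mat_ring_consts\<close>)
  assume C: "C \<in> carrier ?M"
  note ABC = AB C[THEN mat_ring_entry]
  show "A \<oplus>\<^bsub>?M\<^esub> B \<oplus>\<^bsub>?M\<^esub> C = A \<oplus>\<^bsub>?M\<^esub> (B \<oplus>\<^bsub>?M\<^esub> C)"
    by (rule mat_ring_eqI[of _ n]) (use A B C ABC in \<open>auto simp: mat_ring_apply mat_ring_closed a_assoc\<close>)
  show "(A \<oplus>\<^bsub>?M\<^esub> B) \<otimes>\<^bsub>?M\<^esub> C = A \<otimes>\<^bsub>?M\<^esub> C \<oplus>\<^bsub>?M\<^esub> (B \<otimes>\<^bsub>?M\<^esub> C)"
  proof (rule mat_ring_eqI[of _ n])
    fix i j assume ij: "i < n" "j < n"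
    have "((A \<oplus>\<^bsub>?M\<^esub> B) \<otimes>\<^bsub>?M\<^esub> C) i j = (\<Oplus>r\<in>{..<n}. (A \<oplus>\<^bsub>?M\<^esub> B) i r \<otimes> C r j)"
      using ij by (simp add: mat_ring_apply(1))
    also have "\<dots> = (\<Oplus>r\<in>{..<n}. A i r \<otimes> C r j \<oplus> B i r \<otimes> C r j)"
      using ij ABC by (intro finsum_cong') (auto simp: mat_ring_apply l_distr)
    also have "\<dots> = (A \<otimes>\<^bsub>?M\<^esub> C \<oplus>\<^bsub>?M\<^esub> (B \<otimes>\<^bsub>?M\<^esub> C)) i j"
      using ij ABC by (subst finsum_addf) (auto simp: mat_ring_apply)
    finally show "((A \<oplus>\<^bsub>?M\<^esub> B) \<otimes>\<^bsub>?M\<^esub> C) i j = (A \<otimes>\<^bsub>?M\<^esub> C \<oplus>\<^bsub>?M\<^esub> (B \<otimes>\<^bsub>?M\<^esub> C)) i j" .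
  qed (use A B C in \<open>auto simp: mat_ring_closed\<close>)
  show "C \<otimes>\<^bsub>?M\<^esub> (A \<oplus>\<^bsub>?M\<^esub> B) = C \<otimes>\<^bsub>?M\<^esub> A \<oplus>\<^bsub>?M\<^esub> (C \<otimes>\<^bsub>?M\<^esub> B)"
  proof (rule mat_ring_eqI[of _ n])
    fix i j assume ij: "i < n" "j < n"
    have "(C \<otimes>\<^bsub>?M\<^esub> (A \<oplus>\<^bsub>?M\<^esub> B)) i j = (\<Oplus>r\<in>{..<n}. C i r \<otimes> (A \<oplus>\<^bsub>?M\<^esub> B) r j)"
      using ij by (simp add: mat_ring_apply(1))
    also have "\<dots> = (\<Oplus>r\<in>{..<n}. C i r \<otimes> A r j \<oplus> C i r \<otimes> B r j)"
      using ij ABC by (intro finsum_cong') (auto simp: mat_ring_apply r_distr)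
    also have "\<dots> = (C \<otimes>\<^bsub>?M\<^esub> A \<oplus>\<^bsub>?M\<^esub> (C \<otimes>\<^bsub>?M\<^esub> B)) i j"
      using ij ABC by (subst finsum_addf) (auto simp: mat_ring_apply)
    finally show "(C \<otimes>\<^bsub>?M\<^esub> (A \<oplus>\<^bsub>?M\<^esub> B)) i j = (C \<otimes>\<^bsub>?M\<^esub> A \<oplus>\<^bsub>?M\<^esub> (C \<otimes>\<^bsub>?M\<^esub> B)) i j" .
  qed (use A B C in \<open>auto simp: mat_ring_closed\<close>)
  show "A \<otimes>\<^bsub>?M\<^esub> B \<otimes>\<^bsub>?M\<^esub> C = A \<otimes>\<^bsub>?M\<^esub> (B \<otimes>\<^bsub>?M\<^esub> C)"
  proof (rule mat_ring_eqI[of _ n])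
    fix i j assume ij: "i < n" "j < n"
    have "(A \<otimes>\<^bsub>?M\<^esub> B \<otimes>\<^bsub>?M\<^esub> C) i j = (\<Oplus>r\<in>{..<n}. (A \<otimes>\<^bsub>?M\<^esub> B) i r \<otimes> C r j)"
      using ij by (simp add: mat_ring_apply(1))
    also have "\<dots> = (\<Oplus>r\<in>{..<n}. (\<Oplus>s\<in>{..<n}. A i s \<otimes> B s r) \<otimes> C r j)"
      using ij ABC by (intro finsum_cong') (auto simp: mat_ring_apply intro!: finsum_closed)
    also have "\<dots> = (\<Oplus>r\<in>{..<n}. \<Oplus>s\<in>{..<n}. A i s \<otimes> B s r \<otimes> C r j)"
      using ij ABC by (intro finsum_cong' finsum_ldistr) (auto intro!: finsum_closed)
    also have "\<dots> = (\<Oplus>s\<in>{..<n}. \<Oplus>r\<in>{..<n}. A i s \<otimes> (B s r \<otimes> C r j))"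
      using ij ABC by (subst finsum_swap) (auto intro!: finsum_cong' finsum_closed simp: m_assoc)
    also have "\<dots> = (\<Oplus>s\<in>{..<n}. A i s \<otimes> (\<Oplus>r\<in>{..<n}. B s r \<otimes> C r j))"
      using ij ABC by (intro finsum_cong' finsum_rdistr[symmetric]) (auto intro!: finsum_closed)
    also have "\<dots> = (\<Oplus>s\<in>{..<n}. A i s \<otimes> (B \<otimes>\<^bsub>?M\<^esub> C) s j)"
      using ij ABC by (intro finsum_cong') (auto simp: mat_ring_apply intro!: finsum_closed)
    also have "\<dots> = (A \<otimes>\<^bsub>?M\<^esub> (B \<otimes>\<^bsub>?M\<^esub> C)) i j"
      using ij by (simp add: mat_ring_apply(1))
    finally show "(A \<otimes>\<^bsub>?M\<^esub> B \<otimes>\<^bsub>?M\<^esub> C) i j = (A \<otimes>\<^bsub>?M\<^esub> (B \<otimes>\<^bsub>?M\<^esub> C)) i j" .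
  qed (use A B C in \<open>auto simp: mat_ring_closed\<close>)
qed (auto simp: mat_ring_consts)

lemma mat_ring_finsum:
  assumes "i < n" "j < n" "\<And>x. x \<in> I \<Longrightarrow> f x \<in> carrier (mat_ring n)"
  shows "(\<Oplus>\<^bsub>mat_ring n\<^esub>x\<in>I. f x) i j = (\<Oplus>x\<in>I. f x i j)"
proof -
  interpret M: ring "mat_ring n" by (rule mat_ring_ring)
  show ?thesis using assms(3)
  proof (induction I rule: infinite_finite_induct)
    case (insert x I)
    then have "f y i j \<in> carrier R" if "y \<in> insert x I" for y
      using that assms(1,2) by (intro mat_ring_entry) auto
    with insert show ?case using assms(1,2)
      by (simp add: finsum_insert M.finsum_insert mat_ring_apply Pi_iff)
  qed (use assms in \<open>auto simp: finsum_infinite M.finsum_infinite mat_ring_apply\<close>)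
qed

text \<open>A matrix of series is a series F with matrices as coefficients. Its constant term is a
  unit of the matrix ring, so F is a unit by \<open>powser_Units\<close>, and the inverse is read
  back entry by entry.\<close>

lemma invertible_matrix_powser:
  assumes M: "M \<in> mats P n n" and inv: "invertible_matrix R n (\<lambda>i j. M i j 0)"
  shows "invertible_matrix P n M"
proof -
  interpret M: ring "mat_ring n" by (rule mat_ring_ring)
  interpret M: plain_ring "mat_ring n" ..
  define F where "F = (\<lambda>k. \<lambda>i\<in>{..<n}. \<lambda>j\<in>{..<n}. M i j k)"
  have Mc: "M i j \<in> carrier P" if "i < n" "j < n" for i j using M that by (simp add: mats_def)
  have F: "F \<in> carrier M.P"
    unfolding F_def using Mc by (intro M.P_I mat_ring_carrierI) auto
  obtain N where N: "N \<in> mats R n n"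
    "\<And>i j. i < n \<Longrightarrow> j < n \<Longrightarrow> mat_prod R n (\<lambda>i j. M i j 0) N i j = (if i = j then \<one> else \<zero>)"
    "\<And>i j. i < n \<Longrightarrow> j < n \<Longrightarrow> mat_prod R n N (\<lambda>i j. M i j 0) i j = (if i = j then \<one> else \<zero>)"
    using inv unfolding invertible_matrix_def by blast
  define N' where "N' = (\<lambda>i\<in>{..<n}. \<lambda>j\<in>{..<n}. N i j)"
  have N': "N' \<in> carrier (mat_ring n)" unfolding N'_def using N(1) by (intro mat_ring_carrierI) (auto simp: mats_def)
  have Nc: "N i j \<in> carrier R" if "i < n" "j < n" for i j using N(1) that by (simp add: mats_def)
  have "F 0 \<otimes>\<^bsub>mat_ring n\<^esub> N' = \<one>\<^bsub>mat_ring n\<^esub>"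
  proof (rule mat_ring_eqI[of _ n])
    fix i j assume ij: "i < n" "j < n"
    then have "(F 0 \<otimes>\<^bsub>mat_ring n\<^esub> N') i j = (\<Oplus>r\<in>{..<n}. M i r 0 \<otimes> N r j)"
      using Mc Nc by (auto simp: mat_ring_apply F_def N'_def intro!: finsum_cong')
    with N(2)[OF ij] ij show "(F 0 \<otimes>\<^bsub>mat_ring n\<^esub> N') i j = \<one>\<^bsub>mat_ring n\<^esub> i j"
      by (simp add: mat_ring_apply mat_prod_def)
  qed (use M.P_coeff[OF F] N' in auto)
  moreover have "N' \<otimes>\<^bsub>mat_ring n\<^esub> F 0 = \<one>\<^bsub>mat_ring n\<^esub>"
  proof (rule mat_ring_eqI[of _ n])
    fix i j assume ij: "i < n" "j < n"
    then have "(N' \<otimes>\<^bsub>mat_ring n\<^esub> F 0) i j = (\<Oplus>r\<in>{..<n}. N i r \<otimes> M r j 0)"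
      using Mc Nc by (auto simp: mat_ring_apply F_def N'_def intro!: finsum_cong')
    with N(3)[OF ij] ij show "(N' \<otimes>\<^bsub>mat_ring n\<^esub> F 0) i j = \<one>\<^bsub>mat_ring n\<^esub> i j"
      by (simp add: mat_ring_apply mat_prod_def)
  qed (use M.P_coeff[OF F] N' in auto)
  ultimately have "F 0 \<in> Units (mat_ring n)"
    using M.P_coeff[OF F] N' unfolding Units_def by blast
  from M.powser_Units[OF F this] obtain G where G: "G \<in> carrier M.P"
    "G \<otimes>\<^bsub>M.P\<^esub> F = \<one>\<^bsub>M.P\<^esub>" "F \<otimes>\<^bsub>M.P\<^esub> G = \<one>\<^bsub>M.P\<^esub>"
    unfolding Units_def by blast
  define M' where "M' = (\<lambda>i j k. G k i j)"
  have Gc: "G k i j \<in> carrier R" if "i < n" "j < n" for i j k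
    using mat_ring_entry[OF M.P_coeff[OF G(1)]] that by blast
  have M'c: "M' i j \<in> carrier P" if "i < n" "j < n" for i j
    unfolding M'_def by (rule P_I) (use Gc that in blast)
  interpret P: ring P by (rule powser_ring_ring)
  \<comment> \<open>Stated for arbitrary factors U and V, because it is applied to F G = 1 and to G
    F = 1.\<close>
  have prod: "mat_prod P n A B i j = (if i = j then \<one>\<^bsub>P\<^esub> else \<zero>\<^bsub>P\<^esub>)"
    if ij: "i < n" "j < n" and UV: "U \<in> carrier M.P" "V \<in> carrier M.P" "U \<otimes>\<^bsub>M.P\<^esub> V = \<one>\<^bsub>M.P\<^esub>"
      and A: "\<And>i j k. i < n \<Longrightarrow> j < n \<Longrightarrow> A i j k = U k i j"
      and B: "\<And>i j k. i < n \<Longrightarrow> j < n \<Longrightarrow> B i j k = V k i j"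
    for U V A B i j
  proof
    fix k
    have Uc: "U k i j \<in> carrier R" "V k i j \<in> carrier R" if "i < n" "j < n" for i j k
      using mat_ring_entry[OF M.P_coeff[OF UV(1)]] mat_ring_entry[OF M.P_coeff[OF UV(2)]] that by blast+
    have cl: "A i j \<in> carrier P" "B i j \<in> carrier P" if "i < n" "j < n" for i j
      using Uc[OF that] A[OF that] B[OF that] by (auto intro!: P_I)
    have "mat_prod P n A B i j k = (\<Oplus>r\<in>{..<n}. (A i r \<otimes>\<^bsub>P\<^esub> B r j) k)"
      unfolding mat_prod_def using cl ij by (intro powser_finsum_apply) auto
    also have "\<dots> = (\<Oplus>r\<in>{..<n}. \<Oplus>s\<in>{..k}. U s i r \<otimes> V (k - s) r j)"
      using Uc ij by (auto simp: P_mult A B intro!: finsum_cong' finsum_closed)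
    also have "\<dots> = (\<Oplus>s\<in>{..k}. \<Oplus>r\<in>{..<n}. U s i r \<otimes> V (k - s) r j)"
      using Uc ij by (intro finsum_swap) auto
    also have "\<dots> = (\<Oplus>s\<in>{..k}. (U s \<otimes>\<^bsub>mat_ring n\<^esub> V (k - s)) i j)"
      using ij by (simp add: mat_ring_apply(1))
    also have "\<dots> = (\<Oplus>\<^bsub>mat_ring n\<^esub>s\<in>{..k}. U s \<otimes>\<^bsub>mat_ring n\<^esub> V (k - s)) i j"
      using UV ij M.P_coeff by (intro mat_ring_finsum[symmetric]) auto
    also have "\<dots> = (U \<otimes>\<^bsub>M.P\<^esub> V) k i j" by (simp add: M.P_mult)
    also have "\<dots> = (if i = j then \<one>\<^bsub>P\<^esub> else \<zero>\<^bsub>P\<^esub>) k"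
      unfolding UV(3) using ij by (auto simp: M.P_one P_one P_zero mat_ring_apply)
    finally show "mat_prod P n A B i j k = (if i = j then \<one>\<^bsub>P\<^esub> else \<zero>\<^bsub>P\<^esub>) k" .
  qed
  have FM: "M i j k = F k i j" if "i < n" "j < n" for i j k using that by (simp add: F_def)
  have GM: "M' i j k = G k i j" if "i < n" "j < n" for i j k by (simp add: M'_def)
  show ?thesis unfolding invertible_matrix_def
  proof (intro conjI bexI[of _ M'] allI impI)
    show "M' \<in> mats P n n" using M'c by (simp add: mats_def)
    show "M \<in> mats P n n" by fact
    fix i j assume "i < n" "j < n"
    then show "mat_prod P n M M' i j = (if i = j then \<one>\<^bsub>P\<^esub> else \<zero>\<^bsub>P\<^esub>)"
      "mat_prod P n M' M i j = (if i = j then \<one>\<^bsub>P\<^esub> else \<zero>\<^bsub>P\<^esub>)"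
      using prod[OF _ _ F G(1) G(3) FM GM] prod[OF _ _ G(1) F G(2) GM FM] by blast+
  qed
qed

end


lemma invertible_matrix_cong:
  assumes "ring A" "\<And>i j. i < n \<Longrightarrow> j < n \<Longrightarrow> M i j = N i j"
  shows "invertible_matrix A n M \<longleftrightarrow> invertible_matrix A n N"
proof -
  interpret ring A by fact
  have *: "invertible_matrix A n N" if inv: "invertible_matrix A n M" and eq: "\<And>i j. i < n \<Longrightarrow> j < n \<Longrightarrow> M i j = N i j" for M N
  proof -
    have M: "M \<in> mats A n n" using inv by (simp add: invertible_matrix_def)
    obtain M' where M': "M' \<in> mats A n n"
      "\<forall>i<n. \<forall>j<n. mat_prod A n M M' i j = (if i = j then \<one>\<^bsub>A\<^esub> else \<zero>\<^bsub>A\<^esub>) \<and>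
        mat_prod A n M' M i j = (if i = j then \<one>\<^bsub>A\<^esub> else \<zero>\<^bsub>A\<^esub>)"
      using inv unfolding invertible_matrix_def by blast
    have N: "N \<in> mats A n n" using M eq by (simp add: mats_def)
    have "mat_prod A n N M' i j = mat_prod A n M M' i j" "mat_prod A n M' N i j = mat_prod A n M' M i j"
      if "i < n" "j < n" for i j
      using that M N M'(1) eq unfolding mat_prod_def mats_def by (auto intro!: finsum_cong')
    with M' N show ?thesis unfolding invertible_matrix_def by (intro conjI bexI[of _ M']) simp_all
  qed
  show ?thesis using *[of M N] *[of N M] assms(2) by metis
qed

section \<open>Substituting t for a second variable, and extension from constants to series\<close>

context plain_ring begin

lemma powser_const_hom: "powser_const R \<in> ring_hom R P"
proof (rule ring_hom_memI)
  fix a b assume a: "a \<in> carrier R" and b: "b \<in> carrier R"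
  show "powser_const R (a \<otimes> b) = powser_const R a \<otimes>\<^bsub>P\<^esub> powser_const R b"
    using a b by (auto simp: fun_eq_iff powser_mult_const(1)[OF powser_const_carrier]) (auto simp: powser_const_def)
  show "powser_const R (a \<oplus> b) = powser_const R a \<oplus>\<^bsub>P\<^esub> powser_const R b"
    using a b by (auto simp: fun_eq_iff P_add powser_const_def)
next
  show "powser_const R \<one> = \<one>\<^bsub>P\<^esub>" by (simp add: fun_eq_iff P_one powser_const_def)
qed (rule powser_const_carrier)

text \<open>Regard u as a series in an outer variable whose coefficients \<open>u k\<close> are
  series in t. Then \<open>diagonal u\<close> is obtained by setting the outer variable equal to
  t.\<close>

definition diagonal :: "(nat \<Rightarrow> nat \<Rightarrow> 'a) \<Rightarrow> nat \<Rightarrow> 'a" where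
  "diagonal u m = (\<Oplus>k\<in>{..m}. u k (m - k))"

lemma diagonal_hom: "diagonal \<in> ring_hom (powser_ring P) P"
proof -
  interpret P: ring P by (rule powser_ring_ring)
  interpret P: plain_ring P ..
  show ?thesis
  proof (rule ring_hom_memI)
    fix u v assume "u \<in> carrier P.P" "v \<in> carrier P.P"
    then have u: "u k i \<in> carrier R" and v: "v k i \<in> carrier R" for k i
      by (metis P.P_coeff P_coeff)+
    show "diagonal u \<in> carrier P" unfolding diagonal_def using u by (intro P_I finsum_closed) auto
    show "diagonal (u \<oplus>\<^bsub>P.P\<^esub> v) = diagonal u \<oplus>\<^bsub>P\<^esub> diagonal v"
      using u v by (auto simp: fun_eq_iff diagonal_def P_add P.P_add finsum_addf)
    show "diagonal (u \<otimes>\<^bsub>P.P\<^esub> v) = diagonal u \<otimes>\<^bsub>P\<^esub> diagonal v"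
    proof
      fix m :: nat
      let ?I = "Sigma {..m} (\<lambda>k. {..k} \<times> {..m - k})"
      let ?F = "\<lambda>z. u (fst (snd z)) (snd (snd z)) \<otimes> v (fst z - fst (snd z)) (m - fst z - snd (snd z))"
      let ?G = "\<lambda>z. u (fst (snd z)) (fst z - fst (snd z)) \<otimes> v (snd (snd z)) (m - fst z - snd (snd z))"
      \<comment> \<open>Each term of the product has two outer and two inner exponents with total m.
        \<open>?F\<close> groups the terms by the total outer exponent k, \<open>?G\<close> by the
        total degree l of the left factor. The map \<open>?h\<close> exchanges the groupings and is
        its own inverse.\<close>
      let ?h = "\<lambda>z. (fst (snd z) + snd (snd z), (fst (snd z), fst z - fst (snd z)))"
      have "diagonal (u \<otimes>\<^bsub>P.P\<^esub> v) m = (\<Oplus>k\<in>{..m}. \<Oplus>i\<in>{..k}. \<Oplus>j\<in>{..m - k}. u i j \<otimes> v (k - i) (m - k - j))"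
        unfolding diagonal_def
      proof (intro finsum_cong' refl)
        fix k
        have "(u \<otimes>\<^bsub>P.P\<^esub> v) k (m - k) = (\<Oplus>i\<in>{..k}. (u i \<otimes>\<^bsub>P\<^esub> v (k - i)) (m - k))"
          unfolding P.P_mult using P_I[OF u] P_I[OF v] by (intro powser_finsum_apply P.m_closed)
        then show "(u \<otimes>\<^bsub>P.P\<^esub> v) k (m - k) = (\<Oplus>i\<in>{..k}. \<Oplus>j\<in>{..m - k}. u i j \<otimes> v (k - i) (m - k - j))"
          by (simp only: P_mult)
      qed (use u v in \<open>auto intro!: finsum_closed\<close>)
      also have "\<dots> = (\<Oplus>z\<in>?I. ?F z)"
        using u v by (subst finsum_Sigma[symmetric]) (auto simp: finsum_Sigma intro!: finsum_cong' finsum_closed)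
      also have "\<dots> = (\<Oplus>z\<in>?I. ?G (?h z))"
        using u v by (intro finsum_cong') (auto simp: algebra_simps)
      also have "\<dots> = (\<Oplus>z\<in>?I. ?G z)"
        using u v by (intro finsum_reindex_bij bij_betw_byWitness[where f' = ?h]) auto
      also have "\<dots> = (\<Oplus>l\<in>{..m}. \<Oplus>i\<in>{..l}. \<Oplus>q\<in>{..m - l}. u i (l - i) \<otimes> v q (m - l - q))"
        using u v by (subst finsum_Sigma[symmetric]) (auto simp: finsum_Sigma intro!: finsum_cong' finsum_closed)
      also have "\<dots> = (\<Oplus>l\<in>{..m}. \<Oplus>i\<in>{..l}. u i (l - i) \<otimes> (\<Oplus>q\<in>{..m - l}. v q (m - l - q)))"
        using u v by (intro finsum_cong' finsum_rdistr[symmetric]) (auto intro!: finsum_closed)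
      also have "\<dots> = (\<Oplus>l\<in>{..m}. (\<Oplus>i\<in>{..l}. u i (l - i)) \<otimes> (\<Oplus>q\<in>{..m - l}. v q (m - l - q)))"
        using u v by (intro finsum_cong' finsum_ldistr[symmetric]) (auto intro!: finsum_closed)
      finally show "diagonal (u \<otimes>\<^bsub>P.P\<^esub> v) m = (diagonal u \<otimes>\<^bsub>P\<^esub> diagonal v) m"
        by (simp add: P_mult diagonal_def)
    qed
  next
    show "diagonal \<one>\<^bsub>P.P\<^esub> = \<one>\<^bsub>P\<^esub>"
    proof
      fix m
      have "(\<Oplus>k\<in>{..m}. \<one>\<^bsub>P.P\<^esub> k (m - k)) = \<one>\<^bsub>P.P\<^esub> 0 (m - 0)"
        by (rule finsum_eq_single) (auto simp: P.P_one P_one P_zero)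
      then show "diagonal \<one>\<^bsub>P.P\<^esub> m = \<one>\<^bsub>P\<^esub> m" by (simp add: diagonal_def P.P_one)
    qed
  qed
qed

end

text \<open>Modulo \<open>t^(m+1)\<close> the series f is the finite sum of its terms, and \<sigma>
  respects this congruence and fixes t. So \<sigma> is determined by its values on constants, which
  is what the comparison with the extension to D uses.\<close>

lemma (in unipotent_powser_automorphism) \<sigma>_expansion:
  assumes f: "f \<in> carrier P"
  shows "\<sigma> f m = (\<Oplus>k\<in>{..m}. \<sigma> (powser_const R (f k)) (m - k))"
proof -
  let ?c = "\<lambda>k. powser_const R (f k)"
  let ?t = "\<lambda>k. powser_t R [^]\<^bsub>P\<^esub> (k::nat)"
  have c: "?c k \<in> carrier P" for k using f by (simp add: powser_const_carrier)
  have t: "?t k \<in> carrier P" for k using powser_t_carrier by simp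
  have "agree (Suc m) f (\<Oplus>\<^bsub>P\<^esub>k\<in>{..m}. ?t k \<otimes>\<^bsub>P\<^esub> ?c k)"
    unfolding agree_def
  proof (intro allI impI)
    fix i assume i: "i < Suc m"
    have "(\<Oplus>\<^bsub>P\<^esub>k\<in>{..m}. ?t k \<otimes>\<^bsub>P\<^esub> ?c k) i = (\<Oplus>k\<in>{..m}. (?t k \<otimes>\<^bsub>P\<^esub> ?c k) i)"
      using c t by (intro powser_finsum_apply) auto
    also have "\<dots> = (?t i \<otimes>\<^bsub>P\<^esub> ?c i) i"
      using i f c by (intro finsum_eq_single) (auto simp: powser_mult_t_pow powser_const_def)
    finally show "f i = (\<Oplus>\<^bsub>P\<^esub>k\<in>{..m}. ?t k \<otimes>\<^bsub>P\<^esub> ?c k) i"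
      using c by (simp add: powser_mult_t_pow) (simp add: powser_const_def)
  qed
  then have "agree (Suc m) (\<sigma> f) (\<sigma> (\<Oplus>\<^bsub>P\<^esub>k\<in>{..m}. ?t k \<otimes>\<^bsub>P\<^esub> ?c k))"
    using c t by (intro \<sigma>_agree f) (auto intro!: P.finsum_closed)
  then have "\<sigma> f m = \<sigma> (\<Oplus>\<^bsub>P\<^esub>k\<in>{..m}. ?t k \<otimes>\<^bsub>P\<^esub> ?c k) m" by (simp add: agree_def)
  also have "\<sigma> (\<Oplus>\<^bsub>P\<^esub>k\<in>{..m}. ?t k \<otimes>\<^bsub>P\<^esub> ?c k) = (\<Oplus>\<^bsub>P\<^esub>k\<in>{..m}. \<sigma> (?t k \<otimes>\<^bsub>P\<^esub> ?c k))"
    using c t by (intro P.additive_finsum) auto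
  also have "\<dots> m = (\<Oplus>k\<in>{..m}. \<sigma> (?t k \<otimes>\<^bsub>P\<^esub> ?c k) m)"
    using c t by (intro powser_finsum_apply) auto
  also have "\<dots> = (\<Oplus>k\<in>{..m}. \<sigma> (?c k) (m - k))"
    using c t by (intro finsum_cong') (auto simp: \<sigma>_t_pow_mult powser_mult_t_pow simp del: \<sigma>.hom_mult)
  finally show ?thesis .
qed

text \<open>The type argument of the universal property is that of the elements of
  \<open>D[[t]]\<close>, the ring into which D is to be mapped.\<close>

lemma powser_automorphism_extends:
  fixes A :: "'a ring" and D :: "'d ring" and e :: "'a \<Rightarrow> 'd"
  assumes A: "unipotent_powser_automorphism A \<sigma>"
    and D: "universal_division_ring TYPE(nat \<Rightarrow> 'd) A D e"
  shows "\<exists>\<sigma>'. unipotent_powser_automorphism D \<sigma>' \<and>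
    (\<forall>f\<in>carrier (powser_ring A). \<sigma>' (e \<circ> f) = e \<circ> \<sigma> f)"
proof -
  interpret A: unipotent_powser_automorphism A \<sigma> by fact
  have Ddiv: "is_division_ring D" and e: "e \<in> ring_hom A D" and gen: "generates_division_ring D (e ` carrier A)"
    and inv: "inverts_full_matrices A D e"
    and univ: "\<And>(B :: (nat \<Rightarrow> 'd) ring) f. ring B \<Longrightarrow> f \<in> ring_hom A B \<Longrightarrow> inverts_full_matrices A B f \<Longrightarrow>
        \<exists>f'\<in>ring_hom D B. \<forall>y\<in>carrier A. f' (e y) = f y"
    using D unfolding universal_division_ring_def by blast+
  interpret D: plain_ring D using Ddiv by (simp add: plain_ring_def is_division_ring_def)
  interpret DP: ring D.P by (rule D.powser_ring_ring)
  interpret DP: plain_ring D.P ..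
  interpret e: ring_hom_ring A D e using e by (intro ring_hom_ringI2 A.ring_axioms D.ring_axioms)
  interpret eP: ring_hom_ring A.P D.P "\<lambda>f. e \<circ> f"
    by (intro ring_hom_ringI2 A.P.ring_axioms DP.ring_axioms powser_map_hom A.ring_axioms D.ring_axioms e)
  define \<phi> where "\<phi> a = e \<circ> \<sigma> (powser_const A a)" for a
  have c: "powser_const A a \<in> carrier A.P" if "a \<in> carrier A" for a
    using that by (rule A.powser_const_carrier)
  have \<phi>_hom: "\<phi> \<in> ring_hom A D.P"
  proof -
    have "\<phi> = (\<lambda>f. e \<circ> f) \<circ> (\<sigma> \<circ> powser_const A)" by (simp add: \<phi>_def fun_eq_iff)
    then show ?thesis
      using ring_hom_trans[OF ring_hom_trans[OF A.powser_const_hom A.\<sigma>_hom] eP.homh] by simp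
  qed
  have \<phi>_0: "\<phi> a 0 = e a" if "a \<in> carrier A" for a
    using A.\<sigma>_0[OF c[OF that]] by (simp add: \<phi>_def powser_const_def)
  have "inverts_full_matrices A D.P \<phi>"
    unfolding inverts_full_matrices_def
  proof (intro allI impI)
    fix n M assume full: "full_matrix A n M"
    then have M: "M i j \<in> carrier A" if "i < n" "j < n" for i j
      using that by (simp add: full_matrix_def mats_def)
    show "invertible_matrix D.P n (\<lambda>i j. \<phi> (M i j))"
    proof (rule D.invertible_matrix_powser)
      show "(\<lambda>i j. \<phi> (M i j)) \<in> mats D.P n n"
        using M ring_hom_closed[OF \<phi>_hom] by (simp add: mats_def)
      have "invertible_matrix D n (\<lambda>i j. e (M i j))" using inv full by (simp add: inverts_full_matrices_def)
      then show "invertible_matrix D n (\<lambda>i j. \<phi> (M i j) 0)"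
        by (subst invertible_matrix_cong[OF D.ring_axioms]) (auto simp: \<phi>_0 M)
    qed
  qed
  from univ[OF DP.ring_axioms \<phi>_hom this] obtain \<psi> where \<psi>: "\<psi> \<in> ring_hom D D.P"
    and \<psi>e: "\<And>a. a \<in> carrier A \<Longrightarrow> \<psi> (e a) = \<phi> a" by blast
  interpret \<psi>: ring_hom_ring D D.P \<psi> using \<psi> by (intro ring_hom_ringI2 D.ring_axioms DP.ring_axioms)
  have \<psi>c: "\<psi> d i \<in> carrier D" if "d \<in> carrier D" for d i using that by simp
  have mult_0: "(f \<otimes>\<^bsub>D.P\<^esub> g) 0 = f 0 \<otimes>\<^bsub>D\<^esub> g 0" if "f \<in> carrier D.P" "g \<in> carrier D.P" for f g
    using that by (simp add: D.P_mult)
  \<comment> \<open>The \<open>d\<close> with \<open>\<psi> d \<equiv> d\<close> modulo \<open>t\<close> form a division subring containing \<open>e ` carrier A\<close>.\<close>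
  define E where "E = {d \<in> carrier D. \<psi> d 0 = d}"
  have "subring E D"
  proof (rule D.subringI)
    show "\<ominus>\<^bsub>D\<^esub> h \<in> E" if "h \<in> E" for h
      using that by (auto simp: E_def D.powser_uminus_apply)
  qed (auto simp: E_def D.P_one D.P_add mult_0)
  moreover have "inv\<^bsub>D\<^esub> y \<in> E" if y: "y \<in> E - {\<zero>\<^bsub>D\<^esub>}" for y
  proof -
    have u: "y \<in> Units D" using y Ddiv by (auto simp: E_def is_division_ring_def)
    then have iy: "inv\<^bsub>D\<^esub> y \<in> carrier D" and yc: "y \<in> carrier D" by auto
    have "\<psi> y \<otimes>\<^bsub>D.P\<^esub> \<psi> (inv\<^bsub>D\<^esub> y) = \<one>\<^bsub>D.P\<^esub>"
      using \<psi>.hom_mult[OF yc iy] u by simp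
    then have "y \<otimes>\<^bsub>D\<^esub> \<psi> (inv\<^bsub>D\<^esub> y) 0 = \<one>\<^bsub>D\<^esub>"
      using mult_0[of "\<psi> y" "\<psi> (inv\<^bsub>D\<^esub> y)"] yc iy y by (simp add: E_def D.P_one)
    then have "\<psi> (inv\<^bsub>D\<^esub> y) 0 = inv\<^bsub>D\<^esub> y"
      using u \<psi>c[OF iy] by (metis D.Units_r_inv D.Units_l_cancel iy)
    then show ?thesis using iy by (simp add: E_def)
  qed
  moreover have "e ` carrier A \<subseteq> E" by (auto simp: E_def \<psi>e \<phi>_0)
  ultimately have "E = carrier D" using gen unfolding generates_division_ring_def by blast
  then have \<psi>_0: "\<psi> d 0 = d" if "d \<in> carrier D" for d using that by (auto simp: E_def)
  \<comment> \<open>The sum of the series \<open>t^k \<psi>(f k)\<close>: applying \<psi> to the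
    coefficients gives a series over \<open>D[[t]]\<close>, whose variable is then set equal to
    t.\<close>
  define \<sigma>' where "\<sigma>' f = D.diagonal (\<psi> \<circ> f)" for f
  have hom: "\<sigma>' \<in> ring_hom D.P D.P"
  proof -
    have "\<sigma>' = D.diagonal \<circ> (\<lambda>f. \<psi> \<circ> f)" by (simp add: \<sigma>'_def fun_eq_iff)
    then show ?thesis
      using ring_hom_trans[OF powser_map_hom[OF D.ring_axioms DP.ring_axioms \<psi>] D.diagonal_hom] by simp
  qed
  \<comment> \<open>The map is unitriangular: because \<psi> d has constant term d, the coefficient
    m of the image is f m plus a term in the earlier coefficients. Bijectivity follows by recursion
    on m.\<close>
  have \<sigma>'_split: "\<sigma>' f m = f m \<oplus>\<^bsub>D\<^esub> (\<Oplus>\<^bsub>D\<^esub>k\<in>{..<m}. \<psi> (f k) (m - k))" if f: "f \<in> carrier D.P" for f m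
  proof -
    have "{..m} = insert m {..<m}" by auto
    then show ?thesis using f by (simp add: \<sigma>'_def D.diagonal_def D.finsum_insert \<psi>_0)
  qed
  have inj: "inj_on \<sigma>' (carrier D.P)"
  proof (rule inj_onI)
    fix f g assume f: "f \<in> carrier D.P" and g: "g \<in> carrier D.P" and eq: "\<sigma>' f = \<sigma>' g"
    have "f m = g m" for m
    proof (induction m rule: less_induct)
      case (less m)
      let ?s = "\<lambda>f. \<Oplus>\<^bsub>D\<^esub>k\<in>{..<m}. \<psi> (f k) (m - k)"
      have "?s f = ?s g" using less f g by (intro D.finsum_cong') auto
      moreover have "?s g \<in> carrier D" using g by (intro D.finsum_closed) auto
      moreover have "f m \<oplus>\<^bsub>D\<^esub> ?s f = g m \<oplus>\<^bsub>D\<^esub> ?s g"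
        using \<sigma>'_split[OF f, of m] \<sigma>'_split[OF g, of m] eq by simp
      ultimately show ?case using f g by simp
    qed
    then show "f = g" by blast
  qed
  have surj: "h \<in> \<sigma>' ` carrier D.P" if h: "h \<in> carrier D.P" for h
  proof -
    \<comment> \<open>The truncation again serves \<open>wf_nat_recursion\<close>; the recursion
      solves \<sigma>' f = h for f m.\<close>
    let ?cut = "\<lambda>m f (i::nat). if i < m then f i else \<zero>\<^bsub>D\<^esub>"
    obtain f where f: "\<And>m. f m = h m \<ominus>\<^bsub>D\<^esub> (\<Oplus>\<^bsub>D\<^esub>k\<in>{..<m}. \<psi> (?cut m f k) (m - k))"
    proof (rule wf_nat_recursion)
      fix m and f g :: "nat \<Rightarrow> 'd" assume "\<And>i. i < m \<Longrightarrow> f i = g i"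
      then have "(\<lambda>k. \<psi> (?cut m f k) (m - k)) = (\<lambda>k. \<psi> (?cut m g k) (m - k))" by auto
      then show "h m \<ominus>\<^bsub>D\<^esub> (\<Oplus>\<^bsub>D\<^esub>k\<in>{..<m}. \<psi> (?cut m f k) (m - k)) =
        h m \<ominus>\<^bsub>D\<^esub> (\<Oplus>\<^bsub>D\<^esub>k\<in>{..<m}. \<psi> (?cut m g k) (m - k))" by (simp only:)
    qed blast
    have fc: "f m \<in> carrier D" for m
    proof (induction m rule: less_induct)
      case (less m)
      have "(\<Oplus>\<^bsub>D\<^esub>k\<in>{..<m}. \<psi> (?cut m f k) (m - k)) \<in> carrier D"
        using less by (intro D.finsum_closed) auto
      then show ?case unfolding f[of m] using h by (intro D.minus_closed) simp_all
    qed
    then have fP: "f \<in> carrier D.P" by (rule D.P_I)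
    have "\<sigma>' f m = h m" for m
    proof -
      have "(\<Oplus>\<^bsub>D\<^esub>k\<in>{..<m}. \<psi> (?cut m f k) (m - k)) = (\<Oplus>\<^bsub>D\<^esub>k\<in>{..<m}. \<psi> (f k) (m - k))" (is "_ = ?s")
        using fc by (intro D.finsum_cong') auto
      then have "f m = h m \<ominus>\<^bsub>D\<^esub> ?s" using f[of m] by simp
      moreover have "?s \<in> carrier D" using fc by (intro D.finsum_closed) auto
      ultimately show ?thesis using \<sigma>'_split[OF fP, of m] h
        by (simp add: a_minus_def D.a_assoc D.l_neg)
    qed
    then show ?thesis using fP by (intro image_eqI[of _ _ f]) auto
  qed
  have "unipotent_powser_automorphism D \<sigma>'"
  proof
    show "\<sigma>' \<in> ring_iso D.P D.P"
      unfolding ring_iso_def bij_betw_def using hom inj surj ring_hom_closed[OF hom] by auto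
    show "\<sigma>' f 0 = f 0" if "f \<in> carrier D.P" for f using \<sigma>'_split[OF that, of 0] that by simp
    show "\<sigma>' (powser_t D) = powser_t D"
    proof
      fix m
      have "(\<Oplus>\<^bsub>D\<^esub>k\<in>{..<m}. \<psi> (powser_t D k) (m - k)) = \<zero>\<^bsub>D\<^esub>"
        by (rule D.add.finprod_one_eqI) (auto simp: powser_t_def D.P_one D.P_zero)
      then show "\<sigma>' (powser_t D) m = powser_t D m"
        using \<sigma>'_split[OF D.powser_t_carrier, of m] D.P_coeff[OF D.powser_t_carrier] by simp
    qed
  qed
  moreover have "\<sigma>' (e \<circ> f) = e \<circ> \<sigma> f" if f: "f \<in> carrier A.P" for f
  proof
    fix m
    have "\<sigma>' (e \<circ> f) m = (\<Oplus>\<^bsub>D\<^esub>k\<in>{..m}. e (\<sigma> (powser_const A (f k)) (m - k)))"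
      using f by (simp add: \<sigma>'_def D.diagonal_def \<psi>e \<phi>_def)
    also have "\<dots> = e (\<Oplus>\<^bsub>A\<^esub>k\<in>{..m}. \<sigma> (powser_const A (f k)) (m - k))"
      using f c by (subst e.hom_finsum) (auto simp: comp_def)
    finally show "\<sigma>' (e \<circ> f) m = (e \<circ> \<sigma> f) m" using A.\<sigma>_expansion[OF f] by simp
  qed
  ultimately show ?thesis by blast
qed


section \<open>Completed group algebras\<close>

context group begin

lemma bij_betw_l_mult: "a \<in> carrier G \<Longrightarrow> bij_betw (\<lambda>x. a \<otimes> x) (carrier G) (carrier G)"
  by (rule bij_betw_byWitness[where f' = "\<lambda>x. inv a \<otimes> x"]) (auto simp: m_assoc[symmetric])

lemma inv_mult_eq_iff: "x \<in> carrier G \<Longrightarrow> y \<in> carrier G \<Longrightarrow> z \<in> carrier G \<Longrightarrow> inv x \<otimes> y = z \<longleftrightarrow> y = x \<otimes> z"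
  by (metis inv_solve_left' m_closed)

end

locale finite_group_algebra = K: plain_ring K + H: group H for K :: "'k ring" and H :: "'h monoid" +
  assumes fin [simp]: "finite (carrier H)"
begin

abbreviation A where "A \<equiv> group_algebra K H"

lemma A_apply:
  assumes "x \<in> carrier H"
  shows "(f \<otimes>\<^bsub>A\<^esub> f') x = (\<Oplus>\<^bsub>K\<^esub>y\<in>carrier H. f y \<otimes>\<^bsub>K\<^esub> f' (inv\<^bsub>H\<^esub> y \<otimes>\<^bsub>H\<^esub> x))"
    "(f \<oplus>\<^bsub>A\<^esub> f') x = f x \<oplus>\<^bsub>K\<^esub> f' x"
    "\<zero>\<^bsub>A\<^esub> x = \<zero>\<^bsub>K\<^esub>" "\<one>\<^bsub>A\<^esub> x = (if x = \<one>\<^bsub>H\<^esub> then \<one>\<^bsub>K\<^esub> else \<zero>\<^bsub>K\<^esub>)"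
  using assms by (simp_all add: group_algebra_def)

lemma A_coeff: "f \<in> carrier A \<Longrightarrow> x \<in> carrier H \<Longrightarrow> f x \<in> carrier K"
  by (auto simp: group_algebra_def)

lemma A_eqI:
  "f \<in> carrier A \<Longrightarrow> g \<in> carrier A \<Longrightarrow> (\<And>x. x \<in> carrier H \<Longrightarrow> f x = g x) \<Longrightarrow> f = g"
  unfolding group_algebra_def by (auto intro: PiE_ext)

lemma A_closed:
  "f \<in> carrier A \<Longrightarrow> f' \<in> carrier A \<Longrightarrow> f \<otimes>\<^bsub>A\<^esub> f' \<in> carrier A"
  "f \<in> carrier A \<Longrightarrow> f' \<in> carrier A \<Longrightarrow> f \<oplus>\<^bsub>A\<^esub> f' \<in> carrier A"
  "\<zero>\<^bsub>A\<^esub> \<in> carrier A" "\<one>\<^bsub>A\<^esub> \<in> carrier A"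
  by (auto simp: group_algebra_def intro!: K.finsum_closed)

lemma A_reindex:
  assumes "y \<in> carrier H" "\<And>x. x \<in> carrier H \<Longrightarrow> F x \<in> carrier K"
  shows "(\<Oplus>\<^bsub>K\<^esub>x\<in>carrier H. F (y \<otimes>\<^bsub>H\<^esub> x)) = (\<Oplus>\<^bsub>K\<^esub>x\<in>carrier H. F x)"
  using assms by (intro K.finsum_reindex_bij H.bij_betw_l_mult) auto

lemma A_ring: "ring A"
proof (intro ringI abelian_groupI monoidI)
  fix f g h assume f: "f \<in> carrier A" and g: "g \<in> carrier A"
  note fg = f[THEN A_coeff] g[THEN A_coeff]
  show "f \<oplus>\<^bsub>A\<^esub> g \<in> carrier A" "f \<otimes>\<^bsub>A\<^esub> g \<in> carrier A" using f g by (auto intro: A_closed)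
  show "f \<oplus>\<^bsub>A\<^esub> g = g \<oplus>\<^bsub>A\<^esub> f"
    by (rule A_eqI) (use f g fg in \<open>auto simp: A_apply A_closed K.a_comm\<close>)
  show "\<zero>\<^bsub>A\<^esub> \<oplus>\<^bsub>A\<^esub> f = f"
    by (rule A_eqI) (use f fg in \<open>auto simp: A_apply A_closed\<close>)
  show "\<exists>y\<in>carrier A. y \<oplus>\<^bsub>A\<^esub> f = \<zero>\<^bsub>A\<^esub>"
  proof
    show c: "(\<lambda>x\<in>carrier H. \<ominus>\<^bsub>K\<^esub> f x) \<in> carrier A" using fg by (auto simp: group_algebra_def)
    show "(\<lambda>x\<in>carrier H. \<ominus>\<^bsub>K\<^esub> f x) \<oplus>\<^bsub>A\<^esub> f = \<zero>\<^bsub>A\<^esub>"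
      by (rule A_eqI) (use f c fg in \<open>auto simp: A_apply A_closed K.l_neg\<close>)
  qed
  show "\<one>\<^bsub>A\<^esub> \<otimes>\<^bsub>A\<^esub> f = f"
  proof (rule A_eqI)
    fix x assume x: "x \<in> carrier H"
    have "(\<one>\<^bsub>A\<^esub> \<otimes>\<^bsub>A\<^esub> f) x = (\<Oplus>\<^bsub>K\<^esub>y\<in>carrier H. \<one>\<^bsub>A\<^esub> y \<otimes>\<^bsub>K\<^esub> f (inv\<^bsub>H\<^esub> y \<otimes>\<^bsub>H\<^esub> x))" using x by (simp add: A_apply)
    also have "\<dots> = \<one>\<^bsub>A\<^esub> \<one>\<^bsub>H\<^esub> \<otimes>\<^bsub>K\<^esub> f (inv\<^bsub>H\<^esub> \<one>\<^bsub>H\<^esub> \<otimes>\<^bsub>H\<^esub> x)"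
      by (rule K.finsum_eq_single) (use x fg in \<open>auto simp: A_apply\<close>)
    finally show "(\<one>\<^bsub>A\<^esub> \<otimes>\<^bsub>A\<^esub> f) x = f x" using x fg by (simp add: A_apply)
  qed (use f in \<open>auto simp: A_closed\<close>)
  show "f \<otimes>\<^bsub>A\<^esub> \<one>\<^bsub>A\<^esub> = f"
  proof (rule A_eqI)
    fix x assume x: "x \<in> carrier H"
    have "(f \<otimes>\<^bsub>A\<^esub> \<one>\<^bsub>A\<^esub>) x = (\<Oplus>\<^bsub>K\<^esub>y\<in>carrier H. f y \<otimes>\<^bsub>K\<^esub> \<one>\<^bsub>A\<^esub> (inv\<^bsub>H\<^esub> y \<otimes>\<^bsub>H\<^esub> x))" using x by (simp add: A_apply)
    also have "\<dots> = f x \<otimes>\<^bsub>K\<^esub> \<one>\<^bsub>A\<^esub> (inv\<^bsub>H\<^esub> x \<otimes>\<^bsub>H\<^esub> x)"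
      by (rule K.finsum_eq_single) (use x fg in \<open>auto simp: A_apply H.inv_mult_eq_iff\<close>)
    finally show "(f \<otimes>\<^bsub>A\<^esub> \<one>\<^bsub>A\<^esub>) x = f x" using x fg by (simp add: A_apply)
  qed (use f in \<open>auto simp: A_closed\<close>)
  assume h: "h \<in> carrier A"
  note fgh = fg h[THEN A_coeff]
  show "f \<oplus>\<^bsub>A\<^esub> g \<oplus>\<^bsub>A\<^esub> h = f \<oplus>\<^bsub>A\<^esub> (g \<oplus>\<^bsub>A\<^esub> h)"
    by (rule A_eqI) (use f g h fgh in \<open>auto simp: A_apply A_closed K.a_assoc\<close>)
  show "(f \<oplus>\<^bsub>A\<^esub> g) \<otimes>\<^bsub>A\<^esub> h = f \<otimes>\<^bsub>A\<^esub> h \<oplus>\<^bsub>A\<^esub> (g \<otimes>\<^bsub>A\<^esub> h)"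
  proof (rule A_eqI)
    fix x assume x: "x \<in> carrier H"
    have "((f \<oplus>\<^bsub>A\<^esub> g) \<otimes>\<^bsub>A\<^esub> h) x = (\<Oplus>\<^bsub>K\<^esub>y\<in>carrier H. (f \<oplus>\<^bsub>A\<^esub> g) y \<otimes>\<^bsub>K\<^esub> h (inv\<^bsub>H\<^esub> y \<otimes>\<^bsub>H\<^esub> x))"
      using x by (simp add: A_apply(1))
    also have "\<dots> = (\<Oplus>\<^bsub>K\<^esub>y\<in>carrier H. f y \<otimes>\<^bsub>K\<^esub> h (inv\<^bsub>H\<^esub> y \<otimes>\<^bsub>H\<^esub> x) \<oplus>\<^bsub>K\<^esub> g y \<otimes>\<^bsub>K\<^esub> h (inv\<^bsub>H\<^esub> y \<otimes>\<^bsub>H\<^esub> x))"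
      using x fgh by (intro K.finsum_cong') (auto simp: A_apply(2) K.l_distr)
    also have "\<dots> = (f \<otimes>\<^bsub>A\<^esub> h \<oplus>\<^bsub>A\<^esub> (g \<otimes>\<^bsub>A\<^esub> h)) x"
      using x fgh by (subst K.finsum_addf) (auto simp: A_apply)
    finally show "((f \<oplus>\<^bsub>A\<^esub> g) \<otimes>\<^bsub>A\<^esub> h) x = (f \<otimes>\<^bsub>A\<^esub> h \<oplus>\<^bsub>A\<^esub> (g \<otimes>\<^bsub>A\<^esub> h)) x" .
  qed (use f g h in \<open>auto simp: A_closed\<close>)
  show "h \<otimes>\<^bsub>A\<^esub> (f \<oplus>\<^bsub>A\<^esub> g) = h \<otimes>\<^bsub>A\<^esub> f \<oplus>\<^bsub>A\<^esub> (h \<otimes>\<^bsub>A\<^esub> g)"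
  proof (rule A_eqI)
    fix x assume x: "x \<in> carrier H"
    have "(h \<otimes>\<^bsub>A\<^esub> (f \<oplus>\<^bsub>A\<^esub> g)) x = (\<Oplus>\<^bsub>K\<^esub>y\<in>carrier H. h y \<otimes>\<^bsub>K\<^esub> (f \<oplus>\<^bsub>A\<^esub> g) (inv\<^bsub>H\<^esub> y \<otimes>\<^bsub>H\<^esub> x))"
      using x by (simp add: A_apply(1))
    also have "\<dots> = (\<Oplus>\<^bsub>K\<^esub>y\<in>carrier H. h y \<otimes>\<^bsub>K\<^esub> f (inv\<^bsub>H\<^esub> y \<otimes>\<^bsub>H\<^esub> x) \<oplus>\<^bsub>K\<^esub> h y \<otimes>\<^bsub>K\<^esub> g (inv\<^bsub>H\<^esub> y \<otimes>\<^bsub>H\<^esub> x))"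
      using x fgh by (intro K.finsum_cong') (auto simp: A_apply(2) K.r_distr)
    also have "\<dots> = (h \<otimes>\<^bsub>A\<^esub> f \<oplus>\<^bsub>A\<^esub> (h \<otimes>\<^bsub>A\<^esub> g)) x"
      using x fgh by (subst K.finsum_addf) (auto simp: A_apply)
    finally show "(h \<otimes>\<^bsub>A\<^esub> (f \<oplus>\<^bsub>A\<^esub> g)) x = (h \<otimes>\<^bsub>A\<^esub> f \<oplus>\<^bsub>A\<^esub> (h \<otimes>\<^bsub>A\<^esub> g)) x" .
  qed (use f g h in \<open>auto simp: A_closed\<close>)
  show "f \<otimes>\<^bsub>A\<^esub> g \<otimes>\<^bsub>A\<^esub> h = f \<otimes>\<^bsub>A\<^esub> (g \<otimes>\<^bsub>A\<^esub> h)"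
  proof (rule A_eqI)
    fix x assume x: "x \<in> carrier H"
    let ?i = "\<lambda>y. inv\<^bsub>H\<^esub> y" and ?m = "\<lambda>y z. y \<otimes>\<^bsub>H\<^esub> z"
    have "(f \<otimes>\<^bsub>A\<^esub> g \<otimes>\<^bsub>A\<^esub> h) x = (\<Oplus>\<^bsub>K\<^esub>w\<in>carrier H. (f \<otimes>\<^bsub>A\<^esub> g) w \<otimes>\<^bsub>K\<^esub> h (?m (?i w) x))"
      using x by (simp add: A_apply(1))
    also have "\<dots> = (\<Oplus>\<^bsub>K\<^esub>w\<in>carrier H. \<Oplus>\<^bsub>K\<^esub>y\<in>carrier H. f y \<otimes>\<^bsub>K\<^esub> g (?m (?i y) w) \<otimes>\<^bsub>K\<^esub> h (?m (?i w) x))"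
      using x fgh by (intro K.finsum_cong') (auto simp: A_apply(1) K.finsum_ldistr intro!: K.finsum_closed)
    also have "\<dots> = (\<Oplus>\<^bsub>K\<^esub>y\<in>carrier H. \<Oplus>\<^bsub>K\<^esub>w\<in>carrier H. f y \<otimes>\<^bsub>K\<^esub> g (?m (?i y) w) \<otimes>\<^bsub>K\<^esub> h (?m (?i w) x))"
      using x fgh by (intro K.finsum_swap) auto
    also have "\<dots> = (\<Oplus>\<^bsub>K\<^esub>y\<in>carrier H. f y \<otimes>\<^bsub>K\<^esub> (g \<otimes>\<^bsub>A\<^esub> h) (?m (?i y) x))"
    proof (intro K.finsum_cong' refl)
      fix y assume y: "y \<in> carrier H"
      have "(\<Oplus>\<^bsub>K\<^esub>w\<in>carrier H. f y \<otimes>\<^bsub>K\<^esub> g (?m (?i y) w) \<otimes>\<^bsub>K\<^esub> h (?m (?i w) x)) =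
        (\<Oplus>\<^bsub>K\<^esub>z\<in>carrier H. f y \<otimes>\<^bsub>K\<^esub> g (?m (?i y) (?m y z)) \<otimes>\<^bsub>K\<^esub> h (?m (?i (?m y z)) x))"
        using x y fgh by (intro A_reindex[symmetric, of y "\<lambda>w. f y \<otimes>\<^bsub>K\<^esub> g (?m (?i y) w) \<otimes>\<^bsub>K\<^esub> h (?m (?i w) x)"]) auto
      also have "\<dots> = (\<Oplus>\<^bsub>K\<^esub>z\<in>carrier H. f y \<otimes>\<^bsub>K\<^esub> (g z \<otimes>\<^bsub>K\<^esub> h (?m (?i z) (?m (?i y) x))))"
        using x y fgh by (intro K.finsum_cong') (auto simp: H.m_assoc[symmetric] H.inv_mult_group K.m_assoc)
      also have "\<dots> = f y \<otimes>\<^bsub>K\<^esub> (g \<otimes>\<^bsub>A\<^esub> h) (?m (?i y) x)"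
        using x y fgh by (simp add: A_apply(1) K.finsum_rdistr Pi_iff)
      finally show "(\<Oplus>\<^bsub>K\<^esub>w\<in>carrier H. f y \<otimes>\<^bsub>K\<^esub> g (?m (?i y) w) \<otimes>\<^bsub>K\<^esub> h (?m (?i w) x)) =
        f y \<otimes>\<^bsub>K\<^esub> (g \<otimes>\<^bsub>A\<^esub> h) (?m (?i y) x)" .
    qed (use x fgh g h in \<open>auto intro!: A_coeff[OF A_closed(1)]\<close>)
    also have "\<dots> = (f \<otimes>\<^bsub>A\<^esub> (g \<otimes>\<^bsub>A\<^esub> h)) x" using x by (simp add: A_apply(1))
    finally show "(f \<otimes>\<^bsub>A\<^esub> g \<otimes>\<^bsub>A\<^esub> h) x = (f \<otimes>\<^bsub>A\<^esub> (g \<otimes>\<^bsub>A\<^esub> h)) x" .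
  qed (use f g h in \<open>auto simp: A_closed\<close>)
qed (auto simp: A_closed)

end

text \<open>Here f' and g' are the push-forwards of f and g along \<tau>. For fixed y the
  substitution D = y z carries the fibre over C to the fibre over \<open>\<tau>(y)^-1 C\<close>, and
  this makes push-forward multiplicative. With the transition maps as \<tau> it shows that products
  of compatible families are compatible.\<close>

lemma group_algebra_push_mult:
  assumes "finite_group_algebra K H" "finite_group_algebra K H'"
    and \<tau>: "\<tau> \<in> hom H H'" and C: "C \<in> carrier H'"
    and f: "f \<in> carrier (group_algebra K H)" and g: "g \<in> carrier (group_algebra K H)"
    and f': "\<And>C. C \<in> carrier H' \<Longrightarrow> f' C = (\<Oplus>\<^bsub>K\<^esub>D\<in>{D \<in> carrier H. \<tau> D = C}. f D)"
    and g': "\<And>C. C \<in> carrier H' \<Longrightarrow> g' C = (\<Oplus>\<^bsub>K\<^esub>D\<in>{D \<in> carrier H. \<tau> D = C}. g D)"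
  shows "(f' \<otimes>\<^bsub>group_algebra K H'\<^esub> g') C =
    (\<Oplus>\<^bsub>K\<^esub>D\<in>{D \<in> carrier H. \<tau> D = C}. (f \<otimes>\<^bsub>group_algebra K H\<^esub> g) D)"
proof -
  interpret H: finite_group_algebra K H by fact
  interpret H': finite_group_algebra K H' by fact
  interpret \<tau>: group_hom H H' \<tau> using \<tau> by unfold_locales
  note fg = f[THEN H.A_coeff] g[THEN H.A_coeff]
  have g'c: "g' C \<in> carrier K" if "C \<in> carrier H'" for C
    using that fg by (auto simp: g' intro!: H.K.finsum_closed)
  have "(\<Oplus>\<^bsub>K\<^esub>D\<in>{D \<in> carrier H. \<tau> D = C}. (f \<otimes>\<^bsub>group_algebra K H\<^esub> g) D) =
    (\<Oplus>\<^bsub>K\<^esub>D\<in>{D \<in> carrier H. \<tau> D = C}. \<Oplus>\<^bsub>K\<^esub>y\<in>carrier H. f y \<otimes>\<^bsub>K\<^esub> g (inv\<^bsub>H\<^esub> y \<otimes>\<^bsub>H\<^esub> D))"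
    using fg by (intro H.K.finsum_cong') (auto simp: H.A_apply(1) intro!: H.K.finsum_closed)
  also have "\<dots> = (\<Oplus>\<^bsub>K\<^esub>y\<in>carrier H. \<Oplus>\<^bsub>K\<^esub>D\<in>{D \<in> carrier H. \<tau> D = C}. f y \<otimes>\<^bsub>K\<^esub> g (inv\<^bsub>H\<^esub> y \<otimes>\<^bsub>H\<^esub> D))"
    using fg by (intro H.K.finsum_swap) auto
  also have "\<dots> = (\<Oplus>\<^bsub>K\<^esub>y\<in>carrier H. f y \<otimes>\<^bsub>K\<^esub> g' (inv\<^bsub>H'\<^esub> \<tau> y \<otimes>\<^bsub>H'\<^esub> C))"
  proof (intro H.K.finsum_cong' refl)
    fix y assume y: "y \<in> carrier H"
    let ?B = "{z \<in> carrier H. \<tau> z = inv\<^bsub>H'\<^esub> \<tau> y \<otimes>\<^bsub>H'\<^esub> C}"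
    have bij: "bij_betw (\<lambda>D. inv\<^bsub>H\<^esub> y \<otimes>\<^bsub>H\<^esub> D) {D \<in> carrier H. \<tau> D = C} ?B"
      using y C by (intro bij_betw_byWitness[where f' = "\<lambda>z. y \<otimes>\<^bsub>H\<^esub> z"])
        (auto simp: H.H.m_assoc[symmetric] H'.H.m_assoc[symmetric])
    have "(\<Oplus>\<^bsub>K\<^esub>D\<in>{D \<in> carrier H. \<tau> D = C}. f y \<otimes>\<^bsub>K\<^esub> g (inv\<^bsub>H\<^esub> y \<otimes>\<^bsub>H\<^esub> D)) = (\<Oplus>\<^bsub>K\<^esub>z\<in>?B. f y \<otimes>\<^bsub>K\<^esub> g z)"
      using fg y by (intro H.K.finsum_reindex_bij[OF bij]) auto
    also have "\<dots> = f y \<otimes>\<^bsub>K\<^esub> g' (inv\<^bsub>H'\<^esub> \<tau> y \<otimes>\<^bsub>H'\<^esub> C)"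
      using fg y C by (subst g') (auto intro!: H.K.finsum_rdistr[symmetric])
    finally show "(\<Oplus>\<^bsub>K\<^esub>D\<in>{D \<in> carrier H. \<tau> D = C}. f y \<otimes>\<^bsub>K\<^esub> g (inv\<^bsub>H\<^esub> y \<otimes>\<^bsub>H\<^esub> D)) = f y \<otimes>\<^bsub>K\<^esub> g' (inv\<^bsub>H'\<^esub> \<tau> y \<otimes>\<^bsub>H'\<^esub> C)" .
  qed (use fg C g'c in auto)
  also have "\<dots> = (\<Oplus>\<^bsub>K\<^esub>E\<in>carrier H'. \<Oplus>\<^bsub>K\<^esub>y\<in>{y \<in> carrier H. \<tau> y = E}. f y \<otimes>\<^bsub>K\<^esub> g' (inv\<^bsub>H'\<^esub> \<tau> y \<otimes>\<^bsub>H'\<^esub> C))"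
    using fg C g'c by (intro H.K.finsum_fibres[symmetric]) auto
  also have "\<dots> = (\<Oplus>\<^bsub>K\<^esub>E\<in>carrier H'. f' E \<otimes>\<^bsub>K\<^esub> g' (inv\<^bsub>H'\<^esub> E \<otimes>\<^bsub>H'\<^esub> C))"
  proof (intro H.K.finsum_cong' refl)
    fix E assume E: "E \<in> carrier H'"
    have "(\<Oplus>\<^bsub>K\<^esub>y\<in>{y \<in> carrier H. \<tau> y = E}. f y \<otimes>\<^bsub>K\<^esub> g' (inv\<^bsub>H'\<^esub> \<tau> y \<otimes>\<^bsub>H'\<^esub> C)) =
      (\<Oplus>\<^bsub>K\<^esub>y\<in>{y \<in> carrier H. \<tau> y = E}. f y \<otimes>\<^bsub>K\<^esub> g' (inv\<^bsub>H'\<^esub> E \<otimes>\<^bsub>H'\<^esub> C))"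
      using fg C E g'c by (intro H.K.finsum_cong') auto
    also have "\<dots> = f' E \<otimes>\<^bsub>K\<^esub> g' (inv\<^bsub>H'\<^esub> E \<otimes>\<^bsub>H'\<^esub> C)"
      using fg C E g'c by (subst f') (auto intro!: H.K.finsum_ldistr[symmetric])
    finally show "(\<Oplus>\<^bsub>K\<^esub>y\<in>{y \<in> carrier H. \<tau> y = E}. f y \<otimes>\<^bsub>K\<^esub> g' (inv\<^bsub>H'\<^esub> \<tau> y \<otimes>\<^bsub>H'\<^esub> C)) =
      f' E \<otimes>\<^bsub>K\<^esub> g' (inv\<^bsub>H'\<^esub> E \<otimes>\<^bsub>H'\<^esub> C)" .
  qed (use fg C g'c in \<open>auto simp: f' intro!: H.K.finsum_closed\<close>)
  also have "\<dots> = (f' \<otimes>\<^bsub>group_algebra K H'\<^esub> g') C" using C by (simp add: H'.A_apply(1))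
  finally show ?thesis ..
qed


section \<open>The inverse limit over the open normal subgroups\<close>

lemma (in normal) rcos_eq_iff:
  "x \<in> carrier G \<Longrightarrow> C \<in> rcosets H \<Longrightarrow> x \<in> C \<longleftrightarrow> C = H #> x"
  using repr_independence[OF _ _ is_subgroup] rcos_self[OF _ is_subgroup] by (auto simp: RCOSETS_def)

text \<open>Finiteness of the quotients makes convolution a finite sum, and openness of the carrier
  puts the trivial quotient, where the augmentation lives, into the inverse system. Both hold for
  compact topological groups.\<close>

locale cga_group = K: plain_ring K + G: group G for K :: "'k ring" and G :: "'g monoid" (structure) and T :: "'g topology" +
  assumes fin_cosets: "U \<in> open_normals G T \<Longrightarrow> finite (carrier (G Mod U))"
    and carrier_open: "openin T (carrier G)"
begin

abbreviation S where "S \<equiv> completed_group_algebra K G T"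
abbreviation \<N> where "\<N> \<equiv> open_normals G T"

lemma \<N>_normal: "U \<in> \<N> \<Longrightarrow> U \<lhd> G"
  by (simp add: open_normals_def)

lemma fga: "U \<in> \<N> \<Longrightarrow> finite_group_algebra K (G Mod U)"
  by (intro finite_group_algebra.intro finite_group_algebra_axioms.intro K.plain_ring_axioms
      normal.factorgroup_is_group \<N>_normal fin_cosets)

lemma coset_map_rcos:
  assumes U: "U \<in> \<N>" and V: "V \<in> \<N>" and UV: "U \<subseteq> V" and x: "x \<in> carrier G"
  shows "V <#> (U #> x) = V #> x"
proof -
  interpret U: normal U G using \<N>_normal[OF U] .
  interpret V: normal V G using \<N>_normal[OF V] .
  have "V <#> U = V"
  proof
    show "V <#> U \<subseteq> V" using UV V.m_closed by (auto simp: set_mult_def)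
    show "V \<subseteq> V <#> U"
    proof
      fix v assume v: "v \<in> V"
      then have "v \<otimes> \<one> \<in> V <#> U" using U.one_closed unfolding set_mult_def by blast
      then show "v \<in> V <#> U" using v V.subset by auto
    qed
  qed
  then show ?thesis
    using G.setmult_rcos_assoc[OF V.subset U.subset x] by simp
qed

lemma rcosetsE:
  assumes "C \<in> carrier (G Mod U)"
  obtains x where "x \<in> carrier G" "C = U #> x"
  using assms by (auto simp: FactGroup_def RCOSETS_def)

lemma coset_map_hom:
  assumes U: "U \<in> \<N>" and V: "V \<in> \<N>" and UV: "U \<subseteq> V"
  shows "(\<lambda>D. V <#> D) \<in> hom (G Mod U) (G Mod V)"
proof (rule homI)
  interpret U: normal U G using \<N>_normal[OF U] .
  interpret V: normal V G using \<N>_normal[OF V] .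
  fix C assume "C \<in> carrier (G Mod U)"
  then obtain x where x: "x \<in> carrier G" "C = U #> x" by (rule rcosetsE)
  then show "V <#> C \<in> carrier (G Mod V)"
    using coset_map_rcos[OF assms] by (auto simp: FactGroup_def RCOSETS_def)
  fix D assume "D \<in> carrier (G Mod U)"
  then obtain y where y: "y \<in> carrier G" "D = U #> y" by (rule rcosetsE)
  show "V <#> (C \<otimes>\<^bsub>G Mod U\<^esub> D) = (V <#> C) \<otimes>\<^bsub>G Mod V\<^esub> (V <#> D)"
    using x y coset_map_rcos[OF assms] by (simp add: FactGroup_def U.rcos_sum V.rcos_sum)
qed

lemma coset_subset_iff:
  assumes U: "U \<in> \<N>" and V: "V \<in> \<N>" and UV: "U \<subseteq> V"
    and D: "D \<in> carrier (G Mod U)" and C: "C \<in> carrier (G Mod V)"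
  shows "D \<subseteq> C \<longleftrightarrow> V <#> D = C"
proof -
  interpret U: normal U G using \<N>_normal[OF U] .
  interpret V: normal V G using \<N>_normal[OF V] .
  obtain x where x: "x \<in> carrier G" "D = U #> x" using D by (rule rcosetsE)
  have *: "V <#> D = V #> x" using coset_map_rcos[OF U V UV x(1)] x by simp
  have C': "C \<in> rcosets V" using C by (simp add: FactGroup_def)
  show ?thesis
  proof
    assume "D \<subseteq> C"
    then have "x \<in> C" using x G.rcos_self[OF x(1) U.is_subgroup] by auto
    then show "V <#> D = C" using V.rcos_eq_iff[OF x(1) C'] * by simp
  next
    assume "V <#> D = C"
    then show "D \<subseteq> C" using * x UV by (auto simp: r_coset_def)
  qed
qed

text \<open>\<open>V <#> D\<close> is the coset of V that contains D. Written with it, the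
  transition map is a fibre sum along a group homomorphism, the form that
  \<open>group_algebra_push_mult\<close> handles.\<close>

lemma S_carrier_iff:
  "a \<in> carrier S \<longleftrightarrow> a \<in> (\<Pi>\<^sub>E U\<in>\<N>. carrier (group_algebra K (G Mod U))) \<and>
    (\<forall>U\<in>\<N>. \<forall>V\<in>\<N>. U \<subseteq> V \<longrightarrow> (\<forall>C\<in>carrier (G Mod V).
      a V C = (\<Oplus>\<^bsub>K\<^esub>D\<in>{D \<in> carrier (G Mod U). V <#> D = C}. a U D)))"
proof -
  have "{D \<in> carrier (G Mod U). D \<subseteq> C} = {D \<in> carrier (G Mod U). V <#> D = C}"
    if "U \<in> \<N>" "V \<in> \<N>" "U \<subseteq> V" "C \<in> carrier (G Mod V)" for U V C
    using coset_subset_iff[OF that(1-3) _ that(4)] by blast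
  then show ?thesis by (simp add: completed_group_algebra_def cong: ball_cong)
qed

lemma S_component: "a \<in> carrier S \<Longrightarrow> U \<in> \<N> \<Longrightarrow> a U \<in> carrier (group_algebra K (G Mod U))"
  by (auto simp: S_carrier_iff)

lemma S_compatible:
  "a \<in> carrier S \<Longrightarrow> U \<in> \<N> \<Longrightarrow> V \<in> \<N> \<Longrightarrow> U \<subseteq> V \<Longrightarrow> C \<in> carrier (G Mod V) \<Longrightarrow>
    a V C = (\<Oplus>\<^bsub>K\<^esub>D\<in>{D \<in> carrier (G Mod U). V <#> D = C}. a U D)"
  by (simp add: S_carrier_iff)

lemma S_coeff: "a \<in> carrier S \<Longrightarrow> U \<in> \<N> \<Longrightarrow> C \<in> carrier (G Mod U) \<Longrightarrow> a U C \<in> carrier K"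
  by (rule finite_group_algebra.A_coeff[OF fga S_component])

lemma S_eqI:
  "a \<in> carrier S \<Longrightarrow> b \<in> carrier S \<Longrightarrow> (\<And>U. U \<in> \<N> \<Longrightarrow> a U = b U) \<Longrightarrow> a = b"
  using S_carrier_iff[THEN iffD1, THEN conjunct1] by (metis (no_types, lifting) PiE_ext)

lemma S_apply:
  assumes "U \<in> \<N>"
  shows "(a \<otimes>\<^bsub>S\<^esub> b) U = a U \<otimes>\<^bsub>group_algebra K (G Mod U)\<^esub> b U"
    "(a \<oplus>\<^bsub>S\<^esub> b) U = a U \<oplus>\<^bsub>group_algebra K (G Mod U)\<^esub> b U"
    "\<zero>\<^bsub>S\<^esub> U = \<zero>\<^bsub>group_algebra K (G Mod U)\<^esub>" "\<one>\<^bsub>S\<^esub> U = \<one>\<^bsub>group_algebra K (G Mod U)\<^esub>"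
  using assms by (simp_all add: completed_group_algebra_def)

lemma S_ext:
  assumes "U \<notin> \<N>"
  shows "(a \<otimes>\<^bsub>S\<^esub> b) U = undefined" "(a \<oplus>\<^bsub>S\<^esub> b) U = undefined"
    "\<one>\<^bsub>S\<^esub> U = undefined" "\<zero>\<^bsub>S\<^esub> U = undefined"
  using assms by (simp_all add: completed_group_algebra_def)

lemma one_in_one_coset: "C \<in> carrier (G Mod U) \<Longrightarrow> U \<in> \<N> \<Longrightarrow> x \<in> carrier G \<Longrightarrow> x \<in> C \<longleftrightarrow> C = U #> x"
  using normal.rcos_eq_iff[OF \<N>_normal] by (simp add: FactGroup_def)

lemma rcos_carrier: "U \<in> \<N> \<Longrightarrow> x \<in> carrier G \<Longrightarrow> U #> x \<in> carrier (G Mod U)"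
  by (auto simp: FactGroup_def RCOSETS_def)

lemma cga_of_apply: "U \<in> \<N> \<Longrightarrow> C \<in> carrier (G Mod U) \<Longrightarrow> cga_of K G T x U C = (if x \<in> C then \<one>\<^bsub>K\<^esub> else \<zero>\<^bsub>K\<^esub>)"
  by (simp add: cga_of_def)

lemma cga_of_closed:
  assumes x: "x \<in> carrier G"
  shows "cga_of K G T x \<in> carrier S"
  unfolding S_carrier_iff
proof (intro conjI ballI impI)
  show "cga_of K G T x \<in> (\<Pi>\<^sub>E U\<in>\<N>. carrier (group_algebra K (G Mod U)))"
    by (auto simp: cga_of_def group_algebra_def)
  fix U V C assume U: "U \<in> \<N>" and V: "V \<in> \<N>" and UV: "U \<subseteq> V" and C: "C \<in> carrier (G Mod V)"
  let ?I = "{D \<in> carrier (G Mod U). V <#> D = C}"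
  have Vx: "V <#> (U #> x) = V #> x" by (rule coset_map_rcos[OF U V UV x])
  show "cga_of K G T x V C = (\<Oplus>\<^bsub>K\<^esub>D\<in>?I. cga_of K G T x U D)"
  proof (cases "C = V #> x")
    case True
    have "(\<Oplus>\<^bsub>K\<^esub>D\<in>?I. cga_of K G T x U D) = cga_of K G T x U (U #> x)"
      using True Vx rcos_carrier[OF U x] fin_cosets[OF U]
      by (intro K.finsum_eq_single) (auto simp: cga_of_apply[OF U] one_in_one_coset[OF _ U x])
    then show ?thesis
      using True C x rcos_carrier[OF U x] by (simp add: cga_of_apply U V one_in_one_coset)
  next
    case False
    have "(\<Oplus>\<^bsub>K\<^esub>D\<in>?I. cga_of K G T x U D) = \<zero>\<^bsub>K\<^esub>"
      using False Vx by (intro K.add.finprod_one_eqI) (auto simp: cga_of_apply[OF U] one_in_one_coset[OF _ U x])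
    then show ?thesis using False C x by (simp add: cga_of_apply V one_in_one_coset)
  qed
qed

lemma cga_of_one: "cga_of K G T \<one> = \<one>\<^bsub>S\<^esub>"
proof
  fix U
  show "cga_of K G T \<one> U = \<one>\<^bsub>S\<^esub> U"
  proof (cases "U \<in> \<N>")
    case True
    interpret U: normal U G using \<N>_normal[OF True] .
    have "C = U #> \<one> \<longleftrightarrow> C = U" for C by (simp add: G.coset_mult_one U.subset)
    then show ?thesis using True by (auto simp: S_apply group_algebra_def cga_of_def one_in_one_coset one_FactGroup fun_eq_iff restrict_def)
  qed (simp add: S_ext cga_of_def)
qed

lemma cga_of_mult:
  assumes x: "x \<in> carrier G" and y: "y \<in> carrier G"
  shows "cga_of K G T (x \<otimes> y) = cga_of K G T x \<otimes>\<^bsub>S\<^esub> cga_of K G T y"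
proof
  fix U
  show "cga_of K G T (x \<otimes> y) U = (cga_of K G T x \<otimes>\<^bsub>S\<^esub> cga_of K G T y) U"
  proof (cases "U \<in> \<N>")
    case U: True
    interpret U: normal U G using \<N>_normal[OF U] .
    interpret A: finite_group_algebra K "G Mod U" by (rule fga[OF U])
    note c = rcos_carrier[OF U]
    show ?thesis unfolding S_apply(1)[OF U]
    proof (rule A.A_eqI)
      show "cga_of K G T (x \<otimes> y) U \<in> carrier A.A" "cga_of K G T x U \<otimes>\<^bsub>A.A\<^esub> cga_of K G T y U \<in> carrier A.A"
        using x y U cga_of_closed S_component by (auto intro: A.A_closed)
      fix C assume C: "C \<in> carrier (G Mod U)"
      have m: "inv\<^bsub>G Mod U\<^esub> E \<otimes>\<^bsub>G Mod U\<^esub> C \<in> carrier (G Mod U)" if "E \<in> carrier (G Mod U)" for E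
        using that C by (intro A.H.m_closed A.H.inv_closed)
      have val: "cga_of K G T z U E \<in> carrier K" if "E \<in> carrier (G Mod U)" for z E
        using that by (simp add: cga_of_apply[OF U])
      have "(cga_of K G T x U \<otimes>\<^bsub>A.A\<^esub> cga_of K G T y U) C =
        (\<Oplus>\<^bsub>K\<^esub>E\<in>carrier (G Mod U). cga_of K G T x U E \<otimes>\<^bsub>K\<^esub> cga_of K G T y U (inv\<^bsub>G Mod U\<^esub> E \<otimes>\<^bsub>G Mod U\<^esub> C))"
        using C by (simp add: A.A_apply)
      also have "\<dots> = cga_of K G T x U (U #> x) \<otimes>\<^bsub>K\<^esub> cga_of K G T y U (inv\<^bsub>G Mod U\<^esub> (U #> x) \<otimes>\<^bsub>G Mod U\<^esub> C)"
      proof (intro K.finsum_eq_single)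
        fix E assume E: "E \<in> carrier (G Mod U)" "E \<noteq> U #> x"
        then have "cga_of K G T x U E = \<zero>\<^bsub>K\<^esub>" by (simp add: cga_of_apply[OF U] one_in_one_coset[OF _ U x])
        then show "cga_of K G T x U E \<otimes>\<^bsub>K\<^esub> cga_of K G T y U (inv\<^bsub>G Mod U\<^esub> E \<otimes>\<^bsub>G Mod U\<^esub> C) = \<zero>\<^bsub>K\<^esub>"
          using val[OF m[OF E(1)]] by simp
      qed (use c[OF x] val m in \<open>auto simp del: mult_FactGroup\<close>)
      also have "\<dots> = (if inv\<^bsub>G Mod U\<^esub> (U #> x) \<otimes>\<^bsub>G Mod U\<^esub> C = U #> y then \<one>\<^bsub>K\<^esub> else \<zero>\<^bsub>K\<^esub>)"
        using x y c[OF x] m[OF c[OF x]]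
        by (simp add: cga_of_apply[OF U] one_in_one_coset[OF _ U] del: mult_FactGroup)
      also have "inv\<^bsub>G Mod U\<^esub> (U #> x) \<otimes>\<^bsub>G Mod U\<^esub> C = U #> y \<longleftrightarrow> C = (U #> x) \<otimes>\<^bsub>G Mod U\<^esub> (U #> y)"
        by (rule A.H.inv_mult_eq_iff) (use C x y c in auto)
      also have "(U #> x) \<otimes>\<^bsub>G Mod U\<^esub> (U #> y) = U #> (x \<otimes> y)"
        using x y by (simp add: FactGroup_def U.rcos_sum)
      finally show "cga_of K G T (x \<otimes> y) U C = (cga_of K G T x U \<otimes>\<^bsub>A.A\<^esub> cga_of K G T y U) C"
        using C x y by (simp add: cga_of_apply[OF U] one_in_one_coset[OF _ U])
    qed
  qed (simp add: S_ext cga_of_def)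
qed

lemma S_closed:
  assumes a: "a \<in> carrier S" and b: "b \<in> carrier S"
  shows "a \<otimes>\<^bsub>S\<^esub> b \<in> carrier S" "a \<oplus>\<^bsub>S\<^esub> b \<in> carrier S"
proof -
  show "a \<otimes>\<^bsub>S\<^esub> b \<in> carrier S"
    unfolding S_carrier_iff
  proof (intro conjI ballI impI)
    show "a \<otimes>\<^bsub>S\<^esub> b \<in> (\<Pi>\<^sub>E U\<in>\<N>. carrier (group_algebra K (G Mod U)))"
      using S_component[OF a] S_component[OF b]
      by (intro PiE_I) (simp_all only: S_apply(1) S_ext(1) not_False_eq_True finite_group_algebra.A_closed(1)[OF fga])
    fix U V C assume U: "U \<in> \<N>" and V: "V \<in> \<N>" and UV: "U \<subseteq> V" and C: "C \<in> carrier (G Mod V)"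
    show "(a \<otimes>\<^bsub>S\<^esub> b) V C = (\<Oplus>\<^bsub>K\<^esub>D\<in>{D \<in> carrier (G Mod U). V <#> D = C}. (a \<otimes>\<^bsub>S\<^esub> b) U D)"
      unfolding S_apply(1)[OF U] S_apply(1)[OF V]
      by (intro group_algebra_push_mult fga U V coset_map_hom UV C S_component S_compatible a b)
  qed
  show "a \<oplus>\<^bsub>S\<^esub> b \<in> carrier S"
    unfolding S_carrier_iff
  proof (intro conjI ballI impI)
    show "a \<oplus>\<^bsub>S\<^esub> b \<in> (\<Pi>\<^sub>E U\<in>\<N>. carrier (group_algebra K (G Mod U)))"
      using S_component[OF a] S_component[OF b]
      by (intro PiE_I) (simp_all only: S_apply(2) S_ext(2) not_False_eq_True finite_group_algebra.A_closed(2)[OF fga])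
    fix U V C assume U: "U \<in> \<N>" and V: "V \<in> \<N>" and UV: "U \<subseteq> V" and C: "C \<in> carrier (G Mod V)"
    interpret U: finite_group_algebra K "G Mod U" by (rule fga[OF U])
    interpret V: finite_group_algebra K "G Mod V" by (rule fga[OF V])
    let ?I = "{D \<in> carrier (G Mod U). V <#> D = C}"
    have "(\<Oplus>\<^bsub>K\<^esub>D\<in>?I. (a \<oplus>\<^bsub>S\<^esub> b) U D) = (\<Oplus>\<^bsub>K\<^esub>D\<in>?I. a U D \<oplus>\<^bsub>K\<^esub> b U D)"
      using S_coeff[OF a U] S_coeff[OF b U] by (intro K.finsum_cong') (auto simp: S_apply(2)[OF U] U.A_apply)
    also have "\<dots> = a V C \<oplus>\<^bsub>K\<^esub> b V C"
      unfolding S_compatible[OF a U V UV C] S_compatible[OF b U V UV C]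
      using S_coeff[OF a U] S_coeff[OF b U] by (intro K.finsum_addf) auto
    finally show "(a \<oplus>\<^bsub>S\<^esub> b) V C = (\<Oplus>\<^bsub>K\<^esub>D\<in>?I. (a \<oplus>\<^bsub>S\<^esub> b) U D)"
      using C by (simp add: S_apply(2)[OF V] V.A_apply)
  qed
qed

lemma S_zero_closed: "\<zero>\<^bsub>S\<^esub> \<in> carrier S"
  unfolding S_carrier_iff
proof (intro conjI ballI impI)
  show "\<zero>\<^bsub>S\<^esub> \<in> (\<Pi>\<^sub>E U\<in>\<N>. carrier (group_algebra K (G Mod U)))"
    by (rule PiE_I) (auto simp: S_apply S_ext intro!: finite_group_algebra.A_closed[OF fga])
  fix U V C assume U: "U \<in> \<N>" and V: "V \<in> \<N>" and UV: "U \<subseteq> V" and C: "C \<in> carrier (G Mod V)"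
  have "(\<Oplus>\<^bsub>K\<^esub>D\<in>{D \<in> carrier (G Mod U). V <#> D = C}. \<zero>\<^bsub>S\<^esub> U D) = \<zero>\<^bsub>K\<^esub>"
    by (rule K.add.finprod_one_eqI) (simp add: S_apply U finite_group_algebra.A_apply[OF fga[OF U]])
  then show "\<zero>\<^bsub>S\<^esub> V C = (\<Oplus>\<^bsub>K\<^esub>D\<in>{D \<in> carrier (G Mod U). V <#> D = C}. \<zero>\<^bsub>S\<^esub> U D)"
    using C by (simp add: S_apply V finite_group_algebra.A_apply[OF fga[OF V]])
qed

lemma S_one_closed: "\<one>\<^bsub>S\<^esub> \<in> carrier S"
  using cga_of_closed[of \<one>] by (simp add: cga_of_one)

lemma S_uminus_closed:
  assumes a: "a \<in> carrier S"
  shows "(\<lambda>U\<in>\<N>. \<lambda>C\<in>carrier (G Mod U). \<ominus>\<^bsub>K\<^esub> a U C) \<in> carrier S" (is "?n \<in> _")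
  unfolding S_carrier_iff
proof (intro conjI ballI impI)
  show "?n \<in> (\<Pi>\<^sub>E U\<in>\<N>. carrier (group_algebra K (G Mod U)))"
    using S_coeff[OF a] by (auto simp: group_algebra_def)
  fix U V C assume U: "U \<in> \<N>" and V: "V \<in> \<N>" and UV: "U \<subseteq> V" and C: "C \<in> carrier (G Mod V)"
  let ?I = "{D \<in> carrier (G Mod U). V <#> D = C}"
  have "(\<Oplus>\<^bsub>K\<^esub>D\<in>?I. ?n U D) = (\<Oplus>\<^bsub>K\<^esub>D\<in>?I. \<ominus>\<^bsub>K\<^esub> a U D)"
    using S_coeff[OF a U] U by (intro K.finsum_cong') auto
  also have "\<dots> = \<ominus>\<^bsub>K\<^esub> a V C"
    unfolding S_compatible[OF a U V UV C] using S_coeff[OF a U] by (intro K.finsum_minus) auto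
  finally show "?n V C = (\<Oplus>\<^bsub>K\<^esub>D\<in>?I. ?n U D)" using V C by simp
qed

lemma S_ring: "ring S"
proof (intro ringI abelian_groupI monoidI)
  note A = finite_group_algebra.A_ring[OF fga]
  fix a b c assume a: "a \<in> carrier S" and b: "b \<in> carrier S"
  show "a \<oplus>\<^bsub>S\<^esub> b \<in> carrier S" "a \<otimes>\<^bsub>S\<^esub> b \<in> carrier S" using a b by (auto intro: S_closed)
  show "a \<oplus>\<^bsub>S\<^esub> b = b \<oplus>\<^bsub>S\<^esub> a"
  proof (rule S_eqI)
    fix U assume U: "U \<in> \<N>"
    interpret A: ring "group_algebra K (G Mod U)" by (rule A[OF U])
    show "(a \<oplus>\<^bsub>S\<^esub> b) U = (b \<oplus>\<^bsub>S\<^esub> a) U" using S_component a b U by (simp add: S_apply A.a_comm)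
  qed (use a b in \<open>auto intro: S_closed\<close>)
  show "\<zero>\<^bsub>S\<^esub> \<oplus>\<^bsub>S\<^esub> a = a"
  proof (rule S_eqI)
    fix U assume U: "U \<in> \<N>"
    interpret A: ring "group_algebra K (G Mod U)" by (rule A[OF U])
    show "(\<zero>\<^bsub>S\<^esub> \<oplus>\<^bsub>S\<^esub> a) U = a U" using S_component a U by (simp add: S_apply)
  qed (use a in \<open>auto intro: S_closed S_zero_closed\<close>)
  show "\<one>\<^bsub>S\<^esub> \<otimes>\<^bsub>S\<^esub> a = a"
  proof (rule S_eqI)
    fix U assume U: "U \<in> \<N>"
    interpret A: ring "group_algebra K (G Mod U)" by (rule A[OF U])
    show "(\<one>\<^bsub>S\<^esub> \<otimes>\<^bsub>S\<^esub> a) U = a U" using S_component a U by (simp add: S_apply)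
  qed (use a in \<open>auto intro: S_closed S_one_closed\<close>)
  show "a \<otimes>\<^bsub>S\<^esub> \<one>\<^bsub>S\<^esub> = a"
  proof (rule S_eqI)
    fix U assume U: "U \<in> \<N>"
    interpret A: ring "group_algebra K (G Mod U)" by (rule A[OF U])
    show "(a \<otimes>\<^bsub>S\<^esub> \<one>\<^bsub>S\<^esub>) U = a U" using S_component a U by (simp add: S_apply)
  qed (use a in \<open>auto intro: S_closed S_one_closed\<close>)
  show "\<exists>b\<in>carrier S. b \<oplus>\<^bsub>S\<^esub> a = \<zero>\<^bsub>S\<^esub>"
  proof
    let ?n = "\<lambda>U\<in>\<N>. \<lambda>C\<in>carrier (G Mod U). \<ominus>\<^bsub>K\<^esub> a U C"
    show n: "?n \<in> carrier S" by (rule S_uminus_closed[OF a])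
    show "?n \<oplus>\<^bsub>S\<^esub> a = \<zero>\<^bsub>S\<^esub>"
    proof (rule S_eqI)
      fix U assume U: "U \<in> \<N>"
      show "(?n \<oplus>\<^bsub>S\<^esub> a) U = \<zero>\<^bsub>S\<^esub> U"
        using S_coeff[OF a U] U by (auto simp: S_apply group_algebra_def fun_eq_iff K.l_neg)
    qed (use a n in \<open>auto intro: S_closed S_zero_closed\<close>)
  qed
  assume c: "c \<in> carrier S"
  have all: "(a \<oplus>\<^bsub>S\<^esub> b \<oplus>\<^bsub>S\<^esub> c) U = (a \<oplus>\<^bsub>S\<^esub> (b \<oplus>\<^bsub>S\<^esub> c)) U"
    "(a \<otimes>\<^bsub>S\<^esub> b \<otimes>\<^bsub>S\<^esub> c) U = (a \<otimes>\<^bsub>S\<^esub> (b \<otimes>\<^bsub>S\<^esub> c)) U"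
    "((a \<oplus>\<^bsub>S\<^esub> b) \<otimes>\<^bsub>S\<^esub> c) U = (a \<otimes>\<^bsub>S\<^esub> c \<oplus>\<^bsub>S\<^esub> (b \<otimes>\<^bsub>S\<^esub> c)) U"
    "(c \<otimes>\<^bsub>S\<^esub> (a \<oplus>\<^bsub>S\<^esub> b)) U = (c \<otimes>\<^bsub>S\<^esub> a \<oplus>\<^bsub>S\<^esub> (c \<otimes>\<^bsub>S\<^esub> b)) U" if U: "U \<in> \<N>" for U
  proof -
    interpret A: ring "group_algebra K (G Mod U)" by (rule A[OF U])
    show "(a \<oplus>\<^bsub>S\<^esub> b \<oplus>\<^bsub>S\<^esub> c) U = (a \<oplus>\<^bsub>S\<^esub> (b \<oplus>\<^bsub>S\<^esub> c)) U"
      "(a \<otimes>\<^bsub>S\<^esub> b \<otimes>\<^bsub>S\<^esub> c) U = (a \<otimes>\<^bsub>S\<^esub> (b \<otimes>\<^bsub>S\<^esub> c)) U"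
      "((a \<oplus>\<^bsub>S\<^esub> b) \<otimes>\<^bsub>S\<^esub> c) U = (a \<otimes>\<^bsub>S\<^esub> c \<oplus>\<^bsub>S\<^esub> (b \<otimes>\<^bsub>S\<^esub> c)) U"
      "(c \<otimes>\<^bsub>S\<^esub> (a \<oplus>\<^bsub>S\<^esub> b)) U = (c \<otimes>\<^bsub>S\<^esub> a \<oplus>\<^bsub>S\<^esub> (c \<otimes>\<^bsub>S\<^esub> b)) U"
      using S_component[OF a U] S_component[OF b U] S_component[OF c U] U
      by (simp_all add: S_apply A.a_assoc A.m_assoc A.l_distr A.r_distr)
  qed
  show "a \<oplus>\<^bsub>S\<^esub> b \<oplus>\<^bsub>S\<^esub> c = a \<oplus>\<^bsub>S\<^esub> (b \<oplus>\<^bsub>S\<^esub> c)"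
    "a \<otimes>\<^bsub>S\<^esub> b \<otimes>\<^bsub>S\<^esub> c = a \<otimes>\<^bsub>S\<^esub> (b \<otimes>\<^bsub>S\<^esub> c)"
    "(a \<oplus>\<^bsub>S\<^esub> b) \<otimes>\<^bsub>S\<^esub> c = a \<otimes>\<^bsub>S\<^esub> c \<oplus>\<^bsub>S\<^esub> (b \<otimes>\<^bsub>S\<^esub> c)"
    "c \<otimes>\<^bsub>S\<^esub> (a \<oplus>\<^bsub>S\<^esub> b) = c \<otimes>\<^bsub>S\<^esub> a \<oplus>\<^bsub>S\<^esub> (c \<otimes>\<^bsub>S\<^esub> b)"
    using a b c by (auto intro!: S_eqI S_closed all)
qed (auto intro: S_zero_closed S_one_closed)

sublocale S: ring S by (rule S_ring)

lemma S_minus_apply: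
  assumes "a \<in> carrier S" "b \<in> carrier S" "U \<in> \<N>" "C \<in> carrier (G Mod U)"
  shows "(a \<ominus>\<^bsub>S\<^esub> b) U C = a U C \<ominus>\<^bsub>K\<^esub> b U C"
proof -
  interpret A: finite_group_algebra K "G Mod U" by (rule fga[OF assms(3)])
  have m: "a \<ominus>\<^bsub>S\<^esub> b \<in> carrier S" using assms by simp
  have "a = (a \<ominus>\<^bsub>S\<^esub> b) \<oplus>\<^bsub>S\<^esub> b" using assms by (simp add: a_minus_def S.a_assoc S.l_neg)
  then have "a U C = (a \<ominus>\<^bsub>S\<^esub> b) U C \<oplus>\<^bsub>K\<^esub> b U C"
    using assms by (metis A.A_apply(2) S_apply(2))
  then show ?thesis
    using S_coeff[OF m assms(3,4)] S_coeff[OF assms(2-4)]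
    by (simp add: a_minus_def K.a_assoc K.r_neg)
qed

lemma carrier_in_\<N>: "carrier G \<in> \<N>"
proof -
  have "carrier G \<lhd> G"
    by (rule G.normal_invI) (auto intro: G.subgroup_self)
  then show ?thesis using carrier_open by (simp add: open_normals_def)
qed

lemma Mod_carrier: "carrier (G Mod carrier G) = {carrier G}"
proof -
  have "carrier G #> x = carrier G" if "x \<in> carrier G" for x
    using that by (intro G.coset_join2 G.subgroup_self)
  then show ?thesis using G.one_closed by (auto simp: FactGroup_def RCOSETS_def)
qed

section \<open>The augmentation ideal and its powers\<close>

abbreviation I where "I \<equiv> augmentation_ideal K G T"

text \<open>The group algebra of the trivial quotient is K itself, and the operations of the inverse
  limit are componentwise.\<close>

lemma augmentation_hom: "(\<lambda>a. a (carrier G) (carrier G)) \<in> ring_hom S K"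
proof -
  let ?Q = "G Mod carrier G"
  interpret A: finite_group_algebra K ?Q by (rule fga[OF carrier_in_\<N>])
  have c: "carrier G \<in> carrier ?Q" by (simp add: Mod_carrier)
  have inv: "inv\<^bsub>?Q\<^esub> carrier G \<otimes>\<^bsub>?Q\<^esub> carrier G = carrier G"
    using A.H.l_inv[OF c] by simp
  note val = S_coeff[OF _ carrier_in_\<N> c]
  show ?thesis
  proof (rule ring_hom_memI)
    fix a b assume a: "a \<in> carrier S" and b: "b \<in> carrier S"
    show "a (carrier G) (carrier G) \<in> carrier K" by (rule val[OF a])
    show "(a \<oplus>\<^bsub>S\<^esub> b) (carrier G) (carrier G) = a (carrier G) (carrier G) \<oplus>\<^bsub>K\<^esub> b (carrier G) (carrier G)"
      by (simp only: S_apply(2)[OF carrier_in_\<N>] A.A_apply(2)[OF c])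
    have "(a \<otimes>\<^bsub>S\<^esub> b) (carrier G) (carrier G) =
      (\<Oplus>\<^bsub>K\<^esub>y\<in>carrier ?Q. a (carrier G) y \<otimes>\<^bsub>K\<^esub> b (carrier G) (inv\<^bsub>?Q\<^esub> y \<otimes>\<^bsub>?Q\<^esub> carrier G))"
      by (simp only: S_apply(1)[OF carrier_in_\<N>] A.A_apply(1)[OF c])
    also have "\<dots> = a (carrier G) (carrier G) \<otimes>\<^bsub>K\<^esub> b (carrier G) (inv\<^bsub>?Q\<^esub> carrier G \<otimes>\<^bsub>?Q\<^esub> carrier G)"
      using val[OF a] val[OF b] inv by (intro K.finsum_eq_single) (auto simp: Mod_carrier)
    finally show "(a \<otimes>\<^bsub>S\<^esub> b) (carrier G) (carrier G) = a (carrier G) (carrier G) \<otimes>\<^bsub>K\<^esub> b (carrier G) (carrier G)"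
      by (simp only: inv)
  next
    show "\<one>\<^bsub>S\<^esub> (carrier G) (carrier G) = \<one>\<^bsub>K\<^esub>"
      by (simp add: S_apply(4)[OF carrier_in_\<N>] A.A_apply(4)[OF c])
  qed
qed

lemma augmentation_ideal_ideal: "ideal I S"
proof -
  interpret \<epsilon>: ring_hom_ring S K "\<lambda>a. a (carrier G) (carrier G)"
    by (rule ring_hom_ringI2[OF S.ring_axioms K.ring_axioms augmentation_hom])
  have "I = a_kernel S K (\<lambda>a. a (carrier G) (carrier G))"
    unfolding augmentation_ideal_def a_kernel_def' ..
  then show ?thesis using \<epsilon>.kernel_is_ideal by (simp only:)
qed

lemma ideal_pow_ideal: "ideal (ideal_pow S I k) S"
  by (induction k) (auto intro: S.oneideal S.ideal_prod_is_ideal augmentation_ideal_ideal)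

text \<open>The powers are built by multiplying by I on the right; the term (g - 1)(x - 1) of a
  commutator needs multiplication on the left as well.\<close>

lemma ideal_prod_pow_commute: "ideal_prod S I (ideal_pow S I k) \<subseteq> ideal_pow S I (Suc k)"
proof (induction k)
  case 0
  have "I \<subseteq> ideal_prod S (carrier S) I"
  proof
    fix i assume i: "i \<in> I"
    then have "\<one>\<^bsub>S\<^esub> \<otimes>\<^bsub>S\<^esub> i \<in> ideal_prod S (carrier S) I" by (intro ideal_prod.prod) auto
    moreover have "i \<in> carrier S" using i by (simp add: augmentation_ideal_def)
    ultimately show "i \<in> ideal_prod S (carrier S) I" by simp
  qed
  then show ?case using S.ideal_prod_one[OF augmentation_ideal_ideal] by simp
next
  case (Suc k)
  have mono: "ideal_prod S A B \<subseteq> ideal_prod S A' B" if "A \<subseteq> A'" for A A' B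
  proof
    fix z assume "z \<in> ideal_prod S A B"
    then show "z \<in> ideal_prod S A' B"
      by (induction rule: ideal_prod.induct) (use that in \<open>auto intro: ideal_prod.intros\<close>)
  qed
  have "ideal_prod S I (ideal_pow S I (Suc k)) = ideal_prod S (ideal_prod S I (ideal_pow S I k)) I"
    using S.ideal_prod_assoc[OF augmentation_ideal_ideal ideal_pow_ideal augmentation_ideal_ideal] by simp
  also have "\<dots> \<subseteq> ideal_prod S (ideal_pow S I (Suc k)) I" by (rule mono[OF Suc])
  finally show ?case by simp
qed

lemma cga_of_minus_one_in_I: "x \<in> carrier G \<Longrightarrow> cga_of K G T x \<ominus>\<^bsub>S\<^esub> \<one>\<^bsub>S\<^esub> \<in> I"
  using cga_of_closed
  by (simp add: augmentation_ideal_def S_minus_apply[unfolded a_minus_def] carrier_in_\<N> Mod_carrier cga_of_one[symmetric] cga_of_apply a_minus_def K.r_neg)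

text \<open>\<open>[x,g] - 1 = x\<^sup>-\<^sup>1 g\<^sup>-\<^sup>1 ((x - 1)(g - 1) - (g - 1)(x - 1))\<close>.\<close>

lemma commutator_ideal_pow:
  assumes x: "x \<in> carrier G" and g: "g \<in> carrier G"
    and k: "cga_of K G T x \<ominus>\<^bsub>S\<^esub> \<one>\<^bsub>S\<^esub> \<in> ideal_pow S I k"
  shows "cga_of K G T (commutator G x g) \<ominus>\<^bsub>S\<^esub> \<one>\<^bsub>S\<^esub> \<in> ideal_pow S I (Suc k)"
proof -
  let ?c = "cga_of K G T"
  define X where "X = ?c x" define Y where "Y = ?c g"
  \<comment> \<open>The commutator is Z X Y, and 1 is Z Y X. Subtracting 1 from X and from Y leaves
    X Y - Y X unchanged.\<close>
  define Z where "Z = ?c (inv x \<otimes> inv g)"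
  have XY: "X \<in> carrier S" "Y \<in> carrier S" "Z \<in> carrier S"
    using x g by (auto simp: X_def Y_def Z_def cga_of_closed)
  have "Z \<otimes>\<^bsub>S\<^esub> (Y \<otimes>\<^bsub>S\<^esub> X) = ?c ((inv x \<otimes> inv g) \<otimes> (g \<otimes> x))"
    using x g by (simp add: X_def Y_def Z_def cga_of_mult)
  also have "(inv x \<otimes> inv g) \<otimes> (g \<otimes> x) = \<one>"
    using x g by (metis G.inv_mult_group G.l_inv G.m_closed)
  finally have ZYX: "Z \<otimes>\<^bsub>S\<^esub> (Y \<otimes>\<^bsub>S\<^esub> X) = \<one>\<^bsub>S\<^esub>" by (simp add: cga_of_one)
  have ZXY: "?c (commutator G x g) = Z \<otimes>\<^bsub>S\<^esub> (X \<otimes>\<^bsub>S\<^esub> Y)"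
    using x g by (simp add: X_def Y_def Z_def cga_of_mult[symmetric] commutator_def G.m_assoc)
  let ?x = "X \<ominus>\<^bsub>S\<^esub> \<one>\<^bsub>S\<^esub>" and ?y = "Y \<ominus>\<^bsub>S\<^esub> \<one>\<^bsub>S\<^esub>"
  interpret J: ideal "ideal_pow S I (Suc k)" S by (rule ideal_pow_ideal)
  have "?y \<in> I" using cga_of_minus_one_in_I[OF g] by (simp add: Y_def)
  moreover have "?x \<in> ideal_pow S I k" using k by (simp add: X_def)
  ultimately have "?x \<otimes>\<^bsub>S\<^esub> ?y \<in> ideal_pow S I (Suc k)" "?y \<otimes>\<^bsub>S\<^esub> ?x \<in> ideal_pow S I (Suc k)"
    using ideal_prod.prod[of ?y I ?x "ideal_pow S I k" S] ideal_prod_pow_commute[of k]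
    by (auto intro: ideal_prod.prod)
  then have "Z \<otimes>\<^bsub>S\<^esub> (?x \<otimes>\<^bsub>S\<^esub> ?y \<ominus>\<^bsub>S\<^esub> ?y \<otimes>\<^bsub>S\<^esub> ?x) \<in> ideal_pow S I (Suc k)"
    using XY(3) J.a_closed J.a_inv_closed unfolding a_minus_def by (intro J.I_l_closed) blast+
  also have "?x \<otimes>\<^bsub>S\<^esub> ?y \<ominus>\<^bsub>S\<^esub> ?y \<otimes>\<^bsub>S\<^esub> ?x = X \<otimes>\<^bsub>S\<^esub> Y \<ominus>\<^bsub>S\<^esub> Y \<otimes>\<^bsub>S\<^esub> X"
    using XY by algebra (simp, algebra)
  also have "Z \<otimes>\<^bsub>S\<^esub> \<dots> = ?c (commutator G x g) \<ominus>\<^bsub>S\<^esub> \<one>\<^bsub>S\<^esub>"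
    using XY by (simp add: ZXY ZYX[symmetric] a_minus_def S.r_distr S.r_minus)
  finally show ?thesis .
qed

end


section \<open>Weights of group elements\<close>

context cga_group begin

text \<open>The functional \<open>L a = \<Sum>C. a U C \<phi>(C)\<close>, with \<open>U\<close> the kernel of \<open>\<phi>\<close>, satisfies
  \<open>L (a b) = L a \<epsilon>(b) + \<epsilon>(a) L b\<close> and hence vanishes on \<open>I\<^sup>2\<close>.\<close>

lemma ideal_pow_Suc_Suc_vanish:
  assumes K: "cring K" and \<phi>: "\<phi> \<in> hom G (add_monoid K)"
    and op: "openin T {y \<in> carrier G. \<phi> y = \<zero>\<^bsub>K\<^esub>}"
    and x: "x \<in> carrier G" and z: "cga_of K G T x \<ominus>\<^bsub>S\<^esub> \<one>\<^bsub>S\<^esub> \<in> ideal_pow S I (Suc (Suc k))"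
  shows "\<phi> x = \<zero>\<^bsub>K\<^esub>"
proof -
  interpret K: cring K by fact
  interpret \<phi>: group_hom G "add_monoid K" \<phi>
    using \<phi> K.a_group by (intro group_hom.intro group_hom_axioms.intro G.group_axioms)
  have \<phi>c: "\<phi> y \<in> carrier K" if "y \<in> carrier G" for y using \<phi>.hom_closed[OF that] by simp
  have \<phi>m: "\<phi> (y \<otimes> z) = \<phi> y \<oplus>\<^bsub>K\<^esub> \<phi> z" if "y \<in> carrier G" "z \<in> carrier G" for y z
    using \<phi>.hom_mult[OF that] by simp
  define U where "U = {y \<in> carrier G. \<phi> y = \<zero>\<^bsub>K\<^esub>}"
  have "U = kernel G (add_monoid K) \<phi>" by (simp add: U_def kernel_def)
  then have U: "U \<in> \<N>" using \<phi>.normal_kernel op by (simp add: open_normals_def U_def)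
  interpret U: normal U G by (rule \<N>_normal[OF U])
  interpret Q: finite_group_algebra K "G Mod U" by (rule fga[OF U])
  \<comment> \<open>\<phi> read on cosets; the choice of the representative is immaterial because
    \<phi> vanishes on U.\<close>
  define \<psi> where "\<psi> C = \<phi> (SOME y. y \<in> C)" for C
  have \<psi>: "\<psi> (U #> y) = \<phi> y" if y: "y \<in> carrier G" for y
  proof -
    define s where "s = (SOME z. z \<in> U #> y)"
    have "s \<in> U #> y" unfolding s_def using G.rcos_self[OF y U.is_subgroup] by (rule someI)
    then obtain u where u: "u \<in> U" "s = u \<otimes> y" unfolding r_coset_def by blast
    have "u \<in> carrier G" "\<phi> u = \<zero>\<^bsub>K\<^esub>" using u(1) unfolding U_def by blast+
    then show ?thesis unfolding \<psi>_def s_def[symmetric] u(2) using \<phi>m[OF _ y] \<phi>c[OF y] K.l_zero by metis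
  qed
  have \<psi>c: "\<psi> C \<in> carrier K" if "C \<in> carrier (G Mod U)" for C
    using that \<psi> \<phi>c by (auto elim!: rcosetsE)
  have \<psi>m: "\<psi> (C \<otimes>\<^bsub>G Mod U\<^esub> D) = \<psi> C \<oplus>\<^bsub>K\<^esub> \<psi> D" if "C \<in> carrier (G Mod U)" "D \<in> carrier (G Mod U)" for C D
    using that by (auto elim!: rcosetsE simp: U.rcos_sum \<psi> \<phi>m)
  define L where "L a = (\<Oplus>\<^bsub>K\<^esub>C\<in>carrier (G Mod U). a U C \<otimes>\<^bsub>K\<^esub> \<psi> C)" for a
  note c = S_coeff[OF _ U]
  have Lc: "L a \<in> carrier K" if "a \<in> carrier S" for a
    unfolding L_def using c[OF that] \<psi>c by (intro K.finsum_closed) auto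
  have Ladd: "L (a \<oplus>\<^bsub>S\<^esub> b) = L a \<oplus>\<^bsub>K\<^esub> L b" if a: "a \<in> carrier S" and b: "b \<in> carrier S" for a b
  proof -
    have "L (a \<oplus>\<^bsub>S\<^esub> b) = (\<Oplus>\<^bsub>K\<^esub>C\<in>carrier (G Mod U). a U C \<otimes>\<^bsub>K\<^esub> \<psi> C \<oplus>\<^bsub>K\<^esub> b U C \<otimes>\<^bsub>K\<^esub> \<psi> C)"
      unfolding L_def using c[OF a] c[OF b] \<psi>c
      by (intro K.finsum_cong') (auto simp: S_apply(2)[OF U] Q.A_apply(2) K.l_distr)
    also have "\<dots> = L a \<oplus>\<^bsub>K\<^esub> L b"
      unfolding L_def using c[OF a] c[OF b] \<psi>c by (intro K.finsum_addf) auto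
    finally show ?thesis .
  qed
  have aug: "(\<Oplus>\<^bsub>K\<^esub>C\<in>carrier (G Mod U). a U C) = \<zero>\<^bsub>K\<^esub>" if "a \<in> I" for a
  proof -
    have a: "a \<in> carrier S" and 0: "a (carrier G) (carrier G) = \<zero>\<^bsub>K\<^esub>" using that by (auto simp: augmentation_ideal_def)
    have UG: "U \<subseteq> carrier G" by (rule U.subset)
    have m: "carrier G \<in> carrier (G Mod carrier G)" by (simp add: Mod_carrier)
    have "carrier G <#> C = carrier G" if "C \<in> carrier (G Mod U)" for C
      using hom_in_carrier[OF coset_map_hom[OF U carrier_in_\<N> UG] that] by (simp add: Mod_carrier)
    then have "{C \<in> carrier (G Mod U). carrier G <#> C = carrier G} = carrier (G Mod U)" by blast
    then show ?thesis using S_compatible[OF a U carrier_in_\<N> UG m] 0 by simp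
  qed
  have Lmult: "L (a \<otimes>\<^bsub>S\<^esub> b) = \<zero>\<^bsub>K\<^esub>" if a: "a \<in> I" and b: "b \<in> I" for a b
  proof -
    have a': "a \<in> carrier S" and b': "b \<in> carrier S" using a b by (auto simp: augmentation_ideal_def)
    let ?Q = "carrier (G Mod U)" and ?m = "\<lambda>C D. C \<otimes>\<^bsub>G Mod U\<^esub> D" and ?i = "\<lambda>C. inv\<^bsub>G Mod U\<^esub> C"
    note cl = c[OF a'] c[OF b'] \<psi>c Q.H.m_closed Q.H.inv_closed
    have "L (a \<otimes>\<^bsub>S\<^esub> b) = (\<Oplus>\<^bsub>K\<^esub>C\<in>?Q. \<Oplus>\<^bsub>K\<^esub>D\<in>?Q. a U D \<otimes>\<^bsub>K\<^esub> b U (?m (?i D) C) \<otimes>\<^bsub>K\<^esub> \<psi> C)"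
      unfolding L_def using cl
      by (intro K.finsum_cong') (auto simp: S_apply(1)[OF U] Q.A_apply(1) K.finsum_ldistr Pi_iff simp del: mult_FactGroup intro!: K.finsum_closed)
    also have "\<dots> = (\<Oplus>\<^bsub>K\<^esub>D\<in>?Q. \<Oplus>\<^bsub>K\<^esub>C\<in>?Q. a U D \<otimes>\<^bsub>K\<^esub> b U (?m (?i D) C) \<otimes>\<^bsub>K\<^esub> \<psi> C)"
      using cl by (intro K.finsum_swap) (auto simp del: mult_FactGroup)
    also have "\<dots> = (\<Oplus>\<^bsub>K\<^esub>D\<in>?Q. a U D \<otimes>\<^bsub>K\<^esub> L b)"
    proof (intro K.finsum_cong' refl)
      fix D assume D: "D \<in> ?Q"
      have "(\<Oplus>\<^bsub>K\<^esub>C\<in>?Q. a U D \<otimes>\<^bsub>K\<^esub> b U (?m (?i D) C) \<otimes>\<^bsub>K\<^esub> \<psi> C) =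
        (\<Oplus>\<^bsub>K\<^esub>E\<in>?Q. a U D \<otimes>\<^bsub>K\<^esub> b U (?m (?i D) (?m D E)) \<otimes>\<^bsub>K\<^esub> \<psi> (?m D E))"
        using D cl by (intro Q.A_reindex[symmetric, of D "\<lambda>C. a U D \<otimes>\<^bsub>K\<^esub> b U (?m (?i D) C) \<otimes>\<^bsub>K\<^esub> \<psi> C"]) (auto simp del: mult_FactGroup)
      \<comment> \<open>Now \<psi>(D E) = \<psi>(D) + \<psi>(E) is split. The second part contains
        the sum of the coefficients of b, which is 0; the first leaves L b times the sum of the
        coefficients of a.\<close>
      also have "\<dots> = (\<Oplus>\<^bsub>K\<^esub>E\<in>?Q. a U D \<otimes>\<^bsub>K\<^esub> (b U E \<otimes>\<^bsub>K\<^esub> \<psi> E) \<oplus>\<^bsub>K\<^esub> a U D \<otimes>\<^bsub>K\<^esub> \<psi> D \<otimes>\<^bsub>K\<^esub> b U E)"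
      proof (intro K.finsum_cong' refl)
        fix E assume E: "E \<in> ?Q"
        have "?m (?i D) (?m D E) = E" using D E by (metis Q.H.inv_mult_eq_iff Q.H.m_closed)
        moreover have "a U D \<in> carrier K" "b U E \<in> carrier K" "\<psi> D \<in> carrier K" "\<psi> E \<in> carrier K" using D E cl by auto
        ultimately show "a U D \<otimes>\<^bsub>K\<^esub> b U (?m (?i D) (?m D E)) \<otimes>\<^bsub>K\<^esub> \<psi> (?m D E) =
          a U D \<otimes>\<^bsub>K\<^esub> (b U E \<otimes>\<^bsub>K\<^esub> \<psi> E) \<oplus>\<^bsub>K\<^esub> a U D \<otimes>\<^bsub>K\<^esub> \<psi> D \<otimes>\<^bsub>K\<^esub> b U E"
          by (simp only: \<psi>m[OF D E]) algebra
      qed (use D cl in auto)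
      also have "\<dots> = (\<Oplus>\<^bsub>K\<^esub>E\<in>?Q. a U D \<otimes>\<^bsub>K\<^esub> (b U E \<otimes>\<^bsub>K\<^esub> \<psi> E)) \<oplus>\<^bsub>K\<^esub> (\<Oplus>\<^bsub>K\<^esub>E\<in>?Q. a U D \<otimes>\<^bsub>K\<^esub> \<psi> D \<otimes>\<^bsub>K\<^esub> b U E)"
        using D cl by (intro K.finsum_addf) auto
      also have "(\<Oplus>\<^bsub>K\<^esub>E\<in>?Q. a U D \<otimes>\<^bsub>K\<^esub> (b U E \<otimes>\<^bsub>K\<^esub> \<psi> E)) = a U D \<otimes>\<^bsub>K\<^esub> L b"
        unfolding L_def using D cl by (intro K.finsum_rdistr[symmetric]) auto
      also have "(\<Oplus>\<^bsub>K\<^esub>E\<in>?Q. a U D \<otimes>\<^bsub>K\<^esub> \<psi> D \<otimes>\<^bsub>K\<^esub> b U E) = a U D \<otimes>\<^bsub>K\<^esub> \<psi> D \<otimes>\<^bsub>K\<^esub> (\<Oplus>\<^bsub>K\<^esub>E\<in>?Q. b U E)"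
        using D cl by (intro K.finsum_rdistr[symmetric]) auto
      finally show "(\<Oplus>\<^bsub>K\<^esub>C\<in>?Q. a U D \<otimes>\<^bsub>K\<^esub> b U (?m (?i D) C) \<otimes>\<^bsub>K\<^esub> \<psi> C) = a U D \<otimes>\<^bsub>K\<^esub> L b"
        using D cl Lc[OF b'] by (simp add: aug[OF b] del: mult_FactGroup)
    qed (use cl Lc[OF b'] in auto)
    also have "\<dots> = (\<Oplus>\<^bsub>K\<^esub>D\<in>?Q. a U D) \<otimes>\<^bsub>K\<^esub> L b"
      using cl Lc[OF b'] by (intro K.finsum_ldistr[symmetric]) auto
    finally show ?thesis using Lc[OF b'] by (simp add: aug[OF a])
  qed
  have Lpow: "L z = \<zero>\<^bsub>K\<^esub>" if "z \<in> ideal_pow S I (Suc (Suc k))" for z k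
  proof -
    \<comment> \<open>From the second power on, every generating product has its last factor in I
      and its first factor in a positive power of I, hence in I, so that \<open>Lmult\<close>
      applies.\<close>
    have sub: "ideal_pow S I (Suc k) \<subseteq> I"
      using S.ideal_prod_inter[OF ideal_pow_ideal augmentation_ideal_ideal] by auto
    have cl: "ideal_prod S (ideal_pow S I (Suc k)) I \<subseteq> carrier S"
      by (rule S.ideal_prod_in_carrier[OF ideal_pow_ideal augmentation_ideal_ideal])
    have "z \<in> ideal_prod S (ideal_pow S I (Suc k)) I" using that by simp
    then show ?thesis
    proof (induction rule: ideal_prod.induct)
      case (prod i j)
      then show ?case using sub by (intro Lmult) auto
    next
      case (sum s1 s2)
      then show ?case using cl Ladd[of s1 s2] by auto
    qed
  qed
  have Lof: "L (cga_of K G T y) = \<phi> y" if y: "y \<in> carrier G" for y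
  proof -
    have "L (cga_of K G T y) = cga_of K G T y U (U #> y) \<otimes>\<^bsub>K\<^esub> \<psi> (U #> y)"
      unfolding L_def using rcos_carrier[OF U y] \<psi>c
      by (intro K.finsum_eq_single) (auto simp: cga_of_apply[OF U] one_in_one_coset[OF _ U y])
    then show ?thesis
      using rcos_carrier[OF U y] y \<psi> \<phi>c by (simp add: cga_of_apply[OF U] one_in_one_coset[OF _ U y])
  qed
  have X: "cga_of K G T x \<in> carrier S" by (rule cga_of_closed[OF x])
  have "cga_of K G T x = (cga_of K G T x \<ominus>\<^bsub>S\<^esub> \<one>\<^bsub>S\<^esub>) \<oplus>\<^bsub>S\<^esub> cga_of K G T \<one>"
    using X by (simp add: cga_of_one a_minus_def S.a_assoc S.l_neg)
  then have "L (cga_of K G T x) = L (cga_of K G T x \<ominus>\<^bsub>S\<^esub> \<one>\<^bsub>S\<^esub>) \<oplus>\<^bsub>K\<^esub> L (cga_of K G T \<one>)"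
    using Ladd[of "cga_of K G T x \<ominus>\<^bsub>S\<^esub> \<one>\<^bsub>S\<^esub>" "cga_of K G T \<one>"] X cga_of_closed by simp
  then show ?thesis using Lof x Lpow[OF z] \<phi>.hom_one by simp
qed

end

lemma residue_field:
  assumes "prime p" shows "field (residue_ring (int p))"
proof -
  interpret residues_prime p "residue_ring (int p)"
    using assms by unfold_locales (auto simp: prime_gt_Suc_0_nat)
  show ?thesis by (rule is_field)
qed

definition I_adic_exponents where
  "I_adic_exponents p G T y = {k. cga_of (residue_ring (int p)) G T y
      \<ominus>\<^bsub>completed_group_algebra (residue_ring (int p)) G T\<^esub> \<one>\<^bsub>completed_group_algebra (residue_ring (int p)) G T\<^esub>
    \<in> ideal_pow (completed_group_algebra (residue_ring (int p)) G T) (augmentation_ideal (residue_ring (int p)) G T) k}"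

text \<open>An infinite set of exponents makes \<open>cga_w\<close> equal to 0, and
  \<open>log\<close> of 0 is 0 in HOL, so the weight is then 0 as well. A positive weight therefore
  guarantees that the set is finite.\<close>

lemma grp_weight_eq:
  assumes "prime p"
  shows "grp_weight p G T y = (if finite (I_adic_exponents p G T y) then Sup (I_adic_exponents p G T y) else 0)"
proof -
  have "1 < real p" using prime_gt_1_nat[OF assms] by simp
  moreover have "log (real p) 0 = 0" by (simp add: log_def)
  ultimately show ?thesis unfolding grp_weight_def cga_w_def Let_def I_adic_exponents_def by auto
qed

locale residue_cga = cga_group "residue_ring (int p)" G T for p :: nat and G :: "'g monoid" (structure) and T :: "'g topology" +
  assumes prime: "prime p"
begin

text \<open>The positivity assumptions exclude the default value of an infinite supremum. Both
  weights are then maxima, and \<open>commutator_ideal_pow\<close> raises the exponent attained at x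
  by one.\<close>

lemma grp_weight_commutator:
  assumes x: "x \<in> carrier G" "g \<in> carrier G"
    and w: "0 < grp_weight p G T x" "0 < grp_weight p G T (commutator G x g)"
  shows "grp_weight p G T x < grp_weight p G T (commutator G x g)"
proof -
  let ?E = "I_adic_exponents p G T"
  have fin: "finite (?E x)" "finite (?E (commutator G x g))"
    using w by (auto simp: grp_weight_eq[OF prime] split: if_splits)
  have "0 \<in> ?E x" using x by (simp add: I_adic_exponents_def cga_of_closed)
  then have ne: "?E x \<noteq> {}" by auto
  then have "Sup (?E x) \<in> ?E x" using fin by (metis Max_in cSup_eq_Max)
  then have "Suc (Sup (?E x)) \<in> ?E (commutator G x g)"
    unfolding I_adic_exponents_def using commutator_ideal_pow[OF x] by blast
  then have "Suc (Sup (?E x)) \<le> Sup (?E (commutator G x g))"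
    using fin by (metis Max_ge cSup_eq_Max empty_iff)
  then show ?thesis using fin by (simp add: grp_weight_eq[OF prime])
qed

text \<open>A character that does not vanish at x keeps x - 1 out of all powers of the augmentation
  ideal from the second on, so 0 and 1 are the only possible exponents.\<close>

lemma grp_weight_le_one:
  assumes \<phi>: "\<phi> \<in> hom G (add_monoid (residue_ring (int p)))"
    and op: "openin T {y \<in> carrier G. \<phi> y = 0}"
    and x: "x \<in> carrier G" "\<phi> x \<noteq> 0"
  shows "grp_weight p G T x \<le> 1"
proof -
  have z: "\<zero>\<^bsub>residue_ring (int p)\<^esub> = 0" by (simp add: residue_ring_def)
  have "cring (residue_ring (int p))" using residue_field[OF prime] by (simp add: field_def domain_def)
  from ideal_pow_Suc_Suc_vanish[OF this \<phi>, unfolded z, OF op x(1)] x(2)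
  have "k \<le> 1" if "k \<in> I_adic_exponents p G T x" for k
    using that unfolding I_adic_exponents_def
    by (metis (mono_tags, lifting) One_nat_def le_SucI le_zero_eq mem_Collect_eq not0_implies_Suc not_less_eq_eq)
  then have "Sup (I_adic_exponents p G T x) \<le> 1"
    by (metis bot_nat_0.extremum cSup_least Sup_nat_empty)
  then show ?thesis by (simp add: grp_weight_eq[OF prime])
qed

end


section \<open>Topological groups\<close>

lemma topological_group_translations:
  assumes G: "topological_group G T" and a: "a \<in> carrier G"
  shows "continuous_map T T (\<lambda>x. x \<otimes>\<^bsub>G\<^esub> a)" "continuous_map T T (\<lambda>x. a \<otimes>\<^bsub>G\<^esub> x)"
proof -
  have top: "topspace T = carrier G" and m: "continuous_map (prod_topology T T) T (\<lambda>(x, y). x \<otimes>\<^bsub>G\<^esub> y)"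
    using G by (simp_all add: topological_group_def)
  have "continuous_map T (prod_topology T T) (\<lambda>x. (x, a))" "continuous_map T (prod_topology T T) (\<lambda>x. (a, x))"
    using a top by (auto intro!: continuous_map_pairedI)
  from this[THEN continuous_map_compose[OF _ m]]
  show "continuous_map T T (\<lambda>x. x \<otimes>\<^bsub>G\<^esub> a)" "continuous_map T T (\<lambda>x. a \<otimes>\<^bsub>G\<^esub> x)"
    by (simp_all add: comp_def)
qed

lemma topological_group_conj:
  assumes G: "topological_group G T" and a: "a \<in> carrier G"
  shows "continuous_map T T (\<lambda>x. inv\<^bsub>G\<^esub> a \<otimes>\<^bsub>G\<^esub> x \<otimes>\<^bsub>G\<^esub> a)"
proof -
  have "inv\<^bsub>G\<^esub> a \<in> carrier G" using G a by (simp add: topological_group_def)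
  from continuous_map_compose[OF topological_group_translations(2)[OF G this] topological_group_translations(1)[OF G a]]
  show ?thesis by (simp add: comp_def)
qed

lemma openin_rcos:
  fixes G :: "'g monoid" (structure)
  assumes G: "topological_group G T" and U: "openin T U" "U \<subseteq> carrier G" and a: "a \<in> carrier G"
  shows "openin T (U #>\<^bsub>G\<^esub> a)"
proof -
  interpret group G using G by (simp add: topological_group_def)
  have top: "topspace T = carrier G" using G by (simp add: topological_group_def)
  have "openin T {x \<in> topspace T. x \<otimes> inv a \<in> U}"
    using topological_group_translations(1)[OF G inv_closed[OF a]] U(1) by (rule openin_continuous_map_preimage)
  also have "{x \<in> topspace T. x \<otimes> inv a \<in> U} = U #> a"
  proof
    show "{x \<in> topspace T. x \<otimes> inv a \<in> U} \<subseteq> U #> a"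
    proof
      fix x assume "x \<in> {x \<in> topspace T. x \<otimes> inv a \<in> U}"
      then have "x \<otimes> inv a \<in> U" "x = x \<otimes> inv a \<otimes> a" using a top by (auto simp: m_assoc)
      then show "x \<in> U #> a" unfolding r_coset_def by blast
    qed
    show "U #> a \<subseteq> {x \<in> topspace T. x \<otimes> inv a \<in> U}"
      using a U(2) top by (auto simp: r_coset_def m_assoc subset_iff)
  qed
  finally show ?thesis .
qed

text \<open>The cosets are pairwise disjoint nonempty open sets that cover the group, so a finite
  subcover must contain every one of them.\<close>

lemma open_normal_finite_index:
  fixes G :: "'g monoid" (structure)
  assumes G: "topological_group G T" and "compact_space T" and U: "U \<in> open_normals G T"
  shows "finite (carrier (G Mod U))"
proof -
  interpret group G using G by (simp add: topological_group_def)
  have top: "topspace T = carrier G" using G by (simp add: topological_group_def)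
  interpret U: normal U G using U by (simp add: open_normals_def)
  have Uo: "openin T U" using U by (simp add: open_normals_def)
  have "openin T C" if "C \<in> rcosets U" for C
    using that openin_rcos[OF G Uo U.subset] by (auto simp: RCOSETS_def)
  moreover have "topspace T \<subseteq> \<Union>(rcosets U)"
    using rcosets_part_G[OF U.is_subgroup] top by simp
  ultimately obtain \<F> where \<F>: "finite \<F>" "\<F> \<subseteq> rcosets U" "topspace T \<subseteq> \<Union>\<F>"
    using \<open>compact_space T\<close> unfolding compact_space_def compactin_def by metis
  have "rcosets U \<subseteq> \<F>"
  proof
    fix C assume C: "C \<in> rcosets U"
    then obtain x where x: "x \<in> carrier G" "C = U #> x" by (auto simp: RCOSETS_def)
    then obtain D where "D \<in> \<F>" "x \<in> D" using \<F>(3) top by auto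
    then show "C \<in> \<F>" using U.rcos_eq_iff[OF x(1)] \<F>(2) x by auto
  qed
  then show ?thesis using \<F>(1) by (simp add: FactGroup_def finite_subset)
qed

lemma cga_group_compact:
  assumes K: "plain_ring K" and G: "topological_group G T" and "compact_space T"
  shows "cga_group K G T"
proof -
  have top: "topspace T = carrier G" and "group G" using G by (simp_all add: topological_group_def)
  then show ?thesis
    using K open_normal_finite_index[OF assms(2,3)] openin_topspace[of T]
    by (simp add: cga_group_def cga_group_axioms_def)
qed

text \<open>The component at U is constant on the cosets of U, which are open.\<close>

lemma cga_of_continuous:
  fixes G :: "'g monoid" (structure)
  assumes "cga_group K G T" and G: "topological_group G T"
  shows "continuous_map T (cga_topology K G T) (cga_of K G T)"
proof -
  interpret cga_group K G T by fact
  have top: "topspace T = carrier G" using G by (simp add: topological_group_def)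
  have "continuous_map T (discrete_topology (carrier (group_algebra K (G Mod U)))) (\<lambda>x. cga_of K G T x U)"
    if U: "U \<in> \<N>" for U
    unfolding continuous_map top
  proof (intro conjI allI impI)
    show "(\<lambda>x. cga_of K G T x U) ` carrier G \<subseteq> topspace (discrete_topology (carrier (group_algebra K (G Mod U))))"
      using S_component[OF cga_of_closed U] by auto
    fix V
    let ?P = "{x \<in> carrier G. cga_of K G T x U \<in> V}"
    interpret U: normal U G by (rule \<N>_normal[OF U])
    show "openin T ?P"
    proof (subst openin_subopen, intro ballI)
      fix x assume x: "x \<in> ?P"
      have const: "cga_of K G T y U = cga_of K G T x U" if y: "y \<in> U #> x" for y
      proof -
        have yG: "y \<in> carrier G" using y x U.subset by (auto simp: r_coset_def)
        have "U #> x = U #> y" using G.repr_independence[OF y] x U.is_subgroup by blast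
        then show ?thesis
          using x yG U by (auto simp: cga_of_def one_in_one_coset)
      qed
      have sub: "U #> x \<subseteq> carrier G" using x U.subset by (auto simp: r_coset_def)
      have "U #> x \<subseteq> ?P"
      proof
        fix y assume y: "y \<in> U #> x"
        then show "y \<in> ?P" using x sub const[OF y] by auto
      qed
      moreover have "x \<in> U #> x" using x G.rcos_self[OF _ U.is_subgroup] by blast
      moreover have "openin T (U #> x)"
        using openin_rcos[OF G] U x U.subset by (auto simp: open_normals_def)
      ultimately show "\<exists>W. openin T W \<and> x \<in> W \<and> W \<subseteq> ?P" by blast
    qed
  qed
  then show ?thesis
    unfolding cga_topology_def continuous_map_in_subtopology continuous_map_componentwise
    using cga_of_closed top by (auto simp: cga_of_def)
qed

lemma closed_normal_closure_normal:
  fixes G :: "'g monoid" (structure)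
  assumes G: "topological_group G T" and X: "X \<subseteq> carrier G"
  shows "closed_normal_closure G T X \<lhd> G" "closedin T (closed_normal_closure G T X)"
    "X \<subseteq> closed_normal_closure G T X"
proof -
  interpret group G using G by (simp add: topological_group_def)
  have "carrier G \<lhd> G" by (rule normal_invI) (auto intro: subgroup_self)
  moreover have "closedin T (carrier G)" using G closedin_topspace[of T] by (simp add: topological_group_def)
  \<comment> \<open>The whole group belongs to the family. Over an empty family the intersection
    would be the whole type, which need not be closed.\<close>
  ultimately have ne: "{H. H \<lhd> G \<and> closedin T H \<and> X \<subseteq> H} \<noteq> {}" using X by blast
  then show "closedin T (closed_normal_closure G T X)" unfolding closed_normal_closure_def by (intro closedin_Inter) auto
  show "closed_normal_closure G T X \<lhd> G"
    unfolding closed_normal_closure_def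
  proof (rule normal_invI)
    show "subgroup (\<Inter>{H. H \<lhd> G \<and> closedin T H \<and> X \<subseteq> H}) G"
      using ne by (intro subgroups_Inter) (auto intro: normal_imp_subgroup)
    show "\<And>x h. x \<in> carrier G \<Longrightarrow> h \<in> \<Inter>{H. H \<lhd> G \<and> closedin T H \<and> X \<subseteq> H} \<Longrightarrow>
        x \<otimes> h \<otimes> inv x \<in> \<Inter>{H. H \<lhd> G \<and> closedin T H \<and> X \<subseteq> H}"
      by (auto intro: normal.inv_op_closed2)
  qed
qed (auto simp: closed_normal_closure_def)

lemma closed_normal_closure_minimal:
  "H \<lhd> G \<Longrightarrow> closedin T H \<Longrightarrow> X \<subseteq> H \<Longrightarrow> closed_normal_closure G T X \<subseteq> H"
  by (auto simp: closed_normal_closure_def)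

lemma topological_group_subgroup:
  fixes G :: "'g monoid" (structure)
  assumes G: "topological_group G T" and H: "subgroup H G"
  shows "topological_group (G\<lparr>carrier := H\<rparr>) (subtopology T H)"
proof -
  interpret group G using G by (simp add: topological_group_def)
  interpret H: subgroup H G by fact
  have top: "topspace T = carrier G" and m: "continuous_map (prod_topology T T) T (\<lambda>(x, y). x \<otimes> y)"
    and i: "continuous_map T T (\<lambda>x. inv x)"
    using G by (simp_all add: topological_group_def)
  have gH: "group (G\<lparr>carrier := H\<rparr>)" by (rule subgroup.subgroup_is_group[OF H group_axioms])
  have "continuous_map (prod_topology (subtopology T H) (subtopology T H)) T (\<lambda>(x, y). x \<otimes> y)"
    unfolding prod_topology_subtopology(1) prod_topology_subtopology(2)
    using m by (intro continuous_map_from_subtopology)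
  moreover have "continuous_map (subtopology T H) (subtopology T H) (\<lambda>x. inv\<^bsub>G\<lparr>carrier := H\<rparr>\<^esub> x)"
  proof (rule continuous_map_eq)
    show "continuous_map (subtopology T H) (subtopology T H) (\<lambda>x. inv x)"
      using i by (auto simp: continuous_map_in_subtopology intro: continuous_map_from_subtopology)
    show "inv x = inv\<^bsub>G\<lparr>carrier := H\<rparr>\<^esub> x" if "x \<in> topspace (subtopology T H)" for x
      using that m_inv_consistent[OF H] by simp
  qed
  ultimately show ?thesis
    unfolding topological_group_def using gH top H.subset
    by (auto simp: continuous_map_in_subtopology)
qed

text \<open>If \<psi> were nonzero modulo p at x, its kernel modulo p would be a proper open
  subgroup, and a maximal one because every nonzero residue generates the residues modulo p. Integer
  congruences are used so that single coefficients of a power series can serve as \<psi>.\<close>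

lemma frattini_subgroup_additive:
  fixes H :: "'h monoid" (structure)
  assumes H: "group H" and p: "prime p" and \<psi>: "\<And>x y. x \<in> carrier H \<Longrightarrow> y \<in> carrier H \<Longrightarrow> [\<psi> (x \<otimes> y) = \<psi> x + \<psi> y] (mod int p)"
    and op: "openin T {x \<in> carrier H. [\<psi> x = 0] (mod int p)}"
    and x: "x \<in> frattini_subgroup H T"
  shows "[\<psi> x = 0] (mod int p)"
proof (rule ccontr)
  assume nx: "\<not> [\<psi> x = 0] (mod int p)"
  interpret group H by fact
  let ?M = "{x \<in> carrier H. [\<psi> x = 0] (mod int p)}"
  have xH: "x \<in> carrier H" using x by (simp add: frattini_subgroup_def)
  have one: "[\<psi> \<one> = 0] (mod int p)"
    using \<psi>[of \<one> \<one>] by (simp add: cong_iff_dvd_diff)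
  have inv: "[\<psi> (inv y) = - \<psi> y] (mod int p)" if "y \<in> carrier H" for y
  proof -
    have "[\<psi> y + \<psi> (inv y) = 0] (mod int p)"
      using \<psi>[of y "inv y"] one that by (metis cong_sym cong_trans inv_closed r_inv)
    then show ?thesis by (simp add: cong_iff_dvd_diff add.commute)
  qed
  have pow: "[\<psi> (y [^] m) = int m * \<psi> y] (mod int p)" if "y \<in> carrier H" for y and m :: nat
  proof (induction m)
    case (Suc m)
    have "[\<psi> (y [^] Suc m) = \<psi> (y [^] m) + \<psi> y] (mod int p)" using \<psi>[of "y [^] m" y] that by simp
    also have "[\<psi> (y [^] m) + \<psi> y = int m * \<psi> y + \<psi> y] (mod int p)" using Suc by (rule cong_add) simp
    finally show ?case by (simp add: algebra_simps)
  qed (use one in simp)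
  have sub: "subgroup ?M H"
  proof
    fix a b assume a: "a \<in> ?M" and b: "b \<in> ?M"
    have "[\<psi> (a \<otimes> b) = 0 + 0] (mod int p)" using \<psi>[of a b] a b by (metis (mono_tags, lifting) cong_add cong_trans mem_Collect_eq)
    then show "a \<otimes> b \<in> ?M" using a b by simp
    have "[- \<psi> a = - 0] (mod int p)" using a by (simp only: cong_minus_minus_iff mem_Collect_eq)
    then show "inv a \<in> ?M" using a inv[of a] cong_trans by auto
  qed (use one in auto)
  have "L = ?M \<or> L = carrier H" if L: "subgroup L H" "?M \<subseteq> L" for L
  proof (rule disjCI)
    assume "L \<noteq> carrier H"
    interpret L: subgroup L H by fact
    show "L = ?M"
    proof (rule ccontr)
      assume "L \<noteq> ?M"
      then obtain y where y: "y \<in> L" "y \<notin> ?M" using L by blast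
      then have yH: "y \<in> carrier H" using L.subset by blast
      then have "coprime (\<psi> y) (int p)"
        using y p by (auto simp: cong_0_iff coprime_commute intro: prime_imp_coprime)
      then obtain c where c: "[\<psi> y * c = 1] (mod int p)" using cong_solve_coprime_int by blast
      have "z \<in> L" if z: "z \<in> carrier H" for z
      proof -
        \<comment> \<open>As c inverts \<psi>(y) modulo p, the multiple \<open>m \<psi>(y)\<close>
          is congruent to \<psi>(z). Hence \<open>z y^-m\<close> lies in the kernel, which is
          contained in L.\<close>
        define m where "m = nat ((c * \<psi> z) mod int p)"
        have "int m = (c * \<psi> z) mod int p" using p by (simp add: m_def prime_gt_0_nat)
        then have "[int m * \<psi> y = c * \<psi> z * \<psi> y] (mod int p)" by (simp add: cong_def mod_mult_left_eq)
        also have "c * \<psi> z * \<psi> y = \<psi> y * c * \<psi> z" by simp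
        also have "[\<psi> y * c * \<psi> z = 1 * \<psi> z] (mod int p)" using c by (rule cong_mult) simp
        finally have m: "[int m * \<psi> y = \<psi> z] (mod int p)" by simp
        have ymH: "y [^] m \<in> carrier H" using yH by simp
        have "[\<psi> (z \<otimes> inv (y [^] m)) = \<psi> z + \<psi> (inv (y [^] m))] (mod int p)" using z ymH by (intro \<psi>) auto
        also have "[\<psi> z + \<psi> (inv (y [^] m)) = \<psi> z + - \<psi> (y [^] m)] (mod int p)"
          using inv[OF ymH] by (intro cong_add) auto
        also have "[\<psi> z + - \<psi> (y [^] m) = \<psi> z + - \<psi> z] (mod int p)"
          using cong_trans[OF pow[OF yH] m] by (intro cong_add) (auto simp: cong_minus_minus_iff)
        finally have "z \<otimes> inv (y [^] m) \<in> L" using L(2) z ymH by auto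
        moreover have "y [^] m \<in> L" using y(1) by (induction m) auto
        ultimately have "z \<otimes> inv (y [^] m) \<otimes> y [^] m \<in> L" by blast
        then show ?thesis using z ymH by (simp add: m_assoc)
      qed
      then show False using \<open>L \<noteq> carrier H\<close> L.subset by blast
    qed
  qed
  moreover have "?M \<noteq> carrier H" using nx xH by blast
  ultimately have "maximal_open_subgroup H T ?M" using sub op by (simp add: maximal_open_subgroup_def)
  then show False using x nx by (auto simp: frattini_subgroup_def)
qed

text \<open>The exponent is the order of the quotient by W and is uniform in x. It brings a power
  \<open>u^(p^k)\<close> into a given neighbourhood of 1.\<close>

lemma open_normal_pow:
  fixes G :: "'g monoid" (structure)
  assumes "pro_p_group p G T" and W: "W \<in> open_normals G T"
  obtains k where "\<And>x. x \<in> carrier G \<Longrightarrow> x [^] (p ^ k :: nat) \<in> W"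
proof -
  interpret group G using assms(1) by (simp add: pro_p_group_def topological_group_def)
  interpret W: normal W G using W by (simp add: open_normals_def)
  obtain k where k: "order (G Mod W) = p ^ k" using assms by (auto simp: pro_p_group_def)
  interpret Q: group "G Mod W" by (rule W.factorgroup_is_group)
  have "x [^] (p ^ k) \<in> W" if x: "x \<in> carrier G" for x
  proof -
    have c: "W #> x \<in> carrier (G Mod W)" using x by (auto simp: FactGroup_def RCOSETS_def)
    have "W #> (x [^] (p ^ k)) = (W #> x) [^]\<^bsub>G Mod W\<^esub> (p ^ k)" using W.FactGroup_pow[OF x] by simp
    also have "\<dots> = W" using Q.pow_order_eq_1[OF c] k by simp
    finally show ?thesis using x rcos_self[OF _ W.is_subgroup, of "x [^] (p ^ k)"] by simp
  qed
  then show ?thesis by (rule that)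
qed


section \<open>Free algebras and division rings of characteristic p\<close>

context ring begin

lemma add_pow_one_mult: "x \<in> carrier R \<Longrightarrow> add_pow R (n::nat) x = add_pow R n \<one> \<otimes> x"
  using add_pow_ldistr[of \<one> x n] by simp

lemma add_pow_closed: "x \<in> carrier R \<Longrightarrow> add_pow R (n::nat) x \<in> carrier R"
  by (rule add.nat_pow_closed)

lemma add_pow_dvd_zero:
  assumes "add_pow R (p::nat) \<one> = \<zero>" "p dvd n" "x \<in> carrier R"
  shows "add_pow R n x = \<zero>"
proof -
  obtain m where n: "n = p * m" using assms(2) by auto
  have "add_pow R n \<one> = add_pow R m (add_pow R p \<one>)"
    unfolding n using add.nat_pow_pow[of \<one> m p] by (simp add: mult.commute)
  also have "\<dots> = \<zero>" using assms(1) add.nat_pow_one[of m] by simp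
  finally show ?thesis using add_pow_one_mult[OF assms(3), of n] assms(3) by simp
qed

text \<open>The binomial theorem in a ring that may be noncommutative: x commutes with 1.\<close>

lemma binomial_one:
  assumes x: "x \<in> carrier R"
  shows "(x \<oplus> \<one>) [^] (n::nat) = (\<Oplus>k\<in>{..n}. add_pow R (n choose k) (x [^] k))"
proof (induction n)
  case 0
  then show ?case by (simp add: add_pow_def)
next
  case (Suc n)
  let ?t = "\<lambda>n k. add_pow R (n choose k) (x [^] (k::nat))"
  have t: "?t n k \<in> carrier R" for n k using x by (intro add_pow_closed) simp
  have ext: "(\<Oplus>k\<in>{..Suc n}. ?t n k) = (\<Oplus>k\<in>{..n}. ?t n k)"
    using t by (simp add: atMost_Suc finsum_insert Pi_iff) (simp add: add_pow_def binomial_eq_0)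
  have "(\<Oplus>k\<in>{..n}. ?t n k) \<otimes> x = (\<Oplus>k\<in>{..n}. ?t n k \<otimes> x)"
    using t x by (intro finsum_ldistr) auto
  also have "\<dots> = (\<Oplus>k\<in>{..n}. add_pow R (n choose k) (x [^] Suc k))"
    using t x by (intro finsum_cong') (auto simp: add_pow_ldistr add_pow_closed)
  also have "\<dots> = (\<Oplus>k\<in>Suc ` {..n}. add_pow R (n choose (k - 1)) (x [^] k))"
    using x by (subst finsum_reindex) (auto simp: add_pow_closed)
  also have "\<dots> = (\<Oplus>k\<in>{..Suc n}. if k = 0 then \<zero> else add_pow R (n choose (k - 1)) (x [^] k))"
  proof -
    have "(\<Oplus>k\<in>Suc ` {..n}. add_pow R (n choose (k - 1)) (x [^] k)) =
      (\<Oplus>k\<in>Suc ` {..n}. if k = 0 then \<zero> else add_pow R (n choose (k - 1)) (x [^] k))"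
      using x by (intro finsum_cong') (auto simp: add_pow_closed)
    also have "\<dots> = (\<Oplus>k\<in>insert 0 (Suc ` {..n}). if k = 0 then \<zero> else add_pow R (n choose (k - 1)) (x [^] k))"
      using x by (subst finsum_insert) (auto simp: add_pow_closed intro!: finsum_closed)
    finally show ?thesis by (simp only: atMost_Suc_eq_insert_0)
  qed
  finally have shift: "(\<Oplus>k\<in>{..n}. ?t n k) \<otimes> x = \<dots>" .
  have "(x \<oplus> \<one>) [^] Suc n = (\<Oplus>k\<in>{..n}. ?t n k) \<otimes> x \<oplus> (\<Oplus>k\<in>{..n}. ?t n k)"
    using Suc x t by (simp add: r_distr finsum_closed)
  also have "\<dots> = (\<Oplus>k\<in>{..Suc n}. if k = 0 then \<zero> else add_pow R (n choose (k - 1)) (x [^] k)) \<oplus>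
      (\<Oplus>k\<in>{..Suc n}. ?t n k)"
    by (simp only: shift ext)
  also have "\<dots> = (\<Oplus>k\<in>{..Suc n}. (if k = 0 then \<zero> else add_pow R (n choose (k - 1)) (x [^] k)) \<oplus> ?t n k)"
    using t x by (intro finsum_addf[symmetric]) (auto simp: add_pow_closed)
  also have "\<dots> = (\<Oplus>k\<in>{..Suc n}. ?t (Suc n) k)"
  proof (intro finsum_cong' refl)
    fix k
    show "(if k = 0 then \<zero> else add_pow R (n choose (k - 1)) (x [^] k)) \<oplus> ?t n k = ?t (Suc n) k"
    proof (cases k)
      case (Suc k')
      have "add_pow R ((n choose k') + (n choose Suc k')) (x [^] Suc k') =
        add_pow R (n choose k') (x [^] Suc k') \<oplus> add_pow R (n choose Suc k') (x [^] Suc k')"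
        using x add.nat_pow_mult[of "x [^] Suc k'" "n choose k'" "n choose Suc k'"] by simp
      then show ?thesis by (simp add: Suc)
    qed (simp add: add_pow_def)
  qed (use t in auto)
  finally show ?case .
qed

lemma frobenius_one:
  assumes p: "prime p" and char: "add_pow R (p::nat) \<one> = \<zero>" and x: "x \<in> carrier R"
  shows "(x \<oplus> \<one>) [^] (p ^ k) = x [^] (p ^ k) \<oplus> \<one>"
proof (induction k)
  case (Suc k)
  have frob: "(y \<oplus> \<one>) [^] p = y [^] p \<oplus> \<one>" if y: "y \<in> carrier R" for y
  proof -
    have p0: "0 < p" using p by (rule prime_gt_0_nat)
    have "(y \<oplus> \<one>) [^] p = (\<Oplus>i\<in>{..p}. add_pow R (p choose i) (y [^] i))" by (rule binomial_one[OF y])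
    also have "\<dots> = (\<Oplus>i\<in>{0, p}. add_pow R (p choose i) (y [^] i))"
    proof (rule add.finprod_mono_neutral_cong_right)
      fix i assume i: "i \<in> {..p} - {0, p}"
      have "p dvd (p choose i)" using i p by (intro dvd_choose_prime) auto
      then show "add_pow R (p choose i) (y [^] i) = \<zero>" using y by (intro add_pow_dvd_zero[OF char]) auto
    qed (use y p0 in \<open>auto simp: add_pow_closed\<close>)
    also have "\<dots> = \<one> \<oplus> y [^] p" using p0 y by (simp add: finsum_insert add_pow_def)
    finally show ?thesis using y by (simp add: a_comm)
  qed
  have "(x \<oplus> \<one>) [^] (p ^ Suc k) = ((x \<oplus> \<one>) [^] (p ^ k)) [^] p"
    using x by (simp add: nat_pow_pow mult.commute)
  also have "\<dots> = (x [^] (p ^ k)) [^] p \<oplus> \<one>" unfolding Suc using x by (intro frob) simp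
  finally show ?case using x by (simp add: nat_pow_pow mult.commute)
qed (use x in simp)

end

text \<open>In characteristic p the power \<open>(v - 1)^(p^k)\<close> equals
  \<open>v^(p^k) - 1\<close>, which is 0, and a division ring has no nonzero nilpotent
  elements.\<close>

lemma division_ring_p_torsion:
  assumes D: "is_division_ring D" and p: "prime p" and char: "add_pow D (p::nat) \<one>\<^bsub>D\<^esub> = \<zero>\<^bsub>D\<^esub>"
    and v: "v \<in> carrier D" "v [^]\<^bsub>D\<^esub> (p ^ k) = \<one>\<^bsub>D\<^esub>"
  shows "v = \<one>\<^bsub>D\<^esub>"
proof -
  interpret D: ring D using D by (simp add: is_division_ring_def)
  define y where "y = v \<ominus>\<^bsub>D\<^esub> \<one>\<^bsub>D\<^esub>"
  have y: "y \<in> carrier D" using v by (simp add: y_def)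
  have vy: "v = y \<oplus>\<^bsub>D\<^esub> \<one>\<^bsub>D\<^esub>" using v by (simp add: y_def a_minus_def D.a_assoc D.l_neg)
  have "y [^]\<^bsub>D\<^esub> (p ^ k) \<oplus>\<^bsub>D\<^esub> \<one>\<^bsub>D\<^esub> = \<zero>\<^bsub>D\<^esub> \<oplus>\<^bsub>D\<^esub> \<one>\<^bsub>D\<^esub>"
    using D.frobenius_one[OF p char y, of k] v(2) by (simp add: vy)
  then have yp: "y [^]\<^bsub>D\<^esub> (p ^ k) = \<zero>\<^bsub>D\<^esub>" using y by (simp del: D.l_zero)
  have "y = \<zero>\<^bsub>D\<^esub>"
  proof (rule ccontr)
    assume "y \<noteq> \<zero>\<^bsub>D\<^esub>"
    then have "y \<in> Units D" using D y by (simp add: is_division_ring_def)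
    then have "y [^]\<^bsub>D\<^esub> (p ^ k) \<in> Units D" by (rule D.Units_pow_closed)
    then show False using yp D by (simp add: is_division_ring_def)
  qed
  then show ?thesis using vy by simp
qed

text \<open>Associativity and distributivity are inherited from \<open>D\<close>; only closure needs an argument.\<close>

lemma free_algebra_ring:
  assumes K: "ring K" and D: "ring D" and e: "e \<in> ring_hom (free_algebra K V) D"
    and inj: "inj_on e (carrier (free_algebra K V))"
  shows "ring (free_algebra K V)"
proof -
  interpret K: ring K by fact
  interpret D: ring D by fact
  let ?L = "free_algebra K V"
  have Kc: "f u \<in> carrier K" if "f \<in> carrier ?L" for f u using that by (simp add: free_algebra_def)
  have zero: "\<zero>\<^bsub>?L\<^esub> \<in> carrier ?L" by (simp add: free_algebra_def)
  have add: "f \<oplus>\<^bsub>?L\<^esub> g \<in> carrier ?L" if f: "f \<in> carrier ?L" and g: "g \<in> carrier ?L" for f g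
  proof -
    have "{u. f u \<oplus>\<^bsub>K\<^esub> g u \<noteq> \<zero>\<^bsub>K\<^esub>} \<subseteq> {u. f u \<noteq> \<zero>\<^bsub>K\<^esub>} \<union> {u. g u \<noteq> \<zero>\<^bsub>K\<^esub>}" by auto
    moreover have "u \<in> lists V" if "f u \<oplus>\<^bsub>K\<^esub> g u \<noteq> \<zero>\<^bsub>K\<^esub>" for u
    proof -
      have "f u \<noteq> \<zero>\<^bsub>K\<^esub> \<or> g u \<noteq> \<zero>\<^bsub>K\<^esub>" using that by auto
      then show ?thesis using f g by (auto simp: free_algebra_def)
    qed
    ultimately show ?thesis using f g by (auto simp: free_algebra_def intro: finite_subset)
  qed
  have mult: "f \<otimes>\<^bsub>?L\<^esub> g \<in> carrier ?L" if f: "f \<in> carrier ?L" and g: "g \<in> carrier ?L" for f g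
  proof -
    let ?h = "\<lambda>u. \<Oplus>\<^bsub>K\<^esub>k\<in>{..length u}. f (take k u) \<otimes>\<^bsub>K\<^esub> g (drop k u)"
    have supp: "\<exists>k. f (take k u) \<noteq> \<zero>\<^bsub>K\<^esub> \<and> g (drop k u) \<noteq> \<zero>\<^bsub>K\<^esub>" if "?h u \<noteq> \<zero>\<^bsub>K\<^esub>" for u
    proof (rule ccontr)
      assume "\<not> ?thesis"
      then have "f (take k u) \<otimes>\<^bsub>K\<^esub> g (drop k u) = \<zero>\<^bsub>K\<^esub>" for k using Kc[OF f] Kc[OF g] by (metis K.l_null K.r_null)
      then have "?h u = \<zero>\<^bsub>K\<^esub>" by (intro K.add.finprod_one_eqI) auto
      with that show False by simp
    qed
    have "{u. ?h u \<noteq> \<zero>\<^bsub>K\<^esub>} \<subseteq> (\<lambda>(a, b). a @ b) ` ({u. f u \<noteq> \<zero>\<^bsub>K\<^esub>} \<times> {u. g u \<noteq> \<zero>\<^bsub>K\<^esub>})"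
    proof
      fix u assume "u \<in> {u. ?h u \<noteq> \<zero>\<^bsub>K\<^esub>}"
      then obtain k where "f (take k u) \<noteq> \<zero>\<^bsub>K\<^esub>" "g (drop k u) \<noteq> \<zero>\<^bsub>K\<^esub>" using supp by blast
      then show "u \<in> (\<lambda>(a, b). a @ b) ` ({u. f u \<noteq> \<zero>\<^bsub>K\<^esub>} \<times> {u. g u \<noteq> \<zero>\<^bsub>K\<^esub>})"
        by (intro image_eqI[of _ _ "(take k u, drop k u)"]) auto
    qed
    then have "finite {u. ?h u \<noteq> \<zero>\<^bsub>K\<^esub>}"
      by (rule finite_subset) (use f g in \<open>auto simp: free_algebra_def\<close>)
    moreover have "u \<in> lists V" if u: "?h u \<noteq> \<zero>\<^bsub>K\<^esub>" for u
    proof -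
      obtain k where "f (take k u) \<noteq> \<zero>\<^bsub>K\<^esub>" "g (drop k u) \<noteq> \<zero>\<^bsub>K\<^esub>" using supp[OF u] by blast
      then have "take k u \<in> lists V" "drop k u \<in> lists V" using f g by (auto simp: free_algebra_def)
      then have "take k u @ drop k u \<in> lists V" by (simp del: append_take_drop_id)
      then show ?thesis by simp
    qed
    moreover have "?h u \<in> carrier K" for u using Kc[OF f] Kc[OF g] by (intro K.finsum_closed) auto
    ultimately show ?thesis by (simp add: free_algebra_def)
  qed
  \<comment> \<open>Membership in \<open>ring_hom\<close> says nothing about zero, and the free
    algebra is not yet known to be a ring, so that e maps 0 to 0 is derived from 0 + 0 = 0.\<close>
  have "e \<zero>\<^bsub>?L\<^esub> \<oplus>\<^bsub>D\<^esub> e \<zero>\<^bsub>?L\<^esub> = e (\<zero>\<^bsub>?L\<^esub> \<oplus>\<^bsub>?L\<^esub> \<zero>\<^bsub>?L\<^esub>)" using ring_hom_add[OF e zero zero] by simp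
  also have "\<zero>\<^bsub>?L\<^esub> \<oplus>\<^bsub>?L\<^esub> \<zero>\<^bsub>?L\<^esub> = \<zero>\<^bsub>?L\<^esub>" by (simp add: free_algebra_def)
  finally have e0: "e \<zero>\<^bsub>?L\<^esub> = \<zero>\<^bsub>D\<^esub>" using ring_hom_closed[OF e zero] by simp
  show ?thesis
  proof (rule ring_by_injection[OF D _ inj add mult])
    show "\<exists>g\<in>carrier ?L. g \<oplus>\<^bsub>?L\<^esub> f = \<zero>\<^bsub>?L\<^esub>" if f: "f \<in> carrier ?L" for f
    proof
      have "(\<ominus>\<^bsub>K\<^esub> f u \<noteq> \<zero>\<^bsub>K\<^esub>) = (f u \<noteq> \<zero>\<^bsub>K\<^esub>)" for u using Kc[OF f, of u] by (metis K.minus_minus K.minus_zero)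
      then show "(\<lambda>u. \<ominus>\<^bsub>K\<^esub> f u) \<in> carrier ?L" using f by (simp add: free_algebra_def)
      show "(\<lambda>u. \<ominus>\<^bsub>K\<^esub> f u) \<oplus>\<^bsub>?L\<^esub> f = \<zero>\<^bsub>?L\<^esub>" using Kc[OF f] by (simp add: free_algebra_def K.l_neg)
    qed
    show "\<one>\<^bsub>?L\<^esub> \<in> carrier ?L" by (simp add: free_algebra_def)
  qed (use zero e0 ring_hom_closed[OF e] ring_hom_add[OF e] ring_hom_mult[OF e] ring_hom_one[OF e] in auto)
qed

text \<open>A word is a product of variables, and over the prime field a scalar multiple is a
  repeated sum, so a ring endomorphism that fixes the variables fixes every monomial. The rest is
  induction on the number of monomials.\<close>

lemma free_algebra_endomorphism_identity:
  assumes p: "prime p" and ring: "ring (free_algebra (residue_ring (int p)) V)"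
    and \<tau>: "\<tau> \<in> ring_hom (free_algebra (residue_ring (int p)) V) (free_algebra (residue_ring (int p)) V)"
    and gen: "\<And>v. v \<in> V \<Longrightarrow> \<tau> (free_var (residue_ring (int p)) v) = free_var (residue_ring (int p)) v"
    and f: "f \<in> carrier (free_algebra (residue_ring (int p)) V)"
  shows "\<tau> f = f"
proof -
  let ?K = "residue_ring (int p)"
  let ?L = "free_algebra ?K V"
  interpret residues "int p" ?K using prime_gt_1_nat[OF p] by unfold_locales auto
  interpret L: ring ?L by fact
  interpret \<tau>: ring_hom_ring ?L ?L \<tau> using \<tau> by (intro ring_hom_ringI2 ring)
  have p1: "1 < int p" using prime_gt_1_nat[OF p] by simp
  define mono where "mono c u = (\<lambda>w. if w = u then c else (0::int))" for c and u :: "'a list"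
  have monoc: "mono c u \<in> carrier ?L" if "u \<in> lists V" "0 \<le> c" "c < int p" for c u
  proof -
    have "{w. mono c u w \<noteq> 0} \<subseteq> {u}" by (auto simp: mono_def)
    then show ?thesis using that by (auto simp: free_algebra_def res_carrier_eq res_zero_eq mono_def intro: finite_subset)
  qed
  have fix1: "\<tau> (mono 1 u) = mono 1 u" if "u \<in> lists V" for u
    using that
  proof (induction u)
    case Nil
    have "mono 1 [] = \<one>\<^bsub>?L\<^esub>" by (auto simp: mono_def free_algebra_def res_one_eq res_zero_eq)
    then show ?case by simp
  next
    case (Cons v u)
    then have v: "v \<in> V" and u: "u \<in> lists V" by auto
    have vc: "free_var ?K v = mono 1 [v]" by (auto simp: mono_def free_var_def res_one_eq res_zero_eq)
    have "mono 1 [v] \<otimes>\<^bsub>?L\<^esub> mono 1 u = mono 1 (v # u)"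
    proof
      fix w
      have eq: "(mono 1 [v] \<otimes>\<^bsub>?L\<^esub> mono 1 u) w = (\<Oplus>\<^bsub>?K\<^esub>k\<in>{..length w}. mono 1 [v] (take k w) \<otimes>\<^bsub>?K\<^esub> mono 1 u (drop k w))"
        by (simp add: free_algebra_def)
      show "(mono 1 [v] \<otimes>\<^bsub>?L\<^esub> mono 1 u) w = mono 1 (v # u) w"
      proof (cases "w = v # u")
        case True
        have "(\<Oplus>\<^bsub>?K\<^esub>k\<in>{..length w}. mono 1 [v] (take k w) \<otimes>\<^bsub>?K\<^esub> mono 1 u (drop k w)) =
          mono 1 [v] (take 1 w) \<otimes>\<^bsub>?K\<^esub> mono 1 u (drop 1 w)"
          using p1 True
          by (intro finsum_eq_single) (auto simp: mono_def res_mult_eq res_zero_eq res_carrier_eq take_Cons' split: if_splits)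
        then show ?thesis unfolding eq using True p1 by (simp add: mono_def res_mult_eq)
      next
        case False
        have "mono 1 [v] (take k w) * mono 1 u (drop k w) = 0" for k
        proof (rule ccontr)
          assume "\<not> ?thesis"
          then have "take k w = [v]" "drop k w = u" by (auto simp: mono_def split: if_splits)
          then have "w = v # u" by (metis append_Cons append_Nil append_take_drop_id)
          with False show False by simp
        qed
        then have "(\<Oplus>\<^bsub>?K\<^esub>k\<in>{..length w}. mono 1 [v] (take k w) \<otimes>\<^bsub>?K\<^esub> mono 1 u (drop k w)) = \<zero>\<^bsub>?K\<^esub>"
          by (intro add.finprod_one_eqI) (simp add: res_mult_eq res_zero_eq del: mult_eq_0_iff)
        then show ?thesis unfolding eq using False by (simp add: mono_def res_zero_eq)
      qed
    qed
    moreover have "mono 1 [v] \<in> carrier ?L" "mono 1 u \<in> carrier ?L" using monoc v u p1 by auto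
    ultimately show ?case using \<tau>.hom_mult[of "mono 1 [v]" "mono 1 u"] Cons.IH gen[OF v] u by (simp add: vc)
  qed
  have fixc: "int c < int p \<Longrightarrow> \<tau> (mono (int c) u) = mono (int c) u" if u: "u \<in> lists V" for c :: nat and u
  proof (induction c)
    case 0
    have "mono 0 u = \<zero>\<^bsub>?L\<^esub>" by (auto simp: mono_def free_algebra_def res_zero_eq)
    then show ?case by simp
  next
    case (Suc c)
    have "mono (int (Suc c)) u = mono (int c) u \<oplus>\<^bsub>?L\<^esub> mono 1 u"
      using Suc.prems by (auto simp: mono_def free_algebra_def res_add_eq)
    then show ?case using Suc fix1[OF u] monoc[OF u, of "int c"] monoc[OF u, of 1] p1 by simp
  qed
  have "\<forall>f\<in>carrier ?L. card {u. f u \<noteq> 0} = m \<longrightarrow> \<tau> f = f" for m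
  proof (induction m)
    case 0
    show ?case
    proof (intro ballI impI)
      fix f assume f: "f \<in> carrier ?L" and "card {u. f u \<noteq> 0} = 0"
      then have "f = \<zero>\<^bsub>?L\<^esub>" by (auto simp: free_algebra_def res_zero_eq)
      then show "\<tau> f = f" by simp
    qed
  next
    case (Suc m)
    show ?case
    proof (intro ballI impI)
      fix f assume f: "f \<in> carrier ?L" and card: "card {u. f u \<noteq> 0} = Suc m"
      then obtain u where u: "f u \<noteq> 0" by (metis (mono_tags, lifting) card.empty empty_Collect_eq nat.distinct(1))
      have fin: "finite {u. f u \<noteq> 0}" and fu: "u \<in> lists V" "0 \<le> f u" "f u < int p"
        using f u by (auto simp: free_algebra_def res_zero_eq res_carrier_eq)
      let ?g = "f(u := 0)"
      have s: "{w. ?g w \<noteq> 0} = {w. f w \<noteq> 0} - {u}" by auto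
      then have "card {w. ?g w \<noteq> 0} = m" using card fin u by simp
      moreover have g: "?g \<in> carrier ?L"
        using f s p1 by (auto simp: free_algebra_def res_zero_eq res_carrier_eq)
      ultimately have \<tau>g: "\<tau> ?g = ?g" using Suc by blast
      have m: "mono (f u) u \<in> carrier ?L" using monoc fu by blast
      have c: "0 \<le> f w \<and> f w < int p" for w
        using f by (auto simp: free_algebra_def res_carrier_eq)
      have "f = ?g \<oplus>\<^bsub>?L\<^esub> mono (f u) u"
        using c by (auto simp: fun_eq_iff free_algebra_def mono_def res_add_eq)
      moreover have "\<tau> (mono (f u) u) = mono (f u) u"
        using fixc[OF fu(1), of "nat (f u)"] fu by simp
      ultimately show "\<tau> f = f" using \<tau>.hom_add[OF g m] \<tau>g by simp
    qed
  qed
  then show ?thesis using f by blast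
qed

lemma free_algebra_char:
  assumes p: "prime p"
  shows "add_pow (free_algebra (residue_ring (int p)) V) p \<one>\<^bsub>free_algebra (residue_ring (int p)) V\<^esub> =
    \<zero>\<^bsub>free_algebra (residue_ring (int p)) V\<^esub>"
proof -
  let ?L = "free_algebra (residue_ring (int p)) V"
  interpret residues "int p" "residue_ring (int p)" using prime_gt_1_nat[OF p] by unfold_locales auto
  have "add_pow ?L n \<one>\<^bsub>?L\<^esub> = (\<lambda>u. if u = [] then int n mod int p else 0)" for n :: nat
  proof (induction n)
    case 0
    then show ?case by (auto simp: fun_eq_iff add_pow_def free_algebra_def res_zero_eq nat_pow_def)
  next
    case (Suc n)
    have "add_pow ?L (Suc n) \<one>\<^bsub>?L\<^esub> = add_pow ?L n \<one>\<^bsub>?L\<^esub> \<oplus>\<^bsub>?L\<^esub> \<one>\<^bsub>?L\<^esub>"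
      by (simp add: add_pow_def nat_pow_def)
    also have "\<dots> = (\<lambda>u. if u = [] then int (Suc n) mod int p else 0)"
      unfolding Suc by (auto simp: free_algebra_def res_add_eq res_one_eq res_zero_eq mod_simps algebra_simps)
    finally show ?case .
  qed
  then show ?thesis by (auto simp: fun_eq_iff free_algebra_def res_zero_eq)
qed


section \<open>Mild flag presentations\<close>

text \<open>The coset of x modulo the preimage of V lies over C exactly when C is the coset of
  \<phi> x, so the fibre sum of the group element x is 1 or 0 accordingly. This is used for
  conjugation by g.\<close>

lemma cga_map_cga_of_minus_one:
  assumes A: "cga_group K G T" and B: "cga_group K H T'"
    and \<phi>: "\<phi> \<in> hom G H" and cont: "continuous_map T T' \<phi>" and top: "topspace T = carrier G"
    and x: "x \<in> carrier G"
  shows "cga_map K G T H T' \<phi> (cga_of K G T x \<ominus>\<^bsub>completed_group_algebra K G T\<^esub> \<one>\<^bsub>completed_group_algebra K G T\<^esub>) =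
    cga_of K H T' (\<phi> x) \<ominus>\<^bsub>completed_group_algebra K H T'\<^esub> \<one>\<^bsub>completed_group_algebra K H T'\<^esub>"
proof -
  interpret A: cga_group K G T by fact
  interpret B: cga_group K H T' by fact
  interpret \<phi>: group_hom G H \<phi> using \<phi> by unfold_locales
  let ?a = "cga_of K G T x \<ominus>\<^bsub>A.S\<^esub> \<one>\<^bsub>A.S\<^esub>"
  let ?b = "cga_of K H T' (\<phi> x) \<ominus>\<^bsub>B.S\<^esub> \<one>\<^bsub>B.S\<^esub>"
  have bS: "?b \<in> carrier B.S" using x B.cga_of_closed by simp
  have "cga_map K G T H T' \<phi> ?a V C = ?b V C" for V C
  proof (cases "V \<in> B.\<N> \<and> C \<in> carrier (H Mod V)")
    case True
    then have V: "V \<in> B.\<N>" and C: "C \<in> carrier (H Mod V)" by auto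
    interpret V: normal V H by (rule B.\<N>_normal[OF V])
    define U where "U = {x \<in> carrier G. \<phi> x \<in> V}"
    have "U \<lhd> G"
    proof (rule A.G.normal_invI)
      show "subgroup U G"
        by (rule A.G.subgroupI) (auto simp: U_def intro: V.one_closed V.m_closed V.m_inv_closed)
      show "\<And>y z. y \<in> carrier G \<Longrightarrow> z \<in> U \<Longrightarrow> y \<otimes>\<^bsub>G\<^esub> z \<otimes>\<^bsub>G\<^esub> inv\<^bsub>G\<^esub> y \<in> U"
        by (auto simp: U_def intro: V.inv_op_closed2)
    qed
    moreover have "openin T U"
      using openin_continuous_map_preimage[OF cont, of V] V top by (simp add: U_def open_normals_def)
    ultimately have U: "U \<in> A.\<N>" by (simp add: open_normals_def)
    interpret U: normal U G by (rule A.\<N>_normal[OF U])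
    let ?J = "{D \<in> carrier (G Mod U). \<phi> ` D \<subseteq> C}"
    have J: "U #>\<^bsub>G\<^esub> z \<in> ?J \<longleftrightarrow> C = V #>\<^bsub>H\<^esub> \<phi> z" if z: "z \<in> carrier G" for z
    proof
      assume "U #>\<^bsub>G\<^esub> z \<in> ?J"
      then have "\<phi> z \<in> C" using A.G.rcos_self[OF z U.is_subgroup] by blast
      then show "C = V #>\<^bsub>H\<^esub> \<phi> z" using B.one_in_one_coset[OF C V \<phi>.hom_closed[OF z]] by simp
    next
      assume C: "C = V #>\<^bsub>H\<^esub> \<phi> z"
      have "\<phi> ` (U #>\<^bsub>G\<^esub> z) \<subseteq> C"
      proof
        fix w assume "w \<in> \<phi> ` (U #>\<^bsub>G\<^esub> z)"
        then obtain u where u: "u \<in> U" "w = \<phi> (u \<otimes>\<^bsub>G\<^esub> z)" unfolding r_coset_def by blast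
        have "u \<in> carrier G" and v: "\<phi> u \<in> V" using u(1) unfolding U_def by blast+
        then have "w = \<phi> u \<otimes>\<^bsub>H\<^esub> \<phi> z" using u(2) z by simp
        then show "w \<in> C" using v unfolding C r_coset_def by blast
      qed
      then show "U #>\<^bsub>G\<^esub> z \<in> ?J" using A.rcos_carrier[OF U z] by blast
    qed
    have sum: "(\<Oplus>\<^bsub>K\<^esub>D\<in>?J. cga_of K G T z U D) = cga_of K H T' (\<phi> z) V C" if z: "z \<in> carrier G" for z
    proof (cases "U #>\<^bsub>G\<^esub> z \<in> ?J")
      case True
      have "(\<Oplus>\<^bsub>K\<^esub>D\<in>?J. cga_of K G T z U D) = cga_of K G T z U (U #>\<^bsub>G\<^esub> z)"
        using A.fin_cosets[OF U] True
        by (intro A.K.finsum_eq_single) (auto simp: A.cga_of_apply[OF U] A.one_in_one_coset[OF _ U z])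
      also have "\<dots> = \<one>\<^bsub>K\<^esub>" using A.rcos_carrier[OF U z] z by (simp add: A.cga_of_apply[OF U] A.one_in_one_coset[OF _ U z])
      finally show ?thesis using True[unfolded J[OF z]] C z by (simp add: B.cga_of_apply V B.one_in_one_coset)
    next
      case False
      have "(\<Oplus>\<^bsub>K\<^esub>D\<in>?J. cga_of K G T z U D) = \<zero>\<^bsub>K\<^esub>"
        using False by (intro A.K.add.finprod_one_eqI) (auto simp: A.cga_of_apply[OF U] A.one_in_one_coset[OF _ U z])
      then show ?thesis using False[unfolded J[OF z]] C z by (simp add: B.cga_of_apply V B.one_in_one_coset)
    qed
    have val: "cga_of K G T z U D \<in> carrier K" if "z \<in> carrier G" "D \<in> carrier (G Mod U)" for z D
      using A.S_coeff[OF A.cga_of_closed U] that by blast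
    have "cga_map K G T H T' \<phi> ?a V C = (\<Oplus>\<^bsub>K\<^esub>D\<in>?J. ?a U D)"
      unfolding cga_map_def Let_def U_def[symmetric] restrict_def using V C by (simp only: if_True)
    also have "\<dots> = (\<Oplus>\<^bsub>K\<^esub>D\<in>?J. cga_of K G T x U D \<oplus>\<^bsub>K\<^esub> \<ominus>\<^bsub>K\<^esub> cga_of K G T \<one>\<^bsub>G\<^esub> U D)"
    proof (intro A.K.finsum_cong' refl)
      fix D assume "D \<in> ?J"
      then have D: "D \<in> carrier (G Mod U)" by simp
      show "?a U D = cga_of K G T x U D \<oplus>\<^bsub>K\<^esub> \<ominus>\<^bsub>K\<^esub> cga_of K G T \<one>\<^bsub>G\<^esub> U D"
        using A.S_minus_apply[OF A.cga_of_closed[OF x] A.S_one_closed U D]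
        by (simp only: A.cga_of_one a_minus_def)
    qed (use val x in auto)
    also have "\<dots> = (\<Oplus>\<^bsub>K\<^esub>D\<in>?J. cga_of K G T x U D) \<oplus>\<^bsub>K\<^esub> (\<Oplus>\<^bsub>K\<^esub>D\<in>?J. \<ominus>\<^bsub>K\<^esub> cga_of K G T \<one>\<^bsub>G\<^esub> U D)"
      using val x by (intro A.K.finsum_addf) auto
    also have "(\<Oplus>\<^bsub>K\<^esub>D\<in>?J. \<ominus>\<^bsub>K\<^esub> cga_of K G T \<one>\<^bsub>G\<^esub> U D) = \<ominus>\<^bsub>K\<^esub> (\<Oplus>\<^bsub>K\<^esub>D\<in>?J. cga_of K G T \<one>\<^bsub>G\<^esub> U D)"
      using val by (intro A.K.finsum_minus) auto
    also have "(\<Oplus>\<^bsub>K\<^esub>D\<in>?J. cga_of K G T x U D) \<oplus>\<^bsub>K\<^esub> \<dots> = ?b V C"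
      using B.S_minus_apply[OF B.cga_of_closed[OF \<phi>.hom_closed[OF x]] B.S_one_closed V C]
      by (simp only: sum[OF x] sum[OF A.G.one_closed] \<phi>.hom_one B.cga_of_one a_minus_def)
    finally show ?thesis .
  next
    case False
    \<comment> \<open>Equality of functions is claimed, so arguments outside the index sets matter
      too; there both sides are \<open>undefined\<close>.\<close>
    have b1: "?b V = undefined" if "V \<notin> B.\<N>"
      by (rule PiE_arb[OF B.S_carrier_iff[THEN iffD1, OF bS, THEN conjunct1] that])
    have b2: "?b V C = undefined" if "V \<in> B.\<N>" "C \<notin> carrier (H Mod V)"
      using B.S_component[OF bS that(1)] that(2) by (auto simp: group_algebra_def PiE_def extensional_def)
    show ?thesis
    proof (cases "V \<in> B.\<N>")
      case True
      then have "cga_map K G T H T' \<phi> ?a V C = undefined" using False unfolding cga_map_def by simp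
      then show ?thesis using b2 True False by simp
    next
      case V: False
      then have "cga_map K G T H T' \<phi> ?a V = undefined" unfolding cga_map_def by simp
      then show ?thesis using b1[OF V] by simp
    qed
  qed
  then show ?thesis by blast
qed

section \<open>The presented group: relations, characters and bounds on weights\<close>

locale mild_flag =
  fixes p n l :: nat
    and F :: "'f monoid" and TF :: "'f topology" and X h :: "nat \<Rightarrow> 'f" and \<gamma> :: 'f
    and G :: "'g monoid" and TG :: "'g topology" and \<pi> :: "'f \<Rightarrow> 'g"
  assumes prime: "prime p"
    and pres: "mild_flag_presentation p n l F TF X \<gamma> h G TG \<pi>"
begin

abbreviation K where "K \<equiv> residue_ring (int p)"
definition Nt where "Nt = closed_normal_closure F TF (X ` {1..n})"
definition x where "x i = \<pi> (X i)"
definition g where "g = \<pi> \<gamma>"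
definition N where "N = closed_normal_closure G TG (x ` {1..n})"
definition GN where "GN = G\<lparr>carrier := N\<rparr>"
definition TN where "TN = subtopology TG N"

lemma F_pro_p: "pro_p_group p F TF" and G_pro_p: "pro_p_group p G TG"
  and l_le: "l \<le> n"
  and \<pi>_hom: "\<pi> \<in> hom F G" and \<pi>_cont: "continuous_map TF TG \<pi>" and \<pi>_surj: "\<pi> ` carrier F = carrier G"
  and \<pi>_ker: "kernel F G \<pi> = closed_normal_closure F TF ((\<lambda>i. commutator F (X i) \<gamma> \<otimes>\<^bsub>F\<^esub> inv\<^bsub>F\<^esub> h i) ` {1..l})"
  and h_frattini: "i \<in> {1..l} \<Longrightarrow> h i \<in> frattini_subgroup (F\<lparr>carrier := Nt\<rparr>) (subtopology TF Nt)"
  using pres by (auto simp: mild_flag_presentation_def free_pro_p_group_def Nt_def Let_def)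

lemma F_top: "topological_group F TF" and G_top: "topological_group G TG"
  using F_pro_p G_pro_p by (simp_all add: pro_p_group_def)

sublocale F: group F using F_top by (simp add: topological_group_def)
sublocale G: group G using G_top by (simp add: topological_group_def)
sublocale \<pi>: group_hom F G \<pi> using \<pi>_hom by unfold_locales

lemma topspaces: "topspace TF = carrier F" "topspace TG = carrier G"
  using F_top G_top by (simp_all add: topological_group_def)

sublocale K: residues "int p" K
  using prime_gt_1_nat[OF prime] by unfold_locales auto

lemma X_carrier: "i \<in> {1..n} \<Longrightarrow> X i \<in> carrier F" and \<gamma>_carrier: "\<gamma> \<in> carrier F"
  using pres by (auto simp: mild_flag_presentation_def free_pro_p_group_def Pi_iff)

lemma x_carrier: "i \<in> {1..n} \<Longrightarrow> x i \<in> carrier G" and g_carrier: "g \<in> carrier G"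
  using X_carrier \<gamma>_carrier by (auto simp: x_def g_def)

lemma Nt: "Nt \<lhd> F" "closedin TF Nt" "X ` {1..n} \<subseteq> Nt"
proof -
  have "X ` {1..n} \<subseteq> carrier F" using X_carrier by blast
  from closed_normal_closure_normal[OF F_top this]
  show "Nt \<lhd> F" "closedin TF Nt" "X ` {1..n} \<subseteq> Nt" by (simp_all only: Nt_def)
qed

lemma N: "N \<lhd> G" "closedin TG N" "x ` {1..n} \<subseteq> N"
proof -
  have "x ` {1..n} \<subseteq> carrier G" using x_carrier by blast
  from closed_normal_closure_normal[OF G_top this]
  show "N \<lhd> G" "closedin TG N" "x ` {1..n} \<subseteq> N" by (simp_all only: N_def)
qed

sublocale Nt: normal Nt F by (rule Nt(1))
sublocale N: normal N G by (rule N(1))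

lemma h_Nt: "i \<in> {1..l} \<Longrightarrow> h i \<in> Nt"
  using h_frattini[of i] by (simp add: frattini_subgroup_def)

text \<open>The preimage of N is a closed normal subgroup that contains all X i.\<close>

lemma \<pi>_Nt: "\<pi> ` Nt \<subseteq> N"
proof -
  let ?H = "{y \<in> carrier F. \<pi> y \<in> N}"
  have "?H \<lhd> F"
  proof (rule F.normal_invI)
    show "subgroup ?H F"
      by (rule F.subgroupI) (auto intro: N.one_closed N.m_closed N.m_inv_closed)
    show "\<And>y z. y \<in> carrier F \<Longrightarrow> z \<in> ?H \<Longrightarrow> y \<otimes>\<^bsub>F\<^esub> z \<otimes>\<^bsub>F\<^esub> inv\<^bsub>F\<^esub> y \<in> ?H"
      by (auto intro: N.inv_op_closed2)
  qed
  moreover have "closedin TF ?H"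
    using closedin_continuous_map_preimage[OF \<pi>_cont N(2)] by (simp add: topspaces)
  moreover have "X ` {1..n} \<subseteq> ?H" using X_carrier N(3) by (auto simp: x_def)
  ultimately have "Nt \<subseteq> ?H" unfolding Nt_def by (rule closed_normal_closure_minimal)
  then show ?thesis by blast
qed

lemma commutator_relation:
  assumes i: "i \<in> {1..l}"
  shows "commutator G (x i) g = \<pi> (h i)"
proof -
  have Xi: "X i \<in> carrier F" and hi: "h i \<in> carrier F" using i l_le X_carrier h_Nt Nt.subset by auto
  let ?r = "\<lambda>i. commutator F (X i) \<gamma> \<otimes>\<^bsub>F\<^esub> inv\<^bsub>F\<^esub> h i"
  have "?r ` {1..l} \<subseteq> carrier F"
    using X_carrier \<gamma>_carrier h_Nt Nt.subset l_le by (auto simp: commutator_def)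
  then have "?r i \<in> kernel F G \<pi>"
    unfolding \<pi>_ker using closed_normal_closure_normal(3)[OF F_top] i by blast
  then have "\<pi> (commutator F (X i) \<gamma>) \<otimes>\<^bsub>G\<^esub> inv\<^bsub>G\<^esub> \<pi> (h i) = \<one>\<^bsub>G\<^esub>"
    using Xi hi \<gamma>_carrier by (simp add: kernel_def commutator_def)
  moreover have "\<pi> (commutator F (X i) \<gamma>) = commutator G (x i) g"
    using Xi \<gamma>_carrier by (simp add: commutator_def x_def g_def)
  moreover have "commutator G (x i) g \<in> carrier G"
    using Xi \<gamma>_carrier by (simp add: commutator_def x_def g_def)
  ultimately show ?thesis using hi by (metis G.inv_equality G.inv_inv G.inv_closed \<pi>.hom_closed)
qed

text \<open>Freeness is applied with the cyclic group of order p on \<open>{..<p}\<close>, sending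
  each X i to 1 and \<gamma> to 0. The discrete topology of this group makes the kernel both open
  and closed; closedness is what lets the kernel contain a closed normal closure.\<close>

lemma character_of_F:
  obtains \<Theta> where "\<Theta> \<in> hom F (add_monoid K)" "openin TF {y \<in> carrier F. \<Theta> y = 0}"
    "closedin TF {y \<in> carrier F. \<Theta> y = 0}"
    "\<And>i. i \<in> {1..n} \<Longrightarrow> \<Theta> (X i) = 1" "\<Theta> \<gamma> = 0"
proof -
  define P :: "nat monoid" where "P = \<lparr>carrier = {..<p}, monoid.mult = \<lambda>a b. (a + b) mod p, one = 0\<rparr>"
  have p1: "1 < p" by (rule prime_gt_1_nat[OF prime])
  have "group P"
  proof (rule groupI)
    fix a assume "a \<in> carrier P"
    then have "(p - a) mod p \<in> carrier P" "(p - a) mod p \<otimes>\<^bsub>P\<^esub> a = \<one>\<^bsub>P\<^esub>"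
      using p1 by (auto simp: P_def mod_simps)
    then show "\<exists>y\<in>carrier P. y \<otimes>\<^bsub>P\<^esub> a = \<one>\<^bsub>P\<^esub>" by blast
  qed (use p1 in \<open>auto simp: P_def mod_simps add.assoc\<close>)
  moreover have "order P = p ^ 1" by (simp add: order_def P_def)
  moreover have "case_option 0 (\<lambda>_. 1) \<in> insert None (Some ` {1..n}) \<rightarrow> carrier P" using p1 by (auto simp: P_def)
  moreover have "\<And>(P :: nat monoid) c. group P \<Longrightarrow> (\<exists>k. order P = p ^ k) \<Longrightarrow> c \<in> insert None (Some ` {1..n}) \<rightarrow> carrier P \<Longrightarrow>
      \<exists>\<theta>. \<theta> \<in> hom F P \<and> continuous_map TF (discrete_topology (carrier P)) \<theta> \<and>
        (\<forall>i\<in>insert None (Some ` {1..n}). \<theta> (case_option \<gamma> X i) = c i)"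
    using pres unfolding mild_flag_presentation_def free_pro_p_group_def by blast
  ultimately obtain \<theta> where \<theta>: "\<theta> \<in> hom F P" "continuous_map TF (discrete_topology (carrier P)) \<theta>"
    "\<forall>i\<in>insert None (Some ` {1..n}). \<theta> (case_option \<gamma> X i) = (case_option 0 (\<lambda>_. 1) i :: nat)" by metis
  define \<Theta> where "\<Theta> y = int (\<theta> y)" for y
  have eq: "{y \<in> carrier F. \<Theta> y = 0} = {y \<in> topspace TF. \<theta> y \<in> {0}}" by (auto simp: \<Theta>_def topspaces)
  show ?thesis
  proof
    show "\<Theta> \<in> hom F (add_monoid K)"
    proof (rule homI)
      fix a b assume a: "a \<in> carrier F" and b: "b \<in> carrier F"
      show "\<Theta> a \<in> carrier (add_monoid K)"
        using hom_in_carrier[OF \<theta>(1) a] by (auto simp: \<Theta>_def P_def K.res_carrier_eq)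
      show "\<Theta> (a \<otimes>\<^bsub>F\<^esub> b) = \<Theta> a \<otimes>\<^bsub>add_monoid K\<^esub> \<Theta> b"
        using hom_mult[OF \<theta>(1) a b] by (simp add: \<Theta>_def P_def K.res_add_eq zmod_int)
    qed
    show "openin TF {y \<in> carrier F. \<Theta> y = 0}" unfolding eq
      using p1 by (intro openin_continuous_map_preimage[OF \<theta>(2)]) (auto simp: P_def)
    show "closedin TF {y \<in> carrier F. \<Theta> y = 0}" unfolding eq
      using p1 by (intro closedin_continuous_map_preimage[OF \<theta>(2)]) (auto simp: P_def)
    show "\<Theta> (X i) = 1" if "i \<in> {1..n}" for i using \<theta>(3) that by (auto simp: \<Theta>_def)
    show "\<Theta> \<gamma> = 0" using \<theta>(3) by (auto simp: \<Theta>_def)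
  qed
qed

lemma frattini_Nt_additive:
  assumes \<psi>: "\<And>y z. y \<in> Nt \<Longrightarrow> z \<in> Nt \<Longrightarrow> [\<psi> (y \<otimes>\<^bsub>F\<^esub> z) = \<psi> y + \<psi> z] (mod int p)"
    and op: "openin (subtopology TF Nt) {y \<in> Nt. [\<psi> y = 0] (mod int p)}" and i: "i \<in> {1..l}"
  shows "[\<psi> (h i) = 0] (mod int p)"
proof (rule frattini_subgroup_additive[OF _ prime _ _ h_frattini[OF i]])
  show "group (F\<lparr>carrier := Nt\<rparr>)" by (rule subgroup.subgroup_is_group[OF Nt.is_subgroup F.group_axioms])
qed (use \<psi> op in auto)

text \<open>A character of \<open>F\<close> with value 1 on all \<open>X\<^sub>i\<close> factors through \<open>G\<close>, so \<open>x\<^sub>i - 1 \<notin> I\<^sub>G\<^sup>2\<close>.\<close>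

lemma character_of_G:
  obtains \<phi> where "\<phi> \<in> hom G (add_monoid K)" "openin TG {y \<in> carrier G. \<phi> y = 0}"
    "\<And>i. i \<in> {1..n} \<Longrightarrow> \<phi> (x i) = 1"
proof -
  obtain \<Theta> where \<Theta>: "\<Theta> \<in> hom F (add_monoid K)" "openin TF {y \<in> carrier F. \<Theta> y = 0}"
    "closedin TF {y \<in> carrier F. \<Theta> y = 0}" "\<And>i. i \<in> {1..n} \<Longrightarrow> \<Theta> (X i) = 1" "\<Theta> \<gamma> = 0"
    by (rule character_of_F) blast
  interpret \<Theta>: group_hom F "add_monoid K" \<Theta>
    using \<Theta>(1) K.a_group by (intro group_hom.intro group_hom_axioms.intro F.group_axioms)
  let ?M = "{y \<in> carrier F. \<Theta> y = 0}"
  have Mker: "?M = kernel F (add_monoid K) \<Theta>" by (simp add: kernel_def K.res_zero_eq)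
  have range: "0 \<le> \<Theta> y \<and> \<Theta> y < int p" if "y \<in> carrier F" for y
    using \<Theta>.hom_closed[OF that] by (auto simp: K.res_carrier_eq)
  have cong0: "[\<Theta> y = 0] (mod int p) \<longleftrightarrow> \<Theta> y = 0" if "y \<in> carrier F" for y
    using range[OF that] by (simp add: cong_def)
  have mult: "\<Theta> (y \<otimes>\<^bsub>F\<^esub> z) = (\<Theta> y + \<Theta> z) mod int p" if "y \<in> carrier F" "z \<in> carrier F" for y z
    using \<Theta>.hom_mult[OF that] by (simp add: K.res_add_eq)
  \<comment> \<open>On \<open>Nt\<close> the character \<Theta> is additive with open kernel, and h
    i lies in the Frattini subgroup of \<open>Nt\<close>.\<close>
  have h0: "\<Theta> (h i) = 0" if i: "i \<in> {1..l}" for i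
  proof -
    have "[\<Theta> (h i) = 0] (mod int p)"
    proof (rule frattini_Nt_additive[OF _ _ i])
      show "[\<Theta> (y \<otimes>\<^bsub>F\<^esub> z) = \<Theta> y + \<Theta> z] (mod int p)" if "y \<in> Nt" "z \<in> Nt" for y z
        using mult[of y z] that Nt.subset by (auto simp: cong_def)
      have "{y \<in> Nt. [\<Theta> y = 0] (mod int p)} = Nt \<inter> ?M" using cong0 Nt.subset by auto
      then show "openin (subtopology TF Nt) {y \<in> Nt. [\<Theta> y = 0] (mod int p)}"
        using \<Theta>(2) by (auto simp: openin_subtopology)
    qed
    then show ?thesis using cong0 h_Nt[OF i] Nt.subset by blast
  qed
  have relator: "commutator F (X i) \<gamma> \<otimes>\<^bsub>F\<^esub> inv\<^bsub>F\<^esub> h i \<in> ?M" if i: "i \<in> {1..l}" for i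
  proof -
    have c: "X i \<in> carrier F" "h i \<in> carrier F" "\<gamma> \<in> carrier F"
      using i l_le X_carrier h_Nt Nt.subset \<gamma>_carrier by auto
    then have m: "h i \<in> ?M" "\<gamma> \<in> ?M" using h0[OF i] \<Theta>(5) by auto
    interpret M: normal ?M F unfolding Mker by (rule \<Theta>.normal_kernel)
    have "inv\<^bsub>F\<^esub> X i \<otimes>\<^bsub>F\<^esub> inv\<^bsub>F\<^esub> \<gamma> \<otimes>\<^bsub>F\<^esub> X i \<in> ?M" using M.inv_op_closed1[OF c(1) M.m_inv_closed[OF m(2)]] .
    from M.m_closed[OF M.m_closed[OF this m(2)] M.m_inv_closed[OF m(1)]]
    show ?thesis unfolding commutator_def .
  qed
  have "?M \<lhd> F" unfolding Mker by (rule \<Theta>.normal_kernel)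
  then have ker: "kernel F G \<pi> \<subseteq> ?M"
    unfolding \<pi>_ker using relator by (intro closed_normal_closure_minimal \<Theta>(3) image_subsetI)
  have fact: "\<Theta> y = \<Theta> z" if yz: "y \<in> carrier F" "z \<in> carrier F" and eq: "\<pi> y = \<pi> z" for y z
  proof -
    have "y \<otimes>\<^bsub>F\<^esub> inv\<^bsub>F\<^esub> z \<in> kernel F G \<pi>" using yz eq by (simp add: kernel_def)
    then have "\<Theta> (y \<otimes>\<^bsub>F\<^esub> inv\<^bsub>F\<^esub> z) = 0" using ker by auto
    then have "\<Theta> (y \<otimes>\<^bsub>F\<^esub> inv\<^bsub>F\<^esub> z \<otimes>\<^bsub>F\<^esub> z) = \<Theta> z mod int p" using mult[of "y \<otimes>\<^bsub>F\<^esub> inv\<^bsub>F\<^esub> z" z] yz by simp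
    moreover have "y \<otimes>\<^bsub>F\<^esub> inv\<^bsub>F\<^esub> z \<otimes>\<^bsub>F\<^esub> z = y" using yz by (simp add: F.m_assoc)
    ultimately show ?thesis using range[OF yz(2)] by simp
  qed
  define \<phi> where "\<phi> u = \<Theta> (SOME y. y \<in> carrier F \<and> \<pi> y = u)" for u
  have \<phi>: "\<phi> (\<pi> y) = \<Theta> y" if y: "y \<in> carrier F" for y
  proof -
    have "(SOME z. z \<in> carrier F \<and> \<pi> z = \<pi> y) \<in> carrier F \<and> \<pi> (SOME z. z \<in> carrier F \<and> \<pi> z = \<pi> y) = \<pi> y"
      using y by (intro someI[of "\<lambda>z. z \<in> carrier F \<and> \<pi> z = \<pi> y" y]) simp
    then show ?thesis unfolding \<phi>_def using fact[OF _ y] by blast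
  qed
  show ?thesis
  proof
    show "\<phi> \<in> hom G (add_monoid K)"
    proof (rule homI)
      fix u v assume "u \<in> carrier G" "v \<in> carrier G"
      then obtain y z where yz: "y \<in> carrier F" "z \<in> carrier F" "u = \<pi> y" "v = \<pi> z" using \<pi>_surj by (metis imageE)
      show "\<phi> u \<in> carrier (add_monoid K)" using yz \<phi> \<Theta>.hom_closed by simp
      have "\<phi> (u \<otimes>\<^bsub>G\<^esub> v) = \<phi> (\<pi> (y \<otimes>\<^bsub>F\<^esub> z))" using yz by simp
      also have "\<dots> = \<Theta> y \<otimes>\<^bsub>add_monoid K\<^esub> \<Theta> z" using yz \<Theta>.hom_mult by (simp only: \<phi> F.m_closed)
      finally show "\<phi> (u \<otimes>\<^bsub>G\<^esub> v) = \<phi> u \<otimes>\<^bsub>add_monoid K\<^esub> \<phi> v" using yz \<phi> by simp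
    qed
    \<comment> \<open>A continuous surjection from a compact space onto a Hausdorff space is a
      quotient map, so openness of the kernel of \<phi> can be tested in F.\<close>
    have q: "quotient_map TF TG \<pi>"
      using F_pro_p G_pro_p \<pi>_cont \<pi>_surj
      by (intro continuous_imp_quotient_map) (auto simp: pro_p_group_def topspaces)
    have eq: "{y \<in> topspace TF. \<pi> y \<in> {u \<in> carrier G. \<phi> u = 0}} = ?M" using \<phi> by (auto simp: topspaces)
    have "{u \<in> carrier G. \<phi> u = 0} \<subseteq> topspace TG" by (auto simp: topspaces)
    with q have "openin TF {y \<in> topspace TF. \<pi> y \<in> {u \<in> carrier G. \<phi> u = 0}} \<longleftrightarrow> openin TG {u \<in> carrier G. \<phi> u = 0}"
      unfolding quotient_map_def by blast
    then show "openin TG {u \<in> carrier G. \<phi> u = 0}" unfolding eq using \<Theta>(2) by simp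
    show "\<phi> (x i) = 1" if "i \<in> {1..n}" for i using \<phi>[OF X_carrier[OF that]] \<Theta>(4)[OF that] by (simp add: x_def)
  qed
qed

lemma GN_top: "topological_group GN TN"
  unfolding GN_def TN_def by (rule topological_group_subgroup[OF G_top N.is_subgroup])

lemma plain_ring_K: "plain_ring K"
  unfolding plain_ring_def by (rule K.ring_axioms)

lemma TN_compact: "compact_space TN"
  using G_pro_p N(2) unfolding TN_def pro_p_group_def
  by (intro compact_space_subtopology closedin_compact_space) auto

sublocale GN: cga_group K GN TN
  by (rule cga_group_compact[OF plain_ring_K GN_top TN_compact])

sublocale SG: residue_cga p G TG
proof (intro residue_cga.intro residue_cga_axioms.intro prime)
  show "cga_group K G TG"
    by (rule cga_group_compact[OF plain_ring_K G_top]) (use G_pro_p in \<open>simp add: pro_p_group_def\<close>)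
qed

lemma weight_le_one:
  assumes i: "i \<in> {1..n}"
  shows "grp_weight p G TG (x i) \<le> 1"
proof -
  obtain \<phi> where \<phi>: "\<phi> \<in> hom G (add_monoid K)" "openin TG {y \<in> carrier G. \<phi> y = 0}"
    "\<And>i. i \<in> {1..n} \<Longrightarrow> \<phi> (x i) = 1"
    by (rule character_of_G) blast
  show ?thesis by (rule SG.grp_weight_le_one[OF \<phi>(1,2) x_carrier[OF i]]) (simp add: \<phi>(3)[OF i])
qed

lemma commutator_N: "u \<in> N \<Longrightarrow> commutator G u g \<in> N"
proof -
  assume u: "u \<in> N"
  then have uG: "u \<in> carrier G" using N.subset by blast
  have "inv\<^bsub>G\<^esub> g \<otimes>\<^bsub>G\<^esub> u \<otimes>\<^bsub>G\<^esub> g \<in> N" using N.inv_op_closed1[OF g_carrier u] .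
  from N.m_closed[OF N.m_inv_closed[OF u] this]
  have "inv\<^bsub>G\<^esub> u \<otimes>\<^bsub>G\<^esub> (inv\<^bsub>G\<^esub> g \<otimes>\<^bsub>G\<^esub> u \<otimes>\<^bsub>G\<^esub> g) \<in> N" .
  then show ?thesis using uG g_carrier by (simp add: commutator_def G.m_assoc)
qed

lemma flag_gen_N: "(i, j) \<in> flag_index n l \<Longrightarrow> flag_gen G x g (i, j) \<in> N"
proof (induction j)
  case 0
  then show ?case using N(3) by (auto simp: flag_gen_def flag_index_def)
next
  case (Suc j)
  then have "flag_gen G x g (i, j) \<in> N" by (auto simp: flag_index_def)
  then show ?case using commutator_N by (simp add: flag_gen_def)
qed

end


section \<open>The embedding \<iota> and its values on N\<close>

lemma tadic_open_coeff:
  "tadic_open A {f \<in> carrier (powser_ring A). Q (f k)}"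
  unfolding tadic_open_def by (auto intro!: exI[of _ "Suc k"])

lemma (in plain_ring) powser_constant_term_hom: "(\<lambda>f. f 0) \<in> ring_hom P R"
  by (rule ring_hom_memI) (simp_all add: P_mult P_add P_one)

text \<open>Of D the locale records that it is a division ring containing \<Lambda>. This makes
  \<Lambda> a ring, and it leaves 1 as the only possible constant term of p-power order.\<close>

locale mild_flag_embedding = mild_flag p n l F TF X h \<gamma> G TG \<pi>
  for p n l :: nat
    and F :: "'f monoid" and TF :: "'f topology" and X h :: "nat \<Rightarrow> 'f" and \<gamma> :: 'f
    and G :: "'g monoid" and TG :: "'g topology" and \<pi> :: "'f \<Rightarrow> 'g" +
  fixes \<iota> :: "('g set \<Rightarrow> 'g set \<Rightarrow> int) \<Rightarrow> nat \<Rightarrow> (nat \<times> nat) list \<Rightarrow> int"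
    and D :: "'d ring" and e :: "((nat \<times> nat) list \<Rightarrow> int) \<Rightarrow> 'd"
  assumes D_division: "is_division_ring D"
    and e_hom: "e \<in> ring_hom (free_algebra K (flag_index n l)) D"
    and e_inj: "inj_on e (carrier (free_algebra K (flag_index n l)))"
    and \<iota>_hom: "\<iota> \<in> ring_hom GN.S (powser_ring (free_algebra K (flag_index n l)))"
    and \<iota>_cont: "continuous_map (cga_topology K GN TN) (tadic_topology (free_algebra K (flag_index n l))) \<iota>"
    and \<iota>_gen: "ij \<in> flag_index n l \<Longrightarrow>
      \<iota> (cga_of K GN TN (flag_gen G x g ij) \<ominus>\<^bsub>GN.S\<^esub> \<one>\<^bsub>GN.S\<^esub>) =
        powser_const (free_algebra K (flag_index n l)) (free_var K ij)
          \<otimes>\<^bsub>powser_ring (free_algebra K (flag_index n l))\<^esub>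
        powser_t (free_algebra K (flag_index n l))
          [^]\<^bsub>powser_ring (free_algebra K (flag_index n l))\<^esub> grp_weight p G TG (flag_gen G x g ij)"
begin

abbreviation \<Lambda> where "\<Lambda> \<equiv> free_algebra K (flag_index n l)"
abbreviation w where "w ij \<equiv> grp_weight p G TG (flag_gen G x g ij)"

lemma \<Lambda>_ring: "ring \<Lambda>"
  using D_division e_hom e_inj by (intro free_algebra_ring K.ring_axioms) (auto simp: is_division_ring_def)

sublocale \<Lambda>: plain_ring \<Lambda> using \<Lambda>_ring by (simp add: plain_ring_def)
sublocale D: ring D using D_division by (simp add: is_division_ring_def)
sublocale \<Lambda>t: ring \<Lambda>.P by (rule \<Lambda>.powser_ring_ring)
sublocale e: ring_hom_ring \<Lambda> D e by (rule ring_hom_ringI2[OF \<Lambda>_ring D.ring_axioms e_hom])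
sublocale \<iota>: ring_hom_ring GN.S \<Lambda>.P \<iota>
  by (rule ring_hom_ringI2[OF GN.S_ring \<Lambda>t.ring_axioms \<iota>_hom])

definition U where "U u = \<iota> (cga_of K GN TN u)"

lemma GN_simps: "carrier GN = N" "u \<otimes>\<^bsub>GN\<^esub> v = u \<otimes>\<^bsub>G\<^esub> v" "\<one>\<^bsub>GN\<^esub> = \<one>\<^bsub>G\<^esub>"
  by (simp_all add: GN_def)

lemma topspace_TN: "topspace TN = N"
  using GN_top by (simp add: topological_group_def GN_simps)

lemma U_closed: "u \<in> N \<Longrightarrow> U u \<in> carrier \<Lambda>.P"
  unfolding U_def using GN.cga_of_closed[of u] by (simp add: GN_simps)

lemma U_coeff: "u \<in> N \<Longrightarrow> U u k \<in> carrier \<Lambda>"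
  by (rule \<Lambda>.P_coeff[OF U_closed])

lemma U_mult: "u \<in> N \<Longrightarrow> v \<in> N \<Longrightarrow> U (u \<otimes>\<^bsub>G\<^esub> v) = U u \<otimes>\<^bsub>\<Lambda>.P\<^esub> U v"
  unfolding U_def using GN.cga_of_mult[of u v] GN.cga_of_closed[of u] GN.cga_of_closed[of v] by (simp add: GN_simps)

lemma U_one: "U \<one>\<^bsub>G\<^esub> = \<one>\<^bsub>\<Lambda>.P\<^esub>"
  unfolding U_def using GN.cga_of_one by (simp add: GN_simps)

lemma U_minus_one: "u \<in> N \<Longrightarrow> \<iota> (cga_of K GN TN u \<ominus>\<^bsub>GN.S\<^esub> \<one>\<^bsub>GN.S\<^esub>) = U u \<ominus>\<^bsub>\<Lambda>.P\<^esub> \<one>\<^bsub>\<Lambda>.P\<^esub>"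
  unfolding U_def using GN.cga_of_closed[of u] by (simp add: GN_simps a_minus_def)

lemma U_open:
  assumes "tadic_open \<Lambda> V"
  shows "openin TN {u \<in> N. U u \<in> V}"
proof -
  have "continuous_map TN (tadic_topology \<Lambda>) (\<iota> \<circ> cga_of K GN TN)"
    by (rule continuous_map_compose[OF cga_of_continuous[OF GN.cga_group_axioms GN_top] \<iota>_cont])
  from openin_continuous_map_preimage[OF this, of V] assms show ?thesis
    by (simp add: openin_tadic_topology topspace_TN U_def)
qed

lemma D_char: "add_pow D p \<one>\<^bsub>D\<^esub> = \<zero>\<^bsub>D\<^esub>"
proof -
  have "e (add_pow \<Lambda> m \<one>\<^bsub>\<Lambda>\<^esub>) = add_pow D m \<one>\<^bsub>D\<^esub>" for m :: nat
  proof (induction m)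
    case (Suc m)
    have "add_pow \<Lambda> m \<one>\<^bsub>\<Lambda>\<^esub> \<in> carrier \<Lambda>" by (rule \<Lambda>.add_pow_closed) simp
    then have "e (add_pow \<Lambda> m \<one>\<^bsub>\<Lambda>\<^esub> \<oplus>\<^bsub>\<Lambda>\<^esub> \<one>\<^bsub>\<Lambda>\<^esub>) = add_pow D m \<one>\<^bsub>D\<^esub> \<oplus>\<^bsub>D\<^esub> \<one>\<^bsub>D\<^esub>" using Suc by simp
    then show ?case by (simp add: add_pow_def nat_pow_def)
  qed (simp add: add_pow_def nat_pow_def)
  from this[of p] show ?thesis by (simp add: free_algebra_char[OF prime])
qed

text \<open>\<open>U u 0\<close> is a \<open>p\<close>-power torsion unit because \<open>u\<^bsup>p^k\<^esup> \<rightarrow> 1\<close>, and \<open>D\<close> has characteristic \<open>p\<close>.\<close>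

lemma U_0:
  assumes u: "u \<in> N"
  shows "U u 0 = \<one>\<^bsub>\<Lambda>\<^esub>"
proof -
  let ?V = "{f \<in> carrier \<Lambda>.P. f 0 = \<one>\<^bsub>\<Lambda>\<^esub>}"
  \<comment> \<open>The condition on the constant term is open and holds at 1, so it holds on the
    intersection of N with some open normal subgroup, and hence at \<open>u^(p^k)\<close> for
    suitable k.\<close>
  have "openin TN {u \<in> N. U u \<in> ?V}" by (rule U_open[OF tadic_open_coeff])
  then obtain W where W: "openin TG W" "{u \<in> N. U u \<in> ?V} = W \<inter> N"
    unfolding TN_def openin_subtopology by blast
  have "\<one>\<^bsub>G\<^esub> \<in> {u \<in> N. U u \<in> ?V}"
    using U_one N.one_closed by (simp add: \<Lambda>.P_one)
  then have "\<one>\<^bsub>G\<^esub> \<in> W" using W(2) by blast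
  then obtain V where V: "V \<in> open_normals G TG" "V \<subseteq> W"
    using G_pro_p W(1) unfolding pro_p_group_def by blast
  obtain k where k: "\<And>y. y \<in> carrier G \<Longrightarrow> y [^]\<^bsub>G\<^esub> (p ^ k) \<in> V"
    using open_normal_pow[OF G_pro_p V(1)] by blast
  have pow: "u [^]\<^bsub>G\<^esub> m \<in> N \<and> U (u [^]\<^bsub>G\<^esub> m) 0 = U u 0 [^]\<^bsub>\<Lambda>\<^esub> m" for m :: nat
  proof (induction m)
    case 0
    then show ?case using N.one_closed by (simp add: U_one \<Lambda>.P_one)
  next
    case (Suc m)
    then have m: "u [^]\<^bsub>G\<^esub> m \<in> N" by blast
    have "U (u [^]\<^bsub>G\<^esub> Suc m) 0 = U (u [^]\<^bsub>G\<^esub> m) 0 \<otimes>\<^bsub>\<Lambda>\<^esub> U u 0"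
      using U_coeff[OF m] U_coeff[OF u] by (simp add: U_mult[OF m u] \<Lambda>.P_mult)
    then show ?case using Suc N.m_closed[OF m u] by simp
  qed
  have "u [^]\<^bsub>G\<^esub> (p ^ k) \<in> W \<inter> N" using k[of u] u N.subset V(2) pow by blast
  then have "u [^]\<^bsub>G\<^esub> (p ^ k) \<in> {u \<in> N. U u \<in> ?V}" using W(2) by blast
  then have "U u 0 [^]\<^bsub>\<Lambda>\<^esub> (p ^ k) = \<one>\<^bsub>\<Lambda>\<^esub>" using pow[of "p ^ k"] by auto
  then have "e (U u 0) [^]\<^bsub>D\<^esub> (p ^ k) = \<one>\<^bsub>D\<^esub>"
    using e.hom_nat_pow[OF U_coeff[OF u], of 0 "p ^ k"] by simp
  then have "e (U u 0) = e \<one>\<^bsub>\<Lambda>\<^esub>"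
    using division_ring_p_torsion[OF D_division prime D_char] U_coeff[OF u] by simp
  then show ?thesis by (rule inj_onD[OF e_inj]) (use U_coeff[OF u] in auto)
qed

text \<open>Both constant terms are 1, and the product of \<open>1 + a t + ...\<close> and
  \<open>1 + b t + ...\<close> is \<open>1 + (a + b) t + ...\<close>.\<close>

lemma U_1_mult:
  assumes "u \<in> N" "v \<in> N"
  shows "U (u \<otimes>\<^bsub>G\<^esub> v) 1 = U u 1 \<oplus>\<^bsub>\<Lambda>\<^esub> U v 1"
proof -
  have "{..1::nat} = {0, 1}" by auto
  then show ?thesis
    using U_coeff[OF assms(1)] U_coeff[OF assms(2)] U_0 assms
    by (simp add: U_mult \<Lambda>.P_mult \<Lambda>.finsum_insert \<Lambda>.a_comm)
qed

lemma \<Lambda>_coeff: "f \<in> carrier \<Lambda> \<Longrightarrow> 0 \<le> f v \<and> f v < int p"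
  by (auto simp: free_algebra_def K.res_carrier_eq)

text \<open>For each word v the coefficient of v in the coefficient of t is additive modulo p, with
  open kernel by continuity of \<iota>. It is pulled back along \<pi> to \<open>Nt\<close>, since
  that is the group whose Frattini subgroup contains h i.\<close>

lemma U_1_relator:
  assumes i: "i \<in> {1..l}"
  shows "U (\<pi> (h i)) 1 = \<zero>\<^bsub>\<Lambda>\<^esub>"
proof
  fix v
  have \<pi>N: "\<pi> y \<in> N" if "y \<in> Nt" for y using \<pi>_Nt that by blast
  have range: "0 \<le> U (\<pi> y) 1 v \<and> U (\<pi> y) 1 v < int p" if "y \<in> Nt" for y
    by (rule \<Lambda>_coeff[OF U_coeff[OF \<pi>N[OF that]]])
  have cong0: "[U (\<pi> y) 1 v = 0] (mod int p) \<longleftrightarrow> U (\<pi> y) 1 v = 0" if "y \<in> Nt" for y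
    using range[OF that] by (simp add: cong_def)
  have "[U (\<pi> (h i)) 1 v = 0] (mod int p)"
  proof (rule frattini_Nt_additive[OF _ _ i])
    fix y z assume y: "y \<in> Nt" and z: "z \<in> Nt"
    then have "\<pi> (y \<otimes>\<^bsub>F\<^esub> z) = \<pi> y \<otimes>\<^bsub>G\<^esub> \<pi> z" using Nt.subset by auto
    then have "U (\<pi> (y \<otimes>\<^bsub>F\<^esub> z)) 1 v = (U (\<pi> y) 1 v + U (\<pi> z) 1 v) mod int p"
      using U_1_mult[OF \<pi>N[OF y] \<pi>N[OF z]] by (simp add: free_algebra_def K.res_add_eq)
    then show "[U (\<pi> (y \<otimes>\<^bsub>F\<^esub> z)) 1 v = U (\<pi> y) 1 v + U (\<pi> z) 1 v] (mod int p)" by (simp add: cong_def)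
  next
    let ?V = "{f \<in> carrier \<Lambda>.P. f 1 v = 0}"
    have "openin TN {u \<in> N. U u \<in> ?V}" by (rule U_open[OF tadic_open_coeff])
    moreover have "continuous_map (subtopology TF Nt) TN \<pi>"
      using \<pi>_cont \<pi>_Nt unfolding TN_def
      by (auto simp: continuous_map_in_subtopology intro: continuous_map_from_subtopology)
    ultimately have "openin (subtopology TF Nt) {y \<in> topspace (subtopology TF Nt). \<pi> y \<in> {u \<in> N. U u \<in> ?V}}"
      by (rule openin_continuous_map_preimage[rotated])
    also have "topspace (subtopology TF Nt) = Nt" using Nt.subset by (auto simp: topspaces)
    also have "{y \<in> Nt. \<pi> y \<in> {u \<in> N. U u \<in> ?V}} = {y \<in> Nt. [U (\<pi> y) 1 v = 0] (mod int p)}"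
      using \<pi>N U_closed cong0 by blast
    finally show "openin (subtopology TF Nt) {y \<in> Nt. [U (\<pi> y) 1 v = 0] (mod int p)}" .
  qed
  then show "U (\<pi> (h i)) 1 v = \<zero>\<^bsub>\<Lambda>\<^esub> v"
    using range[OF h_Nt[OF i]] by (simp add: cong_def free_algebra_def K.res_zero_eq)
qed

lemma free_var_closed: "ij \<in> flag_index n l \<Longrightarrow> free_var K ij \<in> carrier \<Lambda>"
proof -
  assume ij: "ij \<in> flag_index n l"
  have "{u. free_var K ij u \<noteq> \<zero>\<^bsub>K\<^esub>} \<subseteq> {[ij]}" by (auto simp: free_var_def)
  then show ?thesis using ij by (auto simp: free_algebra_def free_var_def intro: finite_subset)
qed

text \<open>The hypothesis on \<iota> says that U of the generator is \<open>1 + a t^w\<close>. As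
  the constant term is 1 and the variable a is not 0, the exponent w cannot be 0.\<close>

lemma U_generator:
  assumes ij: "ij \<in> flag_index n l"
  shows "0 < w ij" "0 < k \<Longrightarrow> U (flag_gen G x g ij) k = (if k = w ij then free_var K ij else \<zero>\<^bsub>\<Lambda>\<^esub>)"
proof -
  let ?u = "flag_gen G x g ij" and ?a = "free_var K ij"
  have u: "?u \<in> N" using flag_gen_N ij by (cases ij) simp
  have a: "?a \<in> carrier \<Lambda>" by (rule free_var_closed[OF ij])
  have U: "U ?u k \<ominus>\<^bsub>\<Lambda>\<^esub> (if k = 0 then \<one>\<^bsub>\<Lambda>\<^esub> else \<zero>\<^bsub>\<Lambda>\<^esub>) = (if k = w ij then ?a else \<zero>\<^bsub>\<Lambda>\<^esub>)" for k
  proof -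
    have "(U ?u \<ominus>\<^bsub>\<Lambda>.P\<^esub> \<one>\<^bsub>\<Lambda>.P\<^esub>) k = (if k < w ij then \<zero>\<^bsub>\<Lambda>\<^esub> else powser_const \<Lambda> ?a (k - w ij))"
      using \<iota>_gen[OF ij] U_minus_one[OF u] \<Lambda>.powser_mult_t_pow(2)[OF \<Lambda>.powser_const_carrier[OF a]] by simp
    then show ?thesis
      using \<Lambda>.powser_minus_apply[OF \<Lambda>t.one_closed] by (auto simp: \<Lambda>.P_one powser_const_def)
  qed
  show "0 < w ij"
  proof (rule ccontr)
    assume "\<not> 0 < w ij"
    then have "\<one>\<^bsub>\<Lambda>\<^esub> \<ominus>\<^bsub>\<Lambda>\<^esub> \<one>\<^bsub>\<Lambda>\<^esub> = ?a" using U[of 0] U_0[OF u] by simp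
    then have "?a = \<zero>\<^bsub>\<Lambda>\<^esub>" by (simp add: a_minus_def \<Lambda>.r_neg)
    then have "?a [ij] = \<zero>\<^bsub>\<Lambda>\<^esub> [ij]" by simp
    then show False by (simp add: free_var_def free_algebra_def K.res_one_eq K.res_zero_eq)
  qed
  show "U ?u k = (if k = w ij then ?a else \<zero>\<^bsub>\<Lambda>\<^esub>)" if "0 < k"
    using U[of k] that U_coeff[OF u, of k] by (simp add: a_minus_def split: if_splits)
qed

text \<open>These are the coefficients that could disturb the coefficient of \<open>t^w\<close> in
  U(x) U([x,g]). For i \<le> l the bound on the weight leaves only k = 1, the degree that the
  Frattini condition controls. Otherwise [x,g] is the next generator, whose single term of positive
  degree lies above w.\<close>

lemma U_commutator:
  assumes ij: "ij \<in> flag_index n l" and k: "0 < k" "k \<le> w ij"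
  shows "U (commutator G (flag_gen G x g ij) g) k = \<zero>\<^bsub>\<Lambda>\<^esub>"
proof -
  obtain i j where ij': "ij = (i, j)" by fastforce
  show ?thesis
  proof (cases "i \<le> l")
    case True
    then have i: "i \<in> {1..l}" "i \<in> {1..n}" and u: "flag_gen G x g ij = x i"
      using ij by (auto simp: flag_index_def ij' flag_gen_def)
    have "k = 1" using k weight_le_one[OF i(2)] u by simp
    then show ?thesis using commutator_relation[OF i(1)] U_1_relator[OF i(1)] u by simp
  next
    case False
    then have ij1: "(i, Suc j) \<in> flag_index n l" using ij by (auto simp: flag_index_def ij')
    have c: "commutator G (flag_gen G x g ij) g = flag_gen G x g (i, Suc j)" by (simp add: flag_gen_def ij')
    have "flag_gen G x g ij \<in> carrier G" using flag_gen_N[of i j] ij N.subset by (auto simp: ij')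
    from SG.grp_weight_commutator[OF this g_carrier U_generator(1)[OF ij], unfolded c, OF U_generator(1)[OF ij1]]
    have "w ij < w (i, Suc j)" .
    then show ?thesis using U_generator(2)[OF ij1 k(1)] k(2) by (simp add: c)
  qed
qed

text \<open>Conjugation by g multiplies x on the right by [x,g]. In the coefficient of
  \<open>t^w\<close> of U(x) U([x,g]) every term but the last contains a coefficient of U([x,g]) of
  degree between 1 and w, which vanishes. The last term is the variable times the constant term
  1.\<close>

lemma conj_generator:
  assumes ij: "ij \<in> flag_index n l"
  shows "\<iota> (cga_map K GN TN GN TN (\<lambda>y. inv\<^bsub>G\<^esub> g \<otimes>\<^bsub>G\<^esub> y \<otimes>\<^bsub>G\<^esub> g)
      (cga_of K GN TN (flag_gen G x g ij) \<ominus>\<^bsub>GN.S\<^esub> \<one>\<^bsub>GN.S\<^esub>)) (w ij) = free_var K ij"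
proof -
  let ?u = "flag_gen G x g ij" and ?\<phi> = "\<lambda>y. inv\<^bsub>G\<^esub> g \<otimes>\<^bsub>G\<^esub> y \<otimes>\<^bsub>G\<^esub> g"
  let ?c = "commutator G ?u g"
  have u: "?u \<in> N" using flag_gen_N ij by (cases ij) simp
  have uG: "?u \<in> carrier G" using u N.subset by blast
  have c: "?c \<in> N" by (rule commutator_N[OF u])
  have \<phi>N: "?\<phi> y \<in> N" if "y \<in> N" for y using N.inv_op_closed1[OF g_carrier that] .
  have \<phi>: "?\<phi> \<in> hom GN GN"
  proof (rule homI)
    fix y z assume "y \<in> carrier GN" "z \<in> carrier GN"
    then have yz: "y \<in> N" "z \<in> N" by (simp_all add: GN_simps)
    then have yzG: "y \<in> carrier G" "z \<in> carrier G" using N.subset by auto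
    show "?\<phi> y \<in> carrier GN" using \<phi>N[OF yz(1)] by (simp add: GN_simps)
    have "?\<phi> y \<otimes>\<^bsub>G\<^esub> ?\<phi> z = inv\<^bsub>G\<^esub> g \<otimes>\<^bsub>G\<^esub> y \<otimes>\<^bsub>G\<^esub> (g \<otimes>\<^bsub>G\<^esub> inv\<^bsub>G\<^esub> g) \<otimes>\<^bsub>G\<^esub> z \<otimes>\<^bsub>G\<^esub> g"
      using yzG g_carrier by (simp only: G.m_assoc G.m_closed G.inv_closed)
    then show "?\<phi> (y \<otimes>\<^bsub>GN\<^esub> z) = ?\<phi> y \<otimes>\<^bsub>GN\<^esub> ?\<phi> z"
      using yzG g_carrier by (simp add: GN_simps G.m_assoc)
  qed
  have cont: "continuous_map TN TN ?\<phi>"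
    using topological_group_conj[OF G_top g_carrier] \<phi>N unfolding TN_def
    by (auto simp: continuous_map_in_subtopology intro: continuous_map_from_subtopology)
  have one_w: "\<one>\<^bsub>\<Lambda>.P\<^esub> (w ij) = \<zero>\<^bsub>\<Lambda>\<^esub>"
    using U_generator(1)[OF ij] unfolding \<Lambda>.P_one by (simp only: if_not_P neq0_conv)
  have minus_zero: "z \<ominus>\<^bsub>\<Lambda>\<^esub> \<zero>\<^bsub>\<Lambda>\<^esub> = z" if "z \<in> carrier \<Lambda>" for z
    using that by (simp add: a_minus_def)
  have \<phi>u: "?\<phi> ?u = ?u \<otimes>\<^bsub>G\<^esub> ?c"
    using uG g_carrier by (simp add: commutator_def G.m_assoc[symmetric])
  have "\<iota> (cga_map K GN TN GN TN ?\<phi> (cga_of K GN TN ?u \<ominus>\<^bsub>GN.S\<^esub> \<one>\<^bsub>GN.S\<^esub>)) =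
    \<iota> (cga_of K GN TN (?\<phi> ?u) \<ominus>\<^bsub>GN.S\<^esub> \<one>\<^bsub>GN.S\<^esub>)"
    by (subst cga_map_cga_of_minus_one[OF GN.cga_group_axioms GN.cga_group_axioms \<phi> cont])
      (use u in \<open>simp_all add: GN_simps topspace_TN\<close>)
  also have "\<dots> = (U ?u \<otimes>\<^bsub>\<Lambda>.P\<^esub> U ?c) \<ominus>\<^bsub>\<Lambda>.P\<^esub> \<one>\<^bsub>\<Lambda>.P\<^esub>"
    using U_minus_one[OF \<phi>N[OF u]] U_mult[OF u c] by (simp only: \<phi>u)
  finally have conj: "\<iota> (cga_map K GN TN GN TN ?\<phi> (cga_of K GN TN ?u \<ominus>\<^bsub>GN.S\<^esub> \<one>\<^bsub>GN.S\<^esub>)) = \<dots>" .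
  have "((U ?u \<otimes>\<^bsub>\<Lambda>.P\<^esub> U ?c) \<ominus>\<^bsub>\<Lambda>.P\<^esub> \<one>\<^bsub>\<Lambda>.P\<^esub>) (w ij) = (U ?u \<otimes>\<^bsub>\<Lambda>.P\<^esub> U ?c) (w ij) \<ominus>\<^bsub>\<Lambda>\<^esub> \<zero>\<^bsub>\<Lambda>\<^esub>"
    by (simp only: \<Lambda>.powser_minus_apply[OF \<Lambda>t.one_closed] one_w)
  also have "\<dots> = (U ?u \<otimes>\<^bsub>\<Lambda>.P\<^esub> U ?c) (w ij)"
    by (rule minus_zero[OF \<Lambda>.P_coeff[OF \<Lambda>t.m_closed[OF U_closed[OF u] U_closed[OF c]]]])
  also have "\<dots> = (\<Oplus>\<^bsub>\<Lambda>\<^esub>i\<in>{..w ij}. U ?u i \<otimes>\<^bsub>\<Lambda>\<^esub> U ?c (w ij - i))" by (rule \<Lambda>.P_mult)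
  also have "\<dots> = U ?u (w ij) \<otimes>\<^bsub>\<Lambda>\<^esub> U ?c (w ij - w ij)"
    using U_coeff[OF u] U_coeff[OF c] U_commutator[OF ij] by (intro \<Lambda>.finsum_eq_single) auto
  also have "\<dots> = free_var K ij"
    using U_generator[OF ij] U_0[OF c] free_var_closed[OF ij] by simp
  finally show ?thesis unfolding conj .
qed

text \<open>Taking the constant term of \<sigma> on constants gives a ring endomorphism \<tau> of
  \<Lambda>. Comparing coefficients of \<open>t^w\<close> shows that it fixes the variables, so it
  is the identity. Writing f as f 0 + t s passes from constants to all series, since \<sigma> fixes
  t.\<close>

lemma automorphism_unipotent:
  assumes iso: "\<sigma> \<in> ring_iso \<Lambda>.P \<Lambda>.P" and t: "\<sigma> (powser_t \<Lambda>) = powser_t \<Lambda>"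
    and gen: "\<And>ij. ij \<in> flag_index n l \<Longrightarrow>
      \<sigma> (powser_const \<Lambda> (free_var K ij)) \<otimes>\<^bsub>\<Lambda>.P\<^esub> powser_t \<Lambda> [^]\<^bsub>\<Lambda>.P\<^esub> w ij =
        \<iota> (cga_map K GN TN GN TN (\<lambda>y. inv\<^bsub>G\<^esub> g \<otimes>\<^bsub>G\<^esub> y \<otimes>\<^bsub>G\<^esub> g)
          (cga_of K GN TN (flag_gen G x g ij) \<ominus>\<^bsub>GN.S\<^esub> \<one>\<^bsub>GN.S\<^esub>))"
  shows "unipotent_powser_automorphism \<Lambda> \<sigma>"
proof -
  have hom: "\<sigma> \<in> ring_hom \<Lambda>.P \<Lambda>.P" using iso by (simp add: ring_iso_def)
  interpret \<sigma>: ring_hom_ring \<Lambda>.P \<Lambda>.P \<sigma>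
    by (rule ring_hom_ringI2[OF \<Lambda>t.ring_axioms \<Lambda>t.ring_axioms hom])
  define \<tau> where "\<tau> = (\<lambda>f. f 0) \<circ> (\<sigma> \<circ> powser_const \<Lambda>)"
  have \<tau>: "\<tau> \<in> ring_hom \<Lambda> \<Lambda>"
    unfolding \<tau>_def
    by (rule ring_hom_trans[OF ring_hom_trans[OF \<Lambda>.powser_const_hom hom] \<Lambda>.powser_constant_term_hom])
  have const: "powser_const \<Lambda> a \<in> carrier \<Lambda>.P" if "a \<in> carrier \<Lambda>" for a
    using that by (rule \<Lambda>.powser_const_carrier)
  have "\<tau> (free_var K ij) = free_var K ij" if ij: "ij \<in> flag_index n l" for ij
  proof -
    have "\<tau> (free_var K ij) = (\<sigma> (powser_const \<Lambda> (free_var K ij)) \<otimes>\<^bsub>\<Lambda>.P\<^esub> powser_t \<Lambda> [^]\<^bsub>\<Lambda>.P\<^esub> w ij) (w ij)"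
      using \<Lambda>.powser_mult_t_pow(2)[OF \<sigma>.hom_closed[OF const[OF free_var_closed[OF ij]]]] by (simp add: \<tau>_def)
    then show ?thesis using gen[OF ij] conj_generator[OF ij] by simp
  qed
  then have \<tau>id: "\<tau> a = a" if "a \<in> carrier \<Lambda>" for a
    using free_algebra_endomorphism_identity[OF prime \<Lambda>_ring \<tau>] that by blast
  show ?thesis
  proof
    show "\<sigma> f 0 = f 0" if f: "f \<in> carrier \<Lambda>.P" for f
    proof -
      define s where "s = (\<lambda>k. f (Suc k))"
      have s: "s \<in> carrier \<Lambda>.P" unfolding s_def using f by (intro \<Lambda>.P_I) simp
      have c: "powser_const \<Lambda> (f 0) \<in> carrier \<Lambda>.P" using f by (intro const) simp
      note ts = \<Lambda>t.m_closed[OF \<Lambda>.powser_t_carrier s]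
      have "f = powser_const \<Lambda> (f 0) \<oplus>\<^bsub>\<Lambda>.P\<^esub> (powser_t \<Lambda> \<otimes>\<^bsub>\<Lambda>.P\<^esub> s)"
      proof
        fix k
        show "f k = (powser_const \<Lambda> (f 0) \<oplus>\<^bsub>\<Lambda>.P\<^esub> (powser_t \<Lambda> \<otimes>\<^bsub>\<Lambda>.P\<^esub> s)) k"
          unfolding \<Lambda>.P_add \<Lambda>.powser_mult_t[OF s] using f by (cases k) (simp_all add: powser_const_def s_def)
      qed
      then have "\<sigma> f = \<sigma> (powser_const \<Lambda> (f 0)) \<oplus>\<^bsub>\<Lambda>.P\<^esub> (powser_t \<Lambda> \<otimes>\<^bsub>\<Lambda>.P\<^esub> \<sigma> s)"
        using \<sigma>.hom_add[OF c ts] \<sigma>.hom_mult[OF \<Lambda>.powser_t_carrier s] t by simp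
      then have "\<sigma> f 0 = \<tau> (f 0) \<oplus>\<^bsub>\<Lambda>\<^esub> \<zero>\<^bsub>\<Lambda>\<^esub>"
        by (simp add: \<Lambda>.P_add \<Lambda>.powser_mult_t[OF \<sigma>.hom_closed[OF s]] \<tau>_def)
      then show ?thesis using \<tau>id f by simp
    qed
  qed (use iso t in auto)
qed

end


theorem proposition5p3:
  fixes p n l :: nat
    and F :: "'f monoid" and TF :: "'f topology" and X h :: "nat \<Rightarrow> 'f" and \<gamma> :: 'f
    and G :: "'g monoid" and TG :: "'g topology" and \<pi> :: "'f \<Rightarrow> 'g"
    and x :: "nat \<Rightarrow> 'g" and g :: 'g and N :: "'g set"
    and GN :: "'g monoid" and TN :: "'g topology"
    and K :: "int ring" and R :: "('g set \<Rightarrow> 'g set \<Rightarrow> int) ring"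
    and xi :: "nat \<times> nat \<Rightarrow> 'g" and w :: "nat \<times> nat \<Rightarrow> nat"
    and \<sigma>\<^sub>R :: "('g set \<Rightarrow> 'g set \<Rightarrow> int) \<Rightarrow> 'g set \<Rightarrow> 'g set \<Rightarrow> int"
    and \<Lambda> :: "((nat \<times> nat) list \<Rightarrow> int) ring"
    and \<Lambda>t :: "(nat \<Rightarrow> (nat \<times> nat) list \<Rightarrow> int) ring"
    and \<iota> :: "('g set \<Rightarrow> 'g set \<Rightarrow> int) \<Rightarrow> nat \<Rightarrow> (nat \<times> nat) list \<Rightarrow> int"
    and \<sigma> \<delta> :: "(nat \<Rightarrow> (nat \<times> nat) list \<Rightarrow> int) \<Rightarrow> nat \<Rightarrow> (nat \<times> nat) list \<Rightarrow> int"
    and D :: "'d ring" and e :: "((nat \<times> nat) list \<Rightarrow> int) \<Rightarrow> 'd"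
    and Dt :: "(nat \<Rightarrow> 'd) ring"
  assumes "prime p"
    and "mild_flag_presentation p n l F TF X \<gamma> h G TG \<pi>"
    and "x = (\<lambda>i. \<pi> (X i))" and "g = \<pi> \<gamma>"
    and "N = closed_normal_closure G TG (x ` {1..n})"
    and "GN = G\<lparr>carrier := N\<rparr>" and "TN = subtopology TG N"
    and "xi = flag_gen G x g"
    and "w = (\<lambda>ij. grp_weight p G TG (xi ij))"
    and "K = residue_ring (int p)"
    and "R = completed_group_algebra K GN TN"
    and "\<sigma>\<^sub>R = cga_map K GN TN GN TN (\<lambda>y. inv\<^bsub>G\<^esub> g \<otimes>\<^bsub>G\<^esub> y \<otimes>\<^bsub>G\<^esub> g)"
    and "\<Lambda> = free_algebra K (flag_index n l)"
    and "\<Lambda>t = powser_ring \<Lambda>"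
    \<comment> \<open>the continuous embedding \<open>\<iota>\<close> of \<open>R\<close>\<close>
    and "\<iota> \<in> ring_hom R \<Lambda>t" and "inj_on \<iota> (carrier R)"
    and "continuous_map (cga_topology K GN TN) (tadic_topology \<Lambda>) \<iota>"
    and "\<And>ij. ij \<in> flag_index n l \<Longrightarrow>
           \<iota> (cga_of K GN TN (xi ij) \<ominus>\<^bsub>R\<^esub> \<one>\<^bsub>R\<^esub>) =
             powser_const \<Lambda> (free_var K ij) \<otimes>\<^bsub>\<Lambda>t\<^esub> powser_t \<Lambda> [^]\<^bsub>\<Lambda>t\<^esub> w ij"
    \<comment> \<open>the associated automorphism; division by a power of \<open>t\<close> is written as a product\<close>
    and "\<sigma> \<in> ring_iso \<Lambda>t \<Lambda>t" and "\<sigma> (powser_t \<Lambda>) = powser_t \<Lambda>"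
    and "\<And>ij. ij \<in> flag_index n l \<Longrightarrow>
           \<sigma> (powser_const \<Lambda> (free_var K ij)) \<otimes>\<^bsub>\<Lambda>t\<^esub> powser_t \<Lambda> [^]\<^bsub>\<Lambda>t\<^esub> w ij =
             \<iota> (\<sigma>\<^sub>R (cga_of K GN TN (xi ij) \<ominus>\<^bsub>R\<^esub> \<one>\<^bsub>R\<^esub>))"
    and "\<delta> = minus_id \<Lambda>t \<sigma>"
    and "universal_division_ring TYPE(nat \<Rightarrow> 'd) \<Lambda> D e"
    and "Dt = powser_ring D"
  shows "\<exists>\<sigma>' \<delta>'.
    \<sigma>' \<in> ring_iso Dt Dt \<and> (\<forall>f\<in>carrier \<Lambda>t. \<sigma>' (e \<circ> f) = e \<circ> \<sigma> f) \<and>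
    \<delta>' = minus_id Dt \<sigma>' \<and> sigma_derivation Dt \<sigma>' \<delta>' \<and>
    (\<forall>f\<in>carrier \<Lambda>t. \<delta>' (e \<circ> f) = e \<circ> \<delta> f) \<and>
    \<delta>' ` carrier Dt \<subseteq> {powser_t D \<otimes>\<^bsub>Dt\<^esub> f | f. f \<in> carrier Dt} \<and>
    homeomorphic_map (tadic_topology \<Lambda>) (tadic_topology \<Lambda>) \<sigma> \<and>
    topologically_nilpotent \<Lambda>t (tadic_topology \<Lambda>) \<delta> \<and>
    homeomorphic_map (tadic_topology D) (tadic_topology D) \<sigma>' \<and>
    topologically_nilpotent Dt (tadic_topology D) \<delta>' \<and>
    ring_embedding (skew_powser_ring \<Lambda>t (tadic_topology \<Lambda>) \<sigma> \<delta>)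
      (skew_powser_ring Dt (tadic_topology D) \<sigma>' \<delta>') (\<lambda>f i. e \<circ> f i)"
proof -
  interpret flag: mild_flag p n l F TF X h \<gamma> G TG \<pi>
    using assms(1,2) by unfold_locales
  \<comment> \<open>The statement introduces its objects by equations. Identifying them with the
    constants of the locales allows the hypotheses to be transferred by unfolding.\<close>
  have x: "x = flag.x" and g: "g = flag.g" using assms(3,4) by (simp_all add: flag.x_def flag.g_def fun_eq_iff)
  have N: "N = flag.N" using assms(5) by (simp add: x flag.N_def)
  have GN: "GN = flag.GN" and TN: "TN = flag.TN" using assms(6,7) by (simp_all add: N flag.GN_def flag.TN_def)
  have \<Lambda>: "\<Lambda> = free_algebra flag.K (flag_index n l)" using assms(10,13) by simp
  have e: "is_division_ring D" "e \<in> ring_hom \<Lambda> D" "inj_on e (carrier \<Lambda>)"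
    using assms(23) by (simp_all add: universal_division_ring_def)
  interpret flag: mild_flag_embedding p n l F TF X h \<gamma> G TG \<pi> \<iota> D e
  proof
    show "is_division_ring D" by (rule e)
    show "e \<in> ring_hom (free_algebra flag.K (flag_index n l)) D"
      "inj_on e (carrier (free_algebra flag.K (flag_index n l)))"
      using e by (simp_all only: \<Lambda>)
    show "\<iota> \<in> ring_hom flag.GN.S (powser_ring (free_algebra flag.K (flag_index n l)))"
      using assms(15) unfolding assms(14) assms(11) \<Lambda> GN TN assms(10) .
    show "continuous_map (cga_topology flag.K flag.GN flag.TN) (tadic_topology (free_algebra flag.K (flag_index n l))) \<iota>"
      using assms(17) unfolding \<Lambda> GN TN assms(10) .
  next
    fix ij assume "ij \<in> flag_index n l"
    from assms(18)[OF this] show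
      "\<iota> (cga_of flag.K flag.GN flag.TN (flag_gen G flag.x flag.g ij) \<ominus>\<^bsub>flag.GN.S\<^esub> \<one>\<^bsub>flag.GN.S\<^esub>) =
        powser_const (free_algebra flag.K (flag_index n l)) (free_var flag.K ij)
          \<otimes>\<^bsub>powser_ring (free_algebra flag.K (flag_index n l))\<^esub>
        powser_t (free_algebra flag.K (flag_index n l))
          [^]\<^bsub>powser_ring (free_algebra flag.K (flag_index n l))\<^esub> grp_weight p G TG (flag_gen G flag.x flag.g ij)"
      unfolding assms(14) assms(9) assms(8) assms(11) \<Lambda> GN TN x g assms(10) .
  qed
  have uni: "unipotent_powser_automorphism \<Lambda> \<sigma>"
    unfolding \<Lambda>
  proof (rule flag.automorphism_unipotent)
    show "\<sigma> \<in> ring_iso (powser_ring flag.\<Lambda>) (powser_ring flag.\<Lambda>)" using assms(19) unfolding assms(14) \<Lambda> .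
    show "\<sigma> (powser_t flag.\<Lambda>) = powser_t flag.\<Lambda>" using assms(20) unfolding \<Lambda> .
    fix ij assume "ij \<in> flag_index n l"
    from assms(21)[OF this] show
      "\<sigma> (powser_const flag.\<Lambda> (free_var flag.K ij)) \<otimes>\<^bsub>powser_ring flag.\<Lambda>\<^esub> powser_t flag.\<Lambda> [^]\<^bsub>powser_ring flag.\<Lambda>\<^esub> flag.w ij =
        \<iota> (cga_map flag.K flag.GN flag.TN flag.GN flag.TN (\<lambda>y. inv\<^bsub>G\<^esub> flag.g \<otimes>\<^bsub>G\<^esub> y \<otimes>\<^bsub>G\<^esub> flag.g)
          (cga_of flag.K flag.GN flag.TN (flag_gen G flag.x flag.g ij) \<ominus>\<^bsub>flag.GN.S\<^esub> \<one>\<^bsub>flag.GN.S\<^esub>))"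
      unfolding assms(14) assms(12) assms(9) assms(8) assms(11) \<Lambda> GN TN x g assms(10) .
  qed
  obtain \<sigma>' where \<sigma>': "unipotent_powser_automorphism D \<sigma>'"
    and ext: "\<And>f. f \<in> carrier (powser_ring \<Lambda>) \<Longrightarrow> \<sigma>' (e \<circ> f) = e \<circ> \<sigma> f"
    using powser_automorphism_extends[OF uni assms(23)] by blast
  interpret A: unipotent_powser_automorphism \<Lambda> \<sigma> by (rule uni)
  interpret B: unipotent_powser_automorphism D \<sigma>' by (rule \<sigma>')
  interpret e: ring_hom_ring \<Lambda> D e by (rule ring_hom_ringI2[OF A.ring_axioms flag.D.ring_axioms e(2)])
  have \<delta>: "\<delta> = A.\<delta>" using assms(22) by (simp only: assms(14) A.\<delta>_def)
  have e_minus: "e (u \<ominus>\<^bsub>\<Lambda>\<^esub> v) = e u \<ominus>\<^bsub>D\<^esub> e v" if "u \<in> carrier \<Lambda>" "v \<in> carrier \<Lambda>" for u v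
    using that by (simp add: a_minus_def)
  have ext_\<delta>: "B.\<delta> (e \<circ> f) = e \<circ> \<delta> f" if f: "f \<in> carrier A.P" for f
  proof
    fix k
    have "B.\<delta> (e \<circ> f) k = e (\<sigma> f k) \<ominus>\<^bsub>D\<^esub> e (f k)"
      unfolding B.\<delta>_def minus_id_def ext[OF f]
      by (subst B.powser_minus_apply) (use f in \<open>auto intro: B.P_I\<close>)
    also have "\<dots> = e (\<delta> f k)"
      unfolding \<delta> A.\<delta>_def minus_id_def A.powser_minus_apply[OF f]
      by (rule e_minus[symmetric]) (use f in auto)
    finally show "B.\<delta> (e \<circ> f) k = (e \<circ> \<delta> f) k" by simp
  qed
  show ?thesis
    unfolding assms(14,24)
  proof (intro exI conjI)
    show "\<sigma>' \<in> ring_iso B.P B.P" by (rule B.\<sigma>_iso)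
    show "\<forall>f\<in>carrier A.P. \<sigma>' (e \<circ> f) = e \<circ> \<sigma> f" using ext by blast
    show "B.\<delta> = minus_id B.P \<sigma>'" by (rule B.\<delta>_def)
    show "sigma_derivation B.P \<sigma>' B.\<delta>" by (rule B.sigma_derivation_\<delta>)
    show "\<forall>f\<in>carrier A.P. B.\<delta> (e \<circ> f) = e \<circ> \<delta> f" using ext_\<delta> by blast
    show "B.\<delta> ` carrier B.P \<subseteq> {powser_t D \<otimes>\<^bsub>B.P\<^esub> f | f. f \<in> carrier B.P}" by (rule B.\<delta>_divisible)
    show "homeomorphic_map (tadic_topology \<Lambda>) (tadic_topology \<Lambda>) \<sigma>" by (rule A.homeomorphic_map_\<sigma>)
    show "topologically_nilpotent A.P (tadic_topology \<Lambda>) \<delta>" unfolding \<delta> by (rule A.topologically_nilpotent_\<delta>)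
    show "homeomorphic_map (tadic_topology D) (tadic_topology D) \<sigma>'" by (rule B.homeomorphic_map_\<sigma>)
    show "topologically_nilpotent B.P (tadic_topology D) B.\<delta>" by (rule B.topologically_nilpotent_\<delta>)
    show "ring_embedding (skew_powser_ring A.P (tadic_topology \<Lambda>) \<sigma> \<delta>)
        (skew_powser_ring B.P (tadic_topology D) \<sigma>' B.\<delta>) (\<lambda>f i. e \<circ> f i)"
      unfolding \<delta> A.\<delta>_def B.\<delta>_def by (rule skew_powser_embedding[OF uni \<sigma>' e(2,3) ext])
  qed
qed

end
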